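(* Consider the CP-SGD algorithm (defined in the context) run on the problem $\min_{x\in\mathbb{R}^d} f(x)=\frac1n\sum_{i=1}^n f_i(x)$ over a network of $n$ agents. Suppose: (1) the undirected communication graph is connected; (2) each $f_i:\mathbb{R}^d\to\mathbb{R}$ is $L_f$-smooth for some $L_f>0$, i.e. $\|\nabla f_i(x)-\nabla f_i(y)\|\le L_f\|x-y\|$ for all $x,y\in\mathbb{R}^d$; (3) the random variables $\{\xi_{i,k}\}$ (over all agents $i$ and iterations $k$) are mutually independent; (4) $\mathbb{E}_{\xi_{i,k}}[g_i(x,\xi_{i,k})]=\nabla f_i(x)$ for all $i$, $k$, $x\in\mathbb{R}^d$; (5) there is $\sigma>0$ with $\mathbb{E}_{\xi_{i,k}}\|g_i(x,\xi_{i,k})-\nabla f_i(x)\|^2\le\sigma^2$ for all $i$, $k$, $x\in\mathbb{R}^d$; (6) $f^*:=\inf_x f(x)>-\infty$; (7) (Polyak--Łojasiewicz) there is $\nu>0$ with $\frac12\|\nabla f(x)\|^2\ge\nu(f(x)-f^* )$ for all $x\in\mathbb{R}^d$; (8) there are constants $\varphi\in(0,1]$, $r>0$ such that the (possibly random) compressor $C:\mathbb{R}^d\to\mathbb{R}^d$ satisfies $\mathbb{E}_C\big[\|C(x)/r-x\|^2\big]\le(1-\varphi)\|x\|^2$ for all $x\in\mathbb{R}^d$. Let $\gamma_k=\beta_1\omega_k$, $\omega_k=\omega>\beta_3$, $\eta_k=\eta=\beta_2/\omega$ for all $k$, and $\alpha_x\in(0,\frac1r)$, where $\beta_1>c_0$,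 $\beta_2>0$. Then, with $\bar x_k=\frac1n\sum_{i=1}^nx_{i,k}$, for all integers $k\ge0$, $$\mathbb{E}\Big[\sum_{i=1}^n\|x_{i,k+1}-\bar x_{k+1}\|^2+n\big(f(\bar x_{k+1})-f^*\big)\Big]\le(1-\eta\bar\beta)^{k+1}\frac{V_0}{\check c_1}+\frac{\check c_2\sigma^2\eta}{\bar\beta\,\check c_1},$$ where $\bar\beta,\beta_3,c_0,\check c_1,\check c_2,V_0$ are the positive quantities given in the context, and $0<\eta\bar\beta\le\frac23$.
   Context: Network. $\mathcal{G}=(\mathcal{V},\mathcal{E})$ is an undirected graph on $\mathcal{V}=\{1,\dots,n\}$ with symmetric weight matrix $W=[w_{ij}]$, $w_{ij}>0$ if $(i,j)\in\mathcal{E}$ and $w_{ij}=0$ otherwise; $D=\mathrm{diag}(d_1,\dots,d_n)$, $d_i=\sum_j w_{ij}$; Laplacian $L=D-W=[L_{ij}]$. $\bar\lambda_L$ is the spectral radius of $L$ and $\underline\lambda_L$ its smallest positive eigenvalue. $\|\cdot\|$ is the Euclidean norm and $\|x\|_A^2=x^\top Ax$. Algorithm (CP-SGD). Agent $i$ has access only to stochastic gradients $g_i(x,\xi_{i,k})$ of $f_i$. Positive parameters $\{\eta_k\},\{\gamma_k\},\{\omega_k\},\alpha_x$ are given. Initialization: $x_{i,0}\in\mathbb{R}^d$ arbitrary, $x_{i,0}^c=\mathbf{0}_d$, $v_{i,0}=\mathbf{0}_d$. For $k=0,1,\dots$ and every $i$: $$\hat x_{i,k}=x_{i,k}^c+C(x_{i,k}-x_{i,k}^c),\qquad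 x_{i,k+1}^c=(1-\alpha_x)x_{i,k}^c+\alpha_x\hat x_{i,k},$$ $$x_{i,k+1}=x_{i,k}-\eta_k\Big(\gamma_k\sum_{j=1}^nL_{ij}\hat x_{j,k}+\omega_kv_{i,k}+g_i(x_{i,k},\xi_{i,k})\Big),\qquad v_{i,k+1}=v_{i,k}+\eta_k\omega_k\sum_{j=1}^nL_{ij}\hat x_{j,k}.$$ $\mathbb{E}_{\xi_{i,k}}$ is expectation over $\xi_{i,k}$ with $x$ fixed, $\mathbb{E}_C$ is expectation over the internal randomness of the compressor with $x$ fixed (this randomness is drawn afresh at each use), and $\mathbb{E}$ is total expectation. Initial Lyapunov value. Let $K_n=I_n-\frac1n\mathbf 1_n\mathbf 1_n^\top$, $\mathbf K=K_n\otimes I_d$. Let $0<\lambda_2\le\dots\le\lambda_n$ be the nonzero eigenvalues of $L$, $\rho=\frac{1}{\sqrt n}\mathbf 1_n$, and $R\in\mathbb{R}^{n\times(n-1)}$ with $[\rho\ R]$ orthogonal and $L=R\Lambda_1R^\top$, $\Lambda_1=\mathrm{diag}(\lambda_2,\dots,\lambda_n)$; set $P=\lambda_n^{-1}\rho\rho^\top+R\Lambda_1^{-1}R^\top$, $\mathbf P=P\otimes I_d$. With stacked vectors $\mathbf x_0,\mathbf v_0,\mathbf x_0^c\in\mathbb{R}^{nd}$ of $x_{i,0},v_{i,0},x_{i,0}^c$ (so $\mathbf v_0=\mathbf x_0^c=\mathbf 0$) and $\mathbf g_0^b\in\mathbb{R}^{nd}$ the stacked vector of $\nabla f_i(\bar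 x_0)$, $$V_0=\tfrac12\|\mathbf x_0\|_{\mathbf K}^2+\tfrac{1+\beta_1}{2}\big\|\mathbf v_0+\tfrac1\omega\mathbf g_0^b\big\|_{\mathbf P}^2+\mathbf x_0^\top\mathbf K\mathbf P\big(\mathbf v_0+\tfrac1\omega\mathbf g_0^b\big)+n(f(\bar x_0)-f^* )+\|\mathbf x_0-\mathbf x_0^c\|^2 .$$ Constants. Fix any $\beta_5>0$. With $\gamma=\beta_1\omega$, $r_0=2r^2(1-\varphi)+2(1-r)^2$, $\varphi_2=\alpha_xr\varphi$, set - $c_0=\max\{\frac{9+\beta_5}{2\underline\lambda_L},1\}$; - $\tilde\epsilon_1=\frac{\gamma}{2}\underline\lambda_L-\big(\frac{9\omega+4}{4}+\frac54L_f^2\big)$; - $\tilde\epsilon_2=(12+\frac{16}{\varphi_2})L_f^2+(4+\frac{8}{\varphi_2})\gamma^2\bar\lambda_L^2+1+2\omega^2+3\gamma^2\bar\lambda_L^2$; - $\epsilon_4=\frac{3\omega-1}{4}-3\underline\lambda_L^{-1}$; - $\epsilon_5=\omega^2\bar\lambda_L+\underline\lambda_L^{-1}+(4+\frac{8}{\varphi_2})\omega^2\underline\lambda_L$; - $\epsilon_6=\frac18-\big(\frac{2(1+\beta_1)}{\omega^2\underline\lambda_L}+\frac{1}{\omega^2\underline\lambda_L^2}\big)L_f^2$; - $\epsilon_7=\big(\frac{1+\beta_1}{\omega^2\underline\lambda_L}+\frac{1}{\omega^2\underline\lambda_L^2}+\frac32\big)L_f^2+L_f$; - $\epsilon_9=11+\frac{16}{\varphi_2}$;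 - $\epsilon_{10}=\frac{\varphi_2}{2}+\frac{\varphi_2^2}{2}$; - $\epsilon_{11}=\frac12(\gamma+2\omega)\bar\lambda_Lr_0+2\omega r_0$; - $\epsilon_{12}=\frac{(8+7\varphi_2)\gamma^2\bar\lambda_L^2r_0}{\varphi_2}+(1+2\omega^2)r_0$; - $\beta_4=\min\big\{\frac{\tilde\epsilon_1}{\tilde\epsilon_2},\frac{\epsilon_4}{\epsilon_5},\frac{\epsilon_6}{\epsilon_7},\frac{\sqrt{\epsilon_{11}^2+4\epsilon_{10}\epsilon_{12}}-\epsilon_{11}}{2\epsilon_{12}},1\big\}$; - $\beta_6=\big(\frac{16(1+\beta_1)}{\underline\lambda_L}+\frac{8}{\underline\lambda_L^2}\big)L_f^2$; - $\beta_3=\max\big\{\frac{4+5L_f^2}{\beta_5},\frac{12\underline\lambda_L^{-1}+1}{3},\sqrt{\beta_6},\frac{\beta_2}{\beta_4},4\beta_2L_f\big\}$; - $c_1=\big(\frac{2(1+\beta_1)^2}{\beta_2\beta_3\underline\lambda_L}+\frac{1+\beta_1}{\beta_3^2\underline\lambda_L}+\frac{1}{\beta_2\beta_3\underline\lambda_L^2}+\frac{1}{\beta_3^2\underline\lambda_L^2}+\frac32\big)L_f^2+L_f$; - $\check c_1=\frac{\gamma\underline\lambda_L-\omega}{2\gamma\underline\lambda_L}$, $\ \check c_2=c_1+n\epsilon_9$; - $\beta_8=\max\{\frac12+\beta_1,\frac{\gamma\underline\lambda_L+\omega}{2\gamma\underline\lambda_L}\}$; - $\beta_9=\eta\min\{\tilde\epsilon_1-\tilde\epsilon_2\eta,\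 \epsilon_4-\epsilon_5\eta,\ \frac\nu2,\ \frac{\epsilon_{10}}{\eta}-\epsilon_{11}-\epsilon_{12}\eta\}$; - $\bar\beta=\frac{\beta_9}{\eta\beta_8}$. Since $\beta_4$ depends on $\omega$, so does $\beta_3$; the requirement $\omega>\beta_3$ is read as a condition on $\omega$ with $\beta_3$ evaluated at that $\omega$.
   Formalization: V_0 is shown to be nonnegative rather than positive, since V_0 = 0 when x_0 = 0 is a common stationary minimizer; and for φ = r = 1, where the fourth entry of β_4 is the undefined 0/0, that entry is omitted from the minimum. *)

theory Defs
  imports "HOL-Probability.Probability"
begin

section \<open>Graph, Laplacian, spectrum\<close>

text \<open>
  The agents are the elements of a finite type \<^typ>\<open>'n\<close>. Self-loops are not excluded: a diagonal
  entry of the weight matrix cancels in the Laplacian.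
\<close>

definition weighted_graph :: "('n \<times> 'n) set \<Rightarrow> real^'n^'n \<Rightarrow> bool" where
  "weighted_graph E W \<longleftrightarrow> sym E \<and> transpose W = W \<and>
     (\<forall>i j. ((i, j) \<in> E \<longrightarrow> W $ i $ j > 0) \<and> ((i, j) \<notin> E \<longrightarrow> W $ i $ j = 0))"

definition connected_graph :: "('n \<times> 'n) set \<Rightarrow> bool" where
  "connected_graph E \<longleftrightarrow> (\<forall>i j. (i, j) \<in> E\<^sup>*)"

definition diag_mat :: "real^'n \<Rightarrow> real^'n^'n" where
  "diag_mat d = (\<chi> i j. if i = j then d $ i else 0)"

definition laplacian :: "real^'n^'n \<Rightarrow> real^'n^'n" where
  "laplacian W = diag_mat (\<chi> i. \<Sum>j\<in>UNIV. W $ i $ j) - W"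

definition is_eigenvalue :: "'a::field^'n^'n \<Rightarrow> 'a \<Rightarrow> bool" where
  "is_eigenvalue A \<mu> \<longleftrightarrow> (\<exists>v. v \<noteq> 0 \<and> A *v v = \<mu> *s v)"

definition spec_radius :: "real^'n^'n \<Rightarrow> real" where
  "spec_radius A = Max {cmod \<mu> |\<mu>. is_eigenvalue (map_matrix complex_of_real A) \<mu>}"

definition min_pos_eigenvalue :: "real^'n^'n \<Rightarrow> real" where
  "min_pos_eigenvalue A = Min {\<mu>. 0 < \<mu> \<and> is_eigenvalue A \<mu>}"

definition outer :: "real^'n \<Rightarrow> real^'n \<Rightarrow> real^'n^'n" where
  "outer u v = (\<chi> i j. u $ i * v $ j)"

definition K_mat :: "real^'n^'n" where
  "K_mat = mat 1 - (1 / real CARD('n)) *\<^sub>R outer 1 1"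

definition rho_vec :: "real^'n" where
  "rho_vec = (1 / sqrt (real CARD('n))) *\<^sub>R 1"

text \<open>
  The index type \<^typ>\<open>'m\<close> has one element less than \<^typ>\<open>'n\<close>; the last three conditions on
  \<^term>\<open>R\<close> say that the square matrix \<open>[\<rho> R]\<close> is orthogonal. Since \<^typ>\<open>'m\<close> is nonempty,
  there are at least two agents. The positive eigenvalues are listed with multiplicity, in no
  particular order, so the largest one is \<^term>\<open>Max (range (($) lam))\<close>.
\<close>

definition laplacian_eigen_decomp :: "real^'n^'n \<Rightarrow> real^'m \<Rightarrow> real^'m^'n \<Rightarrow> bool" where
  "laplacian_eigen_decomp L lam R \<longleftrightarrow>
     CARD('n) = CARD('m) + 1 \<and> (\<forall>k. 0 < lam $ k) \<and>
     L = R ** diag_mat lam ** transpose R \<and>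
     transpose R ** R = mat 1 \<and> transpose R *v rho_vec = 0 \<and>
     outer rho_vec rho_vec + R ** transpose R = mat 1"

definition P_mat :: "real^'m \<Rightarrow> real^'m^'n \<Rightarrow> real^'n^'n" where
  "P_mat lam R = (1 / Max (range (($) lam))) *\<^sub>R outer rho_vec rho_vec
     + R ** matrix_inv (diag_mat lam) ** transpose R"

text \<open>
  A stacked vector in \<open>\<real>\<^sup>n\<^sup>d\<close> is an element of \<^typ>\<open>real^'d^'n\<close>, whose norm and inner product
  are the Euclidean ones; \<open>kron_id A\<close> is multiplication by \<open>A \<otimes> I\<^sub>d\<close>.
\<close>

definition kron_id :: "real^'n^'n \<Rightarrow> real^'d^'n \<Rightarrow> real^'d^'n" where
  "kron_id A x = (\<chi> i. \<Sum>j\<in>UNIV. (A $ i $ j) *\<^sub>R (x $ j))"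

definition wnorm_sq :: "real^'n^'n \<Rightarrow> real^'d^'n \<Rightarrow> real" where
  "wnorm_sq A x = x \<bullet> kron_id A x"

definition agent_mean :: "('n::finite \<Rightarrow> 'v::real_vector) \<Rightarrow> 'v" where
  "agent_mean y = (1 / real CARD('n)) *\<^sub>R (\<Sum>i\<in>UNIV. y i)"


section \<open>Objective\<close>

definition grad :: "('v::real_inner \<Rightarrow> real) \<Rightarrow> 'v \<Rightarrow> 'v" where
  "grad h x = (THE D. GDERIV h x :> D)"

definition L_smooth :: "real \<Rightarrow> ('v::real_inner \<Rightarrow> real) \<Rightarrow> bool" where
  "L_smooth l h \<longleftrightarrow> (\<forall>x. \<exists>D. GDERIV h x :> D) \<and>
     (\<forall>x y. norm (grad h x - grad h y) \<le> l * norm (x - y))"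

definition avg_obj :: "('n::finite \<Rightarrow> 'v \<Rightarrow> real) \<Rightarrow> 'v \<Rightarrow> real" where
  "avg_obj f x = (1 / real CARD('n)) * (\<Sum>i\<in>UNIV. f i x)"

definition polyak_lojasiewicz :: "real \<Rightarrow> ('v::real_inner \<Rightarrow> real) \<Rightarrow> bool" where
  "polyak_lojasiewicz mu h \<longleftrightarrow> (\<forall>x. 1 / 2 * (norm (grad h x))\<^sup>2 \<ge> mu * (h x - Inf (range h)))"


section \<open>Randomness\<close>

text \<open>
  The random compressor is a map \<open>C c x\<close> whose internal randomness \<open>c\<close> has law \<open>Q\<close>.
  Integrability is required explicitly because the Bochner integral of a non-integrable function
  is \<open>0\<close>.
\<close>

definition compressor ::
  "'c measure \<Rightarrow> ('c \<Rightarrow> real^'d \<Rightarrow> real^'d) \<Rightarrow> real \<Rightarrow> real \<Rightarrow> bool" where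
  "compressor Q C r ph \<longleftrightarrow> prob_space Q \<and>
     (\<lambda>(c, x). C c x) \<in> borel_measurable (Q \<Otimes>\<^sub>M borel) \<and>
     (\<forall>x. integrable Q (\<lambda>c. (norm ((1 / r) *\<^sub>R C c x - x))\<^sup>2) \<and>
          (\<integral>c. (norm ((1 / r) *\<^sub>R C c x - x))\<^sup>2 \<partial>Q) \<le> (1 - ph) * (norm x)\<^sup>2)"

text \<open>
  \<open>\<zeta> i k\<close> is the compressor randomness used by agent \<open>i\<close> at step \<open>k\<close>. The draws have law \<open>Q\<close> and
  are independent of each other and of all gradient samples \<open>\<xi> i k\<close>. Joint independence is stated
  for the generated families of events, as \<open>\<xi>\<close> and \<open>\<zeta>\<close> take values in different types.
\<close>

definition fresh_compressor_draws ::
  "'w measure \<Rightarrow> ('n \<Rightarrow> 's measure) \<Rightarrow> ('n \<Rightarrow> nat \<Rightarrow> 'w \<Rightarrow> 's) \<Rightarrow>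
   'c measure \<Rightarrow> ('n \<Rightarrow> nat \<Rightarrow> 'w \<Rightarrow> 'c) \<Rightarrow> bool" where
  "fresh_compressor_draws M S \<xi> Q \<zeta> \<longleftrightarrow>
     (\<forall>i k. \<zeta> i k \<in> M \<rightarrow>\<^sub>M Q \<and> distr M Q (\<zeta> i k) = Q) \<and>
     prob_space.indep_sets M
       (\<lambda>a. case a of
          Inl (i, k) \<Rightarrow> {\<xi> i k -` A \<inter> space M |A. A \<in> sets (S i)}
        | Inr (i, k) \<Rightarrow> {\<zeta> i k -` A \<inter> space M |A. A \<in> sets Q})
       (UNIV :: ('n \<times> nat + 'n \<times> nat) set)"

definition stochastic_gradients ::
  "'w measure \<Rightarrow> ('n \<Rightarrow> 's measure) \<Rightarrow> ('n \<Rightarrow> nat \<Rightarrow> 'w \<Rightarrow> 's) \<Rightarrow>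
   ('n \<Rightarrow> real^'d \<Rightarrow> real) \<Rightarrow> ('n \<Rightarrow> real^'d \<Rightarrow> 's \<Rightarrow> real^'d) \<Rightarrow> bool" where
  "stochastic_gradients M S \<xi> f g \<longleftrightarrow>
     (\<forall>i. (\<lambda>(x, s). g i x s) \<in> borel_measurable (borel \<Otimes>\<^sub>M S i)) \<and>
     (\<forall>i k x. integrable M (\<lambda>w. g i x (\<xi> i k w)) \<and>
              (\<integral>w. g i x (\<xi> i k w) \<partial>M) = grad (f i) x)"

definition variance_bounded ::
  "'w measure \<Rightarrow> ('n \<Rightarrow> nat \<Rightarrow> 'w \<Rightarrow> 's) \<Rightarrow> ('n \<Rightarrow> real^'d \<Rightarrow> real) \<Rightarrow>
   ('n \<Rightarrow> real^'d \<Rightarrow> 's \<Rightarrow> real^'d) \<Rightarrow> real \<Rightarrow> bool" where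
  "variance_bounded M \<xi> f g \<sigma> \<longleftrightarrow>
     (\<forall>i k x. integrable M (\<lambda>w. (norm (g i x (\<xi> i k w) - grad (f i) x))\<^sup>2) \<and>
              (\<integral>w. (norm (g i x (\<xi> i k w) - grad (f i) x))\<^sup>2 \<partial>M) \<le> \<sigma>\<^sup>2)"


section \<open>CP-SGD\<close>

text \<open>
  The recursion along one sample path: \<open>s i k\<close> and \<open>c i k\<close> are the realised gradient sample and
  compressor randomness, \<open>xh\<close> and \<open>xc\<close> stand for \<open>\<hat>x\<close> and \<open>x\<^sup>c\<close>.
\<close>

definition cp_sgd ::
  "real^'n^'n \<Rightarrow> ('n \<Rightarrow> real^'d \<Rightarrow> 's \<Rightarrow> real^'d) \<Rightarrow> ('c \<Rightarrow> real^'d \<Rightarrow> real^'d) \<Rightarrow>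
   (nat \<Rightarrow> real) \<Rightarrow> (nat \<Rightarrow> real) \<Rightarrow> (nat \<Rightarrow> real) \<Rightarrow> real \<Rightarrow> real^'d^'n \<Rightarrow>
   ('n \<Rightarrow> nat \<Rightarrow> 's) \<Rightarrow> ('n \<Rightarrow> nat \<Rightarrow> 'c) \<Rightarrow>
   ('n \<Rightarrow> nat \<Rightarrow> real^'d) \<Rightarrow> ('n \<Rightarrow> nat \<Rightarrow> real^'d) \<Rightarrow>
   ('n \<Rightarrow> nat \<Rightarrow> real^'d) \<Rightarrow> ('n \<Rightarrow> nat \<Rightarrow> real^'d) \<Rightarrow> bool" where
  "cp_sgd L g C eta_seq gamma_seq omega_seq ax x0 s c x xh xc v \<longleftrightarrow>
     (\<forall>i. x i 0 = x0 $ i \<and> xc i 0 = 0 \<and> v i 0 = 0) \<and>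
     (\<forall>i k.
        xh i k = xc i k + C (c i k) (x i k - xc i k) \<and>
        xc i (Suc k) = (1 - ax) *\<^sub>R xc i k + ax *\<^sub>R xh i k \<and>
        x i (Suc k) = x i k - eta_seq k *\<^sub>R
          (gamma_seq k *\<^sub>R (\<Sum>j\<in>UNIV. (L $ i $ j) *\<^sub>R xh j k)
           + omega_seq k *\<^sub>R v i k + g i (x i k) (s i k)) \<and>
        v i (Suc k) = v i k
          + (eta_seq k * omega_seq k) *\<^sub>R (\<Sum>j\<in>UNIV. (L $ i $ j) *\<^sub>R xh j k))"


section \<open>Constants\<close>

text \<open>
  \<open>lam_max\<close>, \<open>lam_min\<close> are the spectral radius and the smallest positive eigenvalue of the
  Laplacian; \<open>phi\<close>, \<open>r_C\<close> are the compressor constants and \<open>nu\<close> the Polyak-Lojasiewicz constant.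
\<close>

record params =
  n_agents :: nat
  lam_max :: real
  lam_min :: real
  L_f :: real
  nu :: real
  phi :: real
  r_C :: real
  alpha_x :: real
  omega :: real
  beta1 :: real
  beta2 :: real
  beta5 :: real

definition "gamma p = beta1 p * omega p"
definition "eta p = beta2 p / omega p"
definition "r0 p = 2 * (r_C p)\<^sup>2 * (1 - phi p) + 2 * (1 - r_C p)\<^sup>2"
definition "phi2 p = alpha_x p * r_C p * phi p"

definition "c0 p = max ((9 + beta5 p) / (2 * lam_min p)) 1"

definition "eps1t p = gamma p / 2 * lam_min p - ((9 * omega p + 4) / 4 + 5 / 4 * (L_f p)\<^sup>2)"

definition "eps2t p = (12 + 16 / phi2 p) * (L_f p)\<^sup>2
  + (4 + 8 / phi2 p) * (gamma p)\<^sup>2 * (lam_max p)\<^sup>2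
  + 1 + 2 * (omega p)\<^sup>2 + 3 * (gamma p)\<^sup>2 * (lam_max p)\<^sup>2"

definition "eps4 p = (3 * omega p - 1) / 4 - 3 * (1 / lam_min p)"

definition "eps5 p = (omega p)\<^sup>2 * lam_max p + 1 / lam_min p
  + (4 + 8 / phi2 p) * (omega p)\<^sup>2 * lam_min p"

definition "eps6 p = 1 / 8 - (2 * (1 + beta1 p) / ((omega p)\<^sup>2 * lam_min p)
  + 1 / ((omega p)\<^sup>2 * (lam_min p)\<^sup>2)) * (L_f p)\<^sup>2"

definition "eps7 p = ((1 + beta1 p) / ((omega p)\<^sup>2 * lam_min p)
  + 1 / ((omega p)\<^sup>2 * (lam_min p)\<^sup>2) + 3 / 2) * (L_f p)\<^sup>2 + L_f p"

definition "eps9 p = 11 + 16 / phi2 p"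

definition "eps10 p = phi2 p / 2 + (phi2 p)\<^sup>2 / 2"

definition "eps11 p = 1 / 2 * (gamma p + 2 * omega p) * lam_max p * r0 p + 2 * omega p * r0 p"

definition "eps12 p = (8 + 7 * phi2 p) * (gamma p)\<^sup>2 * (lam_max p)\<^sup>2 * r0 p / phi2 p
  + (1 + 2 * (omega p)\<^sup>2) * r0 p"

text \<open>
  The fourth entry of the minimum is the positive root of \<open>eps10 - eps11 t - eps12 t\<^sup>2\<close>.
  For \<open>phi = r_C = 1\<close> (no compression) \<open>r0 = eps11 = eps12 = 0\<close>, the quotient is \<open>0 / 0\<close> and there
  is no root; its limit as \<open>r0 \<rightarrow> 0\<close> is \<open>+\<infinity>\<close>, so the entry is left out in that case.
\<close>

definition "beta4 p = Min ({eps1t p / eps2t p, eps4 p / eps5 p, eps6 p / eps7 p, 1} \<union>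
  (if eps12 p = 0 then {}
   else {(sqrt ((eps11 p)\<^sup>2 + 4 * eps10 p * eps12 p) - eps11 p) / (2 * eps12 p)}))"

definition "beta6 p = (16 * (1 + beta1 p) / lam_min p + 8 / (lam_min p)\<^sup>2) * (L_f p)\<^sup>2"

definition "beta3 p = Max {(4 + 5 * (L_f p)\<^sup>2) / beta5 p, (12 * (1 / lam_min p) + 1) / 3,
  sqrt (beta6 p), beta2 p / beta4 p, 4 * beta2 p * L_f p}"

definition "c1 p = (2 * (1 + beta1 p)\<^sup>2 / (beta2 p * beta3 p * lam_min p)
  + (1 + beta1 p) / ((beta3 p)\<^sup>2 * lam_min p)
  + 1 / (beta2 p * beta3 p * (lam_min p)\<^sup>2)
  + 1 / ((beta3 p)\<^sup>2 * (lam_min p)\<^sup>2) + 3 / 2) * (L_f p)\<^sup>2 + L_f p"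

definition "c1_check p = (gamma p * lam_min p - omega p) / (2 * gamma p * lam_min p)"

definition "c2_check p = c1 p + real (n_agents p) * eps9 p"

definition "beta8 p = max (1 / 2 + beta1 p)
  ((gamma p * lam_min p + omega p) / (2 * gamma p * lam_min p))"

definition "beta9 p = eta p * Min {eps1t p - eps2t p * eta p, eps4 p - eps5 p * eta p, nu p / 2,
  eps10 p / eta p - eps11 p - eps12 p * eta p}"

definition "beta_bar p = beta9 p / (eta p * beta8 p)"


section \<open>Lyapunov value\<close>

definition V_lyap ::
  "'z params_scheme \<Rightarrow> real^'n^'n \<Rightarrow> ('n \<Rightarrow> real^'d \<Rightarrow> real) \<Rightarrow>
   real^'d^'n \<Rightarrow> real^'d^'n \<Rightarrow> real^'d^'n \<Rightarrow> real" where
  "V_lyap p P f x v xc =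
     (let xbar = agent_mean (($) x);
          y = v + (1 / omega p) *\<^sub>R (\<chi> i. grad (f i) xbar)
      in 1 / 2 * wnorm_sq K_mat x
         + (1 + beta1 p) / 2 * wnorm_sq P y
         + x \<bullet> kron_id K_mat (kron_id P y)
         + real CARD('n) * (avg_obj f xbar - Inf (range (avg_obj f)))
         + (norm (x - xc))\<^sup>2)"

end

theory Submission
  imports Defs
begin

text \<open>
  The proof is a Lyapunov argument. In the eigenbasis of the Laplacian the recursion splits into
  independent modes. For a mode with eigenvalue \<open>l\<close>, let \<open>a\<close> and \<open>y\<close> be the modes of \<open>x\<close> and of
  \<open>v + g\<^sup>b / \<omega>\<close>, where \<open>g\<^sup>b\<close> collects the local gradients at the average. Then, with compression error
  \<open>e\<close>, gradient disagreement \<open>h\<close>, gradient noise \<open>n\<close> and drift \<open>\<Delta>\<close> of \<open>g\<^sup>b\<close>,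
  \<open>a\<^sup>+ = a - \<eta> (\<gamma> l (a + e) + \<omega> y + h + n)\<close> and \<open>y\<^sup>+ = y + \<eta> \<omega> l (a + e) + \<Delta> / \<omega>\<close>.

  The function used is
  \<open>W = \<parallel>x\<parallel>\<^sub>K\<^sup>2 / 2 + q/2 \<parallel>y\<parallel>\<^sub>P\<^sup>2 + th (x \<bullet> K P y) + n (f(xbar) - f\<^sup>*) + \<parallel>x - x\<^sup>c\<parallel>\<^sup>2\<close>,
  of which \<open>V_lyap\<close> is the case \<open>th = 1\<close>, \<open>q = 1 + \<beta>\<^sub>1\<close>. The reason for the two weights is the drift:
  it enters as \<open>(q / \<omega>) (y \<bullet> P \<Delta>)\<close>, while the damping of \<open>y\<close> is only \<open>\<eta> th \<omega> \<parallel>y\<parallel>\<^sub>P\<^sup>2\<close>. If \<open>\<beta>\<^sub>1\<close> is at most of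
  the order of \<open>\<omega>\<close>, the weights of \<open>V_lyap\<close> work (\<open>contracting_weights_moderate_b\<close>). For larger
  \<open>\<beta>\<^sub>1\<close> the damping of \<open>V_lyap\<close> need not control the drift, and the weights \<open>th = 4 / \<beta>\<^sub>1\<close>, \<open>q = 4\<close> are
  used (\<open>contracting_weights_large_b\<close>). They leave a product of \<open>a\<close> and \<open>y\<close>, which \<open>\<gamma> \<parallel>x\<parallel>\<^sub>L\<^sup>2\<close>
  absorbs because the other terms in the consensus error are then small.

  Changing the weights costs nothing in the final bound. The function \<open>W\<close> may start above \<open>V\<^sub>0\<close>, by
  at most \<open>\<delta> \<parallel>x\<^sub>0\<parallel>\<^sub>K\<^sup>2\<close> with \<open>\<delta> = (1 - th) / (2 \<beta>\<^sub>1 lo)\<close>, but it dominates \<open>(c + \<delta>)\<close> times the error, where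
  \<open>c\<close> is the constant \<open>c1_check\<close>. Since \<open>V\<^sub>0 \<ge> c \<parallel>x\<^sub>0\<parallel>\<^sub>K\<^sup>2\<close>, the quotient \<open>W\<^sub>0 / (c + \<delta>)\<close> is at most
  \<open>V\<^sub>0 / c\<close> (\<open>W_le_full_energy\<close>).

  The one-step inequality (\<open>mode_step\<close>, summed in \<open>pathwise_step\<close>) holds for each realisation of the
  compression error and the noise and keeps the terms that are linear in the noise. For a fixed
  state their expectations vanish, by unbiasedness and independence, which gives
  \<open>E W\<^sup>+ \<le> (1 - \<eta> rate) W + \<eta>\<^sup>2 const \<sigma>\<^sup>2\<close> (\<open>expected_step\<close>). As the state is independent of the fresh
  draws, the inequality may be integrated over the state (\<open>energy_recursion\<close>) and iterated.
\<close>

section \<open>One step of a single mode\<close>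

text \<open>
  All cross terms are split by this inequality. The two coefficients are given separately, instead
  of as \<open>t\<close> and \<open>c\<^sup>2 / (4 * t)\<close>, because a cross term may have coefficient \<open>0\<close> and is then split
  with \<open>P = Q = 0\<close>.
\<close>

lemma young_inner:
  fixes u v :: "'v::real_inner"
  assumes "c\<^sup>2 \<le> 4 * P * Q" "0 \<le> P" "0 \<le> Q"
  shows "c * (u \<bullet> v) \<le> P * (norm u)\<^sup>2 + Q * (norm v)\<^sup>2"
proof -
  have "\<bar>c\<bar> \<le> 2 * (sqrt P * sqrt Q)"
    by (rule power2_le_imp_le) (use assms in \<open>auto simp: power_mult_distrib\<close>)
  then have "c * (u \<bullet> v) \<le> 2 * (sqrt P * sqrt Q) * (norm u * norm v)"
  proof -
    have "c * (u \<bullet> v) \<le> \<bar>c\<bar> * \<bar>u \<bullet> v\<bar>"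
      using abs_ge_self[of "c * (u \<bullet> v)"] by (simp add: abs_mult)
    also have "\<dots> \<le> 2 * (sqrt P * sqrt Q) * (norm u * norm v)"
      using \<open>\<bar>c\<bar> \<le> _\<close> Cauchy_Schwarz_ineq2[of u v] assms by (intro mult_mono) auto
    finally show ?thesis .
  qed
  also have "\<dots> \<le> (sqrt P * norm u)\<^sup>2 + (sqrt Q * norm v)\<^sup>2"
    using sum_squares_bound[of "sqrt P * norm u" "sqrt Q * norm v"] by (simp add: algebra_simps)
  also have "\<dots> = P * (norm u)\<^sup>2 + Q * (norm v)\<^sup>2"
    using assms by (simp add: power_mult_distrib)
  finally show ?thesis .
qed

lemma norm_add_sq_le:
  fixes u v :: "'v::real_inner"
  shows "(norm (u + v))\<^sup>2 \<le> 2 * (norm u)\<^sup>2 + 2 * (norm v)\<^sup>2"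
  unfolding power2_norm_eq_inner using inner_ge_zero[of "u - v"]
  by (simp add: inner_simps inner_commute)

text \<open>
  Convexity of the squared norm with weights \<open>1 / c\<^sub>i\<close>. Equal weights would give the factor \<open>4\<close>
  everywhere; unequal ones are needed because the four parts of the search direction have very
  different budgets.
\<close>

lemma norm_sum4_sq_le:
  fixes z1 z2 z3 z4 :: "'v::real_inner" and c1 c2 c3 c4 :: real
  assumes pos: "0 < c1" "0 < c2" "0 < c3" "0 < c4"
    and le: "1 / c1 + 1 / c2 + 1 / c3 + 1 / c4 \<le> 1"
  shows "(norm (z1 + z2 + z3 + z4))\<^sup>2
    \<le> c1 * (norm z1)\<^sup>2 + c2 * (norm z2)\<^sup>2 + c3 * (norm z3)\<^sup>2 + c4 * (norm z4)\<^sup>2"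
proof -
  have y: "2 * (u \<bullet> v) \<le> a / b * (norm u)\<^sup>2 + b / a * (norm v)\<^sup>2"
    if "0 < a" "0 < b" for a b :: real and u v :: 'v
    using that by (intro young_inner) auto
  have k: "a * (1 / c1 + 1 / c2 + 1 / c3 + 1 / c4) * (norm z)\<^sup>2 \<le> a * (norm z)\<^sup>2" if "0 < a" for a and z :: 'v
    using mult_left_mono[OF le, of a] that by (intro mult_right_mono) auto
  have "(norm (z1 + z2 + z3 + z4))\<^sup>2 = (norm z1)\<^sup>2 + (norm z2)\<^sup>2 + (norm z3)\<^sup>2 + (norm z4)\<^sup>2
      + 2 * (z1 \<bullet> z2) + 2 * (z1 \<bullet> z3) + 2 * (z1 \<bullet> z4) + 2 * (z2 \<bullet> z3) + 2 * (z2 \<bullet> z4) + 2 * (z3 \<bullet> z4)"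
    by (simp add: power2_norm_eq_inner inner_add_left inner_add_right inner_commute)
  also have "\<dots> \<le> c1 * (1 / c1 + 1 / c2 + 1 / c3 + 1 / c4) * (norm z1)\<^sup>2
      + c2 * (1 / c1 + 1 / c2 + 1 / c3 + 1 / c4) * (norm z2)\<^sup>2
      + c3 * (1 / c1 + 1 / c2 + 1 / c3 + 1 / c4) * (norm z3)\<^sup>2
      + c4 * (1 / c1 + 1 / c2 + 1 / c3 + 1 / c4) * (norm z4)\<^sup>2"
    using y[OF pos(1,2), of z1 z2] y[OF pos(1,3), of z1 z3] y[OF pos(1,4), of z1 z4]
      y[OF pos(2,3), of z2 z3] y[OF pos(2,4), of z2 z4] y[OF pos(3,4), of z3 z4] pos
    by (simp add: distrib_left distrib_right)
  also have "\<dots> \<le> c1 * (norm z1)\<^sup>2 + c2 * (norm z2)\<^sup>2 + c3 * (norm z3)\<^sup>2 + c4 * (norm z4)\<^sup>2"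
    using k[OF pos(1)] k[OF pos(2)] k[OF pos(3)] k[OF pos(4)] by (intro add_mono) auto
  finally show ?thesis .
qed

text \<open>
  The deterministic constants: \<open>lo\<close> and \<open>hi\<close> enclose the positive eigenvalues of the Laplacian,
  \<open>om\<close> and \<open>b * om\<close> are the gains \<open>\<omega>\<close> and \<open>\<gamma>\<close>, and \<open>s = 1 + 2 / \<phi>\<^sub>2\<close> is the factor with which
  \<open>\<parallel>x\<^sub>k\<^sub>+\<^sub>1 - x\<^sub>k\<parallel>\<^sup>2\<close> enters the recursion of the compression error. The inequality \<open>step_X\<close> says
  that the margin of the consensus error is nonnegative, and \<open>step_G\<close> that the drift of the local
  gradients at the average is slow.
\<close>

locale step_constants =
  fixes lo hi Lf s om b eta :: real
  assumes lo_pos: "0 < lo" and lo_le_hi: "lo \<le> hi" and Lf_pos: "0 < Lf" and s_ge: "3 \<le> s"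
    and eta_pos: "0 < eta" and b_gt_1: "1 < b" and b_lo: "9 / 2 < b * lo"
    and om_lo: "12 + lo < 3 * om * lo"
    and step_X: "eta * ((4 * s + 3) * (b * om * hi)\<^sup>2 + (8 * s + 4) * Lf\<^sup>2 + 1 + 2 * om\<^sup>2)
      \<le> b * om * lo / 2 - (9 * om + 4) / 4 - 5 / 4 * Lf\<^sup>2"
    and step_G: "2 * ((1 + b) * Lf\<^sup>2 / (om\<^sup>2 * lo)) + Lf\<^sup>2 / (om\<^sup>2 * lo\<^sup>2) + eta * Lf \<le> 1 / 8"
begin

lemma om_gt: "1 / 3 < om"
proof -
  have "lo * 1 < lo * (3 * om)" using om_lo lo_pos by (simp only: mult_1_right mult.commute mult.left_commute)
  then have "1 < 3 * om" by (rule mult_left_less_imp_less) (use lo_pos in simp)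
  then show ?thesis by simp
qed

lemma om_lo_gt: "4 < om * lo" using om_lo lo_pos by simp
lemma om_pos: "0 < om" using om_gt by simp
lemma hi_pos: "0 < hi" using lo_pos lo_le_hi by simp
lemma b_pos: "0 < b" using b_gt_1 by simp

end

text \<open>
  In the Lyapunov function a mode with eigenvalue \<open>l\<close> contributes
  \<open>\<parallel>a\<parallel>\<^sup>2 / 2 + q * \<parallel>y\<parallel>\<^sup>2 / (2 * l) + th * (a \<bullet> y) / l\<close>, where \<open>a\<close> and \<open>y\<close> are the modes of \<open>x\<close> and of
  \<open>v + g\<^sup>b / \<omega>\<close>. The term \<open>th\<close> creates the damping \<open>- \<eta> * th * om * \<parallel>y\<parallel>\<^sup>2 / l\<close>. With
  \<open>\<mu> = q - th * b\<close> the remaining products with \<open>y\<close> are \<open>- \<eta> * (1 - \<mu>) * om * (a \<bullet> y)\<close> and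
  \<open>\<eta> * \<mu> * om * (e \<bullet> y)\<close>, with \<open>e\<close> the compression error: \<open>(ca, pb)\<close> and \<open>(p4, Q4)\<close> are the
  coefficients with which they are split. The number \<open>ya\<close> is the part of the damping spent on the
  drift of the gradients, and \<open>cx, ce, cy, ch\<close> split the squared search direction.
\<close>

locale lyapunov_weights = step_constants +
  fixes th q ca pb p4 Q4 ya cx ce cy ch :: real
  assumes th: "0 \<le> th" "th \<le> 1" and q_pos: "0 < q" and q_th: "th * b \<le> q" "q \<le> 1 + th * b"
    and ca: "0 \<le> ca" "ca \<le> 1 / 2" "0 \<le> pb" "((1 - (q - th * b)) * om)\<^sup>2 \<le> 4 * (ca * (b * om)) * pb"
    and p4: "0 \<le> p4" "0 \<le> Q4" "((q - th * b) * om)\<^sup>2 \<le> 4 * p4 * Q4"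
    and ya_pos: "0 < ya"
    and c_pos: "0 < cx" "0 < ce" "0 < cy" "0 < ch"
    and c_sum: "1 / cx + 1 / ce + 1 / cy + 1 / ch \<le> 1"
begin

text \<open>
  The coefficients of the one-step inequality for a mode, per unit of \<open>\<eta>\<close>: decrease in the
  consensus error (\<open>KA\<close>) and in the dual variable (\<open>KB\<close>), increase caused by the compression error
  (\<open>KE\<close>), by the disagreement of the gradients (\<open>KH\<close>) and by their drift (\<open>KD\<close>, not divided by
  \<open>\<eta>\<close>). The squared search direction enters with the factor \<open>cz\<close>: \<open>1 / 2\<close> from \<open>\<parallel>a\<parallel>\<^sup>2 / 2\<close>, \<open>s\<close> from
  the compression error, \<open>th / 8\<close> from its product with the drift.
\<close>

definition "cz = s + 1 / 2 + th / 8"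

definition "KA = (1 / 2 - ca) * (b * om * lo) - th * om - th\<^sup>2 * om / 8 - 1 - th / 4
  - eta * (cz * cx * (b * om * hi)\<^sup>2 + 2 * (q - th * b) * om\<^sup>2 * hi + 2 * th * om\<^sup>2)"

definition "KB = th * om - pb - p4 - th / (2 * lo) - ya - eta * ((th / 2 + cz * cy) * om\<^sup>2 * hi)"

definition "KE = b * om * hi / 2 + Q4 * hi + 2 * om
  + eta * (cz * ce * (b * om * hi)\<^sup>2 + 2 * (q - th * b) * om\<^sup>2 * hi + 2 * th * om\<^sup>2)"

definition "KH = 1 / 4 + th / 2 + eta * (cz * ch + th / 2)"

definition "KD = q / (lo * om\<^sup>2) + q\<^sup>2 / (4 * eta * ya * om\<^sup>2 * lo)
  + th / (eta * om\<^sup>2 * lo\<^sup>2) + 2 * th / (om\<^sup>2 * lo\<^sup>2)"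

text \<open>
  One step of a single mode. The first-order products of \<open>a\<close> with \<open>b'\<close> coming from the three parts
  of the Lyapunov function have coefficients \<open>- \<eta> * om\<close>, \<open>q * \<eta> * om\<close> and \<open>- \<eta> * th * b * om\<close> and
  cancel up to \<open>1 - \<mu>\<close>. In the same way the second-order terms \<open>\<eta>\<^sup>2 * om\<^sup>2 * l * \<parallel>a + e\<parallel>\<^sup>2\<close> of the
  dual part and of the cross part cancel up to \<open>\<mu>\<close>. The term that is linear in the gradient noise
  \<open>n\<close> is kept exact, because only its expectation vanishes.
\<close>

lemma mode_step:
  fixes a b' e h n d :: "'v::real_inner"
  assumes l: "lo \<le> l" "l \<le> hi"
  defines "z \<equiv> (b * om * l) *\<^sub>R (a + e) + om *\<^sub>R b' + h"
  defines "a1 \<equiv> a - eta *\<^sub>R (z + n)" and "b1 \<equiv> b' + (eta * om * l) *\<^sub>R (a + e) + (1 / om) *\<^sub>R d"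
  shows "1 / 2 * (norm a1)\<^sup>2 + q / 2 * ((norm b1)\<^sup>2 / l) + th * ((a1 \<bullet> b1) / l) + s * (norm (a1 - a))\<^sup>2
    \<le> 1 / 2 * (norm a)\<^sup>2 + q / 2 * ((norm b')\<^sup>2 / l) + th * ((a \<bullet> b') / l)
      + n \<bullet> (- eta *\<^sub>R a - (eta * th / l) *\<^sub>R b' - (eta\<^sup>2 * th * om) *\<^sub>R (a + e) + (2 * cz * eta\<^sup>2) *\<^sub>R z)
      + cz * eta\<^sup>2 * (norm n)\<^sup>2
      - eta * KA * (norm a)\<^sup>2 - eta * KB * ((norm b')\<^sup>2 / l)
      + eta * KE * (norm e)\<^sup>2 + eta * KH * (norm h)\<^sup>2 + KD * (norm d)\<^sup>2"
proof -
  note omp = om_pos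
  define mu where "mu = q - th * b"
  have mu: "0 \<le> mu" "mu \<le> 1" using q_th by (auto simp: mu_def)
  have lp: "0 < l" using l lo_pos by simp
  have il: "1 / l \<le> 1 / lo" using l lo_pos by (simp add: frac_le)
  define w where "w = a + e"
  define B where "B = (norm b')\<^sup>2 / l"
  have Bn: "(norm b')\<^sup>2 = l * B" using lp by (simp add: B_def)
  have B0: "0 \<le> B" using lp by (simp add: B_def)
  define D where "D = (eta * om * l) *\<^sub>R w + (1 / om) *\<^sub>R d"
  have b1: "b1 = b' + D" by (simp add: b1_def D_def w_def)
  have zw: "z = (b * om * l) *\<^sub>R w + om *\<^sub>R b' + h" by (simp add: z_def w_def)
  have i1: "1 / 2 * (norm a1)\<^sup>2 = 1 / 2 * (norm a)\<^sup>2 - eta * (a \<bullet> z) - eta * (a \<bullet> n) + eta\<^sup>2 / 2 * (norm (z + n))\<^sup>2"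
    unfolding a1_def power2_norm_eq_inner
    by (simp add: inner_simps inner_commute power2_eq_square algebra_simps)
  have i2: "(norm b1)\<^sup>2 = (norm b')\<^sup>2 + 2 * (b' \<bullet> D) + (norm D)\<^sup>2"
    unfolding b1 power2_norm_eq_inner by (simp add: inner_simps inner_commute)
  have i3: "a1 \<bullet> b1 = a \<bullet> b' + a \<bullet> D - eta * (z \<bullet> b') - eta * (n \<bullet> b') - eta * (z \<bullet> D) - eta * (n \<bullet> D)"
    unfolding a1_def b1 by (simp add: inner_simps algebra_simps)
  have i4: "(norm (a1 - a))\<^sup>2 = eta\<^sup>2 * (norm (z + n))\<^sup>2"
    unfolding a1_def by (simp add: power_mult_distrib)
  have iD: "(v \<bullet> D) / l = eta * om * (v \<bullet> w) + (v \<bullet> d) / (om * l)" for v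
    using lp omp by (simp add: D_def inner_simps field_simps)
  have nD: "(norm D)\<^sup>2 / l \<le> 2 * eta\<^sup>2 * om\<^sup>2 * l * (norm w)\<^sup>2 + 2 / (om\<^sup>2 * l) * (norm d)\<^sup>2"
  proof -
    have "(norm D)\<^sup>2 \<le> 2 * (norm ((eta * om * l) *\<^sub>R w))\<^sup>2 + 2 * (norm ((1 / om) *\<^sub>R d))\<^sup>2"
      unfolding D_def by (rule norm_add_sq_le)
    also have "\<dots> = l * (2 * eta\<^sup>2 * om\<^sup>2 * l * (norm w)\<^sup>2 + 2 / (om\<^sup>2 * l) * (norm d)\<^sup>2)"
      using lp by (simp add: power_mult_distrib power_divide field_simps power2_eq_square)
    finally show ?thesis using lp by (simp add: divide_le_eq mult.commute)
  qed
  have zb: "(z \<bullet> b') / l = b * om * (w \<bullet> b') + om * B + (h \<bullet> b') / l"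
    unfolding zw using lp by (simp add: inner_simps dot_square_norm Bn field_simps)
  have zwi: "z \<bullet> w = b * om * l * (norm w)\<^sup>2 + om * (b' \<bullet> w) + h \<bullet> w"
    unfolding zw by (simp add: inner_simps dot_square_norm)
  have az: "a \<bullet> z = b * om * l * (norm a)\<^sup>2 + b * om * l * (a \<bullet> e) + om * (a \<bullet> b') + a \<bullet> h"
    unfolding z_def by (simp add: inner_simps dot_square_norm algebra_simps)
  have zn: "(norm (z + n))\<^sup>2 = (norm z)\<^sup>2 + 2 * (z \<bullet> n) + (norm n)\<^sup>2"
    by (simp add: power2_norm_eq_inner inner_simps inner_commute)
  have wb: "w \<bullet> b' = a \<bullet> b' + e \<bullet> b'" by (simp add: w_def inner_simps)
  have aw: "a \<bullet> w = (norm a)\<^sup>2 + a \<bullet> e" by (simp add: w_def inner_simps dot_square_norm)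
  \<comment> \<open>The search direction and the drift are coupled: the factor \<open>1 / 8\<close> reappears in \<open>cz\<close>.\<close>
  have y_zd: "- (th * eta * (((z + n) \<bullet> d) / (om * l))) \<le> eta\<^sup>2 * th / 8 * (norm (z + n))\<^sup>2 + 2 * th / (om\<^sup>2 * lo\<^sup>2) * (norm d)\<^sup>2"
  proof -
    have "(- (th * eta / (om * l))) * ((z + n) \<bullet> d) \<le> eta\<^sup>2 * th / 8 * (norm (z + n))\<^sup>2 + 2 * th / (om\<^sup>2 * l\<^sup>2) * (norm d)\<^sup>2"
      using th lp omp eta_pos by (intro young_inner) (auto simp: power_mult_distrib field_simps power2_eq_square)
    moreover have "2 * th / (om\<^sup>2 * l\<^sup>2) * (norm d)\<^sup>2 \<le> 2 * th / (om\<^sup>2 * lo\<^sup>2) * (norm d)\<^sup>2"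
      using th lp omp l lo_pos by (intro mult_right_mono divide_left_mono mult_left_mono power_mono) auto
    ultimately show ?thesis by simp
  qed
  have y_bd: "q * ((b' \<bullet> d) / (om * l)) \<le> eta * ya * B + q\<^sup>2 / (4 * eta * ya * om\<^sup>2 * lo) * (norm d)\<^sup>2"
  proof -
    have "q / (om * l) * (b' \<bullet> d) \<le> eta * ya / l * (norm b')\<^sup>2 + q\<^sup>2 / (4 * eta * ya * om\<^sup>2 * l) * (norm d)\<^sup>2"
      using q_pos lp omp eta_pos ya_pos by (intro young_inner) (auto simp: power_mult_distrib field_simps power2_eq_square)
    moreover have "q\<^sup>2 / (4 * eta * ya * om\<^sup>2 * l) * (norm d)\<^sup>2 \<le> q\<^sup>2 / (4 * eta * ya * om\<^sup>2 * lo) * (norm d)\<^sup>2"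
      using lp omp l lo_pos eta_pos ya_pos by (intro mult_right_mono divide_left_mono mult_left_mono mult_pos_pos) auto
    ultimately show ?thesis using lp by (simp add: B_def)
  qed
  have y_ad: "th * ((a \<bullet> d) / (om * l)) \<le> eta * th / 4 * (norm a)\<^sup>2 + th / (eta * om\<^sup>2 * lo\<^sup>2) * (norm d)\<^sup>2"
  proof -
    have "th / (om * l) * (a \<bullet> d) \<le> eta * th / 4 * (norm a)\<^sup>2 + th / (eta * om\<^sup>2 * l\<^sup>2) * (norm d)\<^sup>2"
      using th lp omp eta_pos by (intro young_inner) (auto simp: power_mult_distrib field_simps power2_eq_square)
    moreover have "th / (eta * om\<^sup>2 * l\<^sup>2) * (norm d)\<^sup>2 \<le> th / (eta * om\<^sup>2 * lo\<^sup>2) * (norm d)\<^sup>2"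
      using th lp omp l lo_pos eta_pos by (intro mult_right_mono divide_left_mono mult_left_mono mult_pos_pos power_mono) auto
    ultimately show ?thesis by simp
  qed
  have y_ae: "- (b * om * l) * (a \<bullet> e) \<le> b * om * l / 2 * (norm a)\<^sup>2 + b * om * l / 2 * (norm e)\<^sup>2"
    using lp omp b_pos by (intro young_inner) (auto simp: power2_eq_square)
  have y_ae2: "(th * om) * (a \<bullet> e) \<le> th\<^sup>2 * om / 8 * (norm a)\<^sup>2 + 2 * om * (norm e)\<^sup>2"
    using omp th by (intro young_inner) (auto simp: power2_eq_square)
  have y_ah: "(-1) * (a \<bullet> h) \<le> 1 * (norm a)\<^sup>2 + 1 / 4 * (norm h)\<^sup>2"
    by (intro young_inner) auto
  have y_ab: "- ((1 - mu) * om) * (a \<bullet> b') \<le> ca * (b * om) * l * (norm a)\<^sup>2 + pb * B"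
  proof -
    have "- ((1 - mu) * om) * (a \<bullet> b') \<le> ca * (b * om) * l * (norm a)\<^sup>2 + pb / l * (norm b')\<^sup>2"
      using ca lp omp b_pos by (intro young_inner) (auto simp: mu_def)
    then show ?thesis using lp by (simp add: B_def)
  qed
  have y_eb: "(mu * om) * (e \<bullet> b') \<le> Q4 * hi * (norm e)\<^sup>2 + p4 * B"
  proof -
    have "(mu * om) * (e \<bullet> b') \<le> Q4 * l * (norm e)\<^sup>2 + p4 / l * (norm b')\<^sup>2"
      using p4 lp by (intro young_inner) (auto simp: mu_def field_simps)
    moreover have "Q4 * l * (norm e)\<^sup>2 \<le> Q4 * hi * (norm e)\<^sup>2"
      using p4 l by (intro mult_right_mono mult_left_mono) auto
    ultimately show ?thesis using lp by (simp add: B_def)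
  qed
  have y_hb: "- (th * ((h \<bullet> b') / l)) \<le> th / 2 * (norm h)\<^sup>2 + th / (2 * lo) * B"
  proof -
    have "- (th / l) * (h \<bullet> b') \<le> th / 2 * (norm h)\<^sup>2 + th / (2 * l\<^sup>2) * (norm b')\<^sup>2"
      using th lp by (intro young_inner) (auto simp: field_simps power2_eq_square)
    also have "th / (2 * l\<^sup>2) * (norm b')\<^sup>2 = th / 2 * B * (1 / l)"
      using lp by (simp add: B_def power2_eq_square)
    also have "\<dots> \<le> th / 2 * B * (1 / lo)"
      using il th B0 by (intro mult_left_mono) auto
    finally show ?thesis by simp
  qed
  have nw: "(norm w)\<^sup>2 \<le> 2 * (norm a)\<^sup>2 + 2 * (norm e)\<^sup>2"
    unfolding w_def by (rule norm_add_sq_le)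
  have lB: "l * B \<le> hi * B" using l B0 by (intro mult_right_mono)
  have y_bw: "- (om\<^sup>2) * (b' \<bullet> w) \<le> om\<^sup>2 * (hi / 2 * B + (norm a)\<^sup>2 + (norm e)\<^sup>2)"
  proof -
    have "(-1) * (b' \<bullet> w) \<le> 1/2 * (norm b')\<^sup>2 + 1/2 * (norm w)\<^sup>2"
      by (intro young_inner) auto
    also have "\<dots> \<le> hi / 2 * B + (norm a)\<^sup>2 + (norm e)\<^sup>2" using nw lB unfolding Bn by argo
    finally show ?thesis using mult_left_mono[of "(-1) * (b' \<bullet> w)" _ "om\<^sup>2"] by simp
  qed
  have y_hw: "- om * (h \<bullet> w) \<le> 1 / 2 * (norm h)\<^sup>2 + om\<^sup>2 * ((norm a)\<^sup>2 + (norm e)\<^sup>2)"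
  proof -
    have "- om * (h \<bullet> w) \<le> 1 / 2 * (norm h)\<^sup>2 + om\<^sup>2 / 2 * (norm w)\<^sup>2"
      by (intro young_inner) auto
    also have "om\<^sup>2 / 2 * (norm w)\<^sup>2 \<le> om\<^sup>2 / 2 * (2 * (norm a)\<^sup>2 + 2 * (norm e)\<^sup>2)"
      using nw by (intro mult_left_mono) auto
    finally show ?thesis by (simp add: algebra_simps)
  qed
  have gl: "(b * om * l)\<^sup>2 \<le> (b * om * hi)\<^sup>2"
    using l lp omp b_pos by (intro power_mono mult_left_mono) auto
  have nz: "(norm z)\<^sup>2 \<le> cx * ((b * om * hi)\<^sup>2 * (norm a)\<^sup>2) + ce * ((b * om * hi)\<^sup>2 * (norm e)\<^sup>2)
      + cy * (om\<^sup>2 * (hi * B)) + ch * (norm h)\<^sup>2"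
  proof -
    have "z = (b * om * l) *\<^sub>R a + (b * om * l) *\<^sub>R e + om *\<^sub>R b' + h"
      by (simp add: z_def scaleR_add_right)
    then have "(norm z)\<^sup>2 \<le> cx * ((b * om * l)\<^sup>2 * (norm a)\<^sup>2) + ce * ((b * om * l)\<^sup>2 * (norm e)\<^sup>2)
        + cy * (om\<^sup>2 * (l * B)) + ch * (norm h)\<^sup>2"
      using norm_sum4_sq_le[OF c_pos c_sum, of "(b * om * l) *\<^sub>R a" "(b * om * l) *\<^sub>R e" "om *\<^sub>R b'" h]
      by (simp add: power_mult_distrib Bn)
    also have "\<dots> \<le> cx * ((b * om * hi)\<^sup>2 * (norm a)\<^sup>2) + ce * ((b * om * hi)\<^sup>2 * (norm e)\<^sup>2)
        + cy * (om\<^sup>2 * (hi * B)) + ch * (norm h)\<^sup>2"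
      using c_pos gl l B0 by (intro add_mono mult_left_mono mult_right_mono order_refl) auto
    finally show ?thesis .
  qed
  have cz0: "0 \<le> cz" using th s_ge by (simp add: cz_def)
  have czz: "cz * (norm z)\<^sup>2 \<le> cz * (cx * ((b * om * hi)\<^sup>2 * (norm a)\<^sup>2) + ce * ((b * om * hi)\<^sup>2 * (norm e)\<^sup>2)
      + cy * (om\<^sup>2 * (hi * B)) + ch * (norm h)\<^sup>2)"
    by (rule mult_left_mono[OF nz cz0])
  have mw: "mu * om\<^sup>2 * l * (norm w)\<^sup>2 \<le> mu * om\<^sup>2 * hi * (2 * (norm a)\<^sup>2 + 2 * (norm e)\<^sup>2)"
    using mu l lp hi_pos nw by (intro mult_mono mult_left_mono) auto
  have la: "(1/2 - ca) * (b * om) * lo * (norm a)\<^sup>2 \<le> (1/2 - ca) * (b * om) * l * (norm a)\<^sup>2"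
    using ca l omp b_pos by (intro mult_right_mono mult_left_mono) auto
  have le: "b * om * l / 2 * (norm e)\<^sup>2 \<le> b * om * hi / 2 * (norm e)\<^sup>2"
    using l omp b_pos by (intro mult_right_mono divide_right_mono mult_left_mono) auto
  \<comment> \<open>The part of the increment of order \<open>\<eta>\<close>, apart from noise and drift.\<close>
  define F where "F = - (b * om * l) * (norm a)\<^sup>2 - b * om * l * (a \<bullet> e) - (1 - mu) * om * (a \<bullet> b') - a \<bullet> h
     + mu * om * (e \<bullet> b') + th * om * (norm a)\<^sup>2 + th * om * (a \<bullet> e) - th * om * B - th * ((h \<bullet> b') / l)"
  have F: "F \<le> - ((1/2 - ca) * (b * om) * lo) * (norm a)\<^sup>2 + (th * om + th\<^sup>2 * om / 8 + 1) * (norm a)\<^sup>2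
     + (b * om * hi / 2 + Q4 * hi + 2 * om) * (norm e)\<^sup>2 + (1/4 + th/2) * (norm h)\<^sup>2
     + (pb + p4 + th / (2 * lo) - th * om) * B"
    using y_ae y_ae2 y_ah y_ab y_eb y_hb la le unfolding F_def by (simp add: algebra_simps)
  \<comment> \<open>The part of order \<open>\<eta>\<^sup>2\<close>; the difference \<open>q - th * b\<close> is what the cancellation leaves.\<close>
  define S where "S = mu * om\<^sup>2 * l * (norm w)\<^sup>2 - th * om\<^sup>2 * (b' \<bullet> w) - th * om * (h \<bullet> w) + cz * (norm z)\<^sup>2"
  have S: "S \<le> (cz * cx * (b * om * hi)\<^sup>2 + 2 * mu * om\<^sup>2 * hi + 2 * th * om\<^sup>2) * (norm a)\<^sup>2
     + (cz * ce * (b * om * hi)\<^sup>2 + 2 * mu * om\<^sup>2 * hi + 2 * th * om\<^sup>2) * (norm e)\<^sup>2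
     + (th / 2 + cz * cy) * om\<^sup>2 * hi * B + (cz * ch + th / 2) * (norm h)\<^sup>2"
  proof -
    have "- th * om\<^sup>2 * (b' \<bullet> w) \<le> th * (om\<^sup>2 * (hi / 2 * B + (norm a)\<^sup>2 + (norm e)\<^sup>2))"
      using mult_left_mono[OF y_bw th(1)] by simp
    moreover have "- th * om * (h \<bullet> w) \<le> th * (1 / 2 * (norm h)\<^sup>2 + om\<^sup>2 * ((norm a)\<^sup>2 + (norm e)\<^sup>2))"
      using mult_left_mono[OF y_hw th(1)] by simp
    ultimately show ?thesis using mw czz unfolding S_def by (simp add: algebra_simps)
  qed
  define lin where "lin = n \<bullet> (- eta *\<^sub>R a - (eta * th / l) *\<^sub>R b' - (eta\<^sup>2 * th * om) *\<^sub>R w + (2 * cz * eta\<^sup>2) *\<^sub>R z)"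
  have lin: "lin = - eta * (a \<bullet> n) - eta * th * ((n \<bullet> b') / l) - eta\<^sup>2 * th * om * (n \<bullet> w) + 2 * cz * eta\<^sup>2 * (z \<bullet> n)"
    unfolding lin_def by (simp add: inner_simps inner_commute)
  define base where "base = 1 / 2 * (norm a)\<^sup>2 + q / 2 * B + th * ((a \<bullet> b') / l)"
  have e2: "q / 2 * ((norm b1)\<^sup>2 / l) \<le> q / 2 * B + q * eta * om * (w \<bullet> b') + q * ((b' \<bullet> d) / (om * l))
      + q * eta\<^sup>2 * om\<^sup>2 * l * (norm w)\<^sup>2 + q / (om\<^sup>2 * l) * (norm d)\<^sup>2"
  proof -
    have "q / 2 * ((norm b1)\<^sup>2 / l) = q / 2 * B + q * ((b' \<bullet> D) / l) + q / 2 * ((norm D)\<^sup>2 / l)"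
      unfolding i2 B_def by (simp add: add_divide_distrib algebra_simps)
    also have "\<dots> \<le> q / 2 * B + q * ((b' \<bullet> D) / l) + q / 2 * (2 * eta\<^sup>2 * om\<^sup>2 * l * (norm w)\<^sup>2 + 2 / (om\<^sup>2 * l) * (norm d)\<^sup>2)"
      using nD q_pos by (intro add_mono order_refl mult_left_mono) auto
    also have "\<dots> = q / 2 * B + q * eta * om * (w \<bullet> b') + q * ((b' \<bullet> d) / (om * l))
      + q * eta\<^sup>2 * om\<^sup>2 * l * (norm w)\<^sup>2 + q / (om\<^sup>2 * l) * (norm d)\<^sup>2"
      unfolding iD by (simp add: algebra_simps inner_commute)
    finally show ?thesis .
  qed
  have e3: "th * ((a1 \<bullet> b1) / l) = th * ((a \<bullet> b') / l) + th * eta * om * (a \<bullet> w) + th * ((a \<bullet> d) / (om * l))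
     - eta * th * (b * om * (w \<bullet> b') + om * B + (h \<bullet> b') / l) - eta * th * ((n \<bullet> b') / l)
     - th * eta\<^sup>2 * om * (z \<bullet> w) - th * eta\<^sup>2 * om * (n \<bullet> w) - th * eta * (((z + n) \<bullet> d) / (om * l))"
  proof -
    have *: "(a1 \<bullet> b1) / l = (a \<bullet> b') / l + (a \<bullet> D) / l - eta * ((z \<bullet> b') / l) - eta * ((n \<bullet> b') / l)
       - eta * ((z \<bullet> D) / l) - eta * ((n \<bullet> D) / l)"
      unfolding i3 by (simp add: add_divide_distrib diff_divide_distrib)
    show ?thesis unfolding *[unfolded iD zb]
      by (simp add: algebra_simps inner_add_left add_divide_distrib power2_eq_square)
  qed
  have ql: "q / (om\<^sup>2 * l) * (norm d)\<^sup>2 \<le> q / (lo * om\<^sup>2) * (norm d)\<^sup>2"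
    using q_pos l lo_pos omp by (intro mult_right_mono divide_left_mono) (auto simp: mult.commute)
  have "1 / 2 * (norm a1)\<^sup>2 + q / 2 * ((norm b1)\<^sup>2 / l) + th * ((a1 \<bullet> b1) / l) + s * (norm (a1 - a))\<^sup>2
     \<le> base + lin + eta * F + eta\<^sup>2 * S + cz * eta\<^sup>2 * (norm n)\<^sup>2
       + (q * ((b' \<bullet> d) / (om * l)) + q / (om\<^sup>2 * l) * (norm d)\<^sup>2 + th * ((a \<bullet> d) / (om * l))
       + 2 * th / (om\<^sup>2 * lo\<^sup>2) * (norm d)\<^sup>2)"
  proof -
    have "1 / 2 * (norm a1)\<^sup>2 + q / 2 * ((norm b1)\<^sup>2 / l) + th * ((a1 \<bullet> b1) / l) + s * (norm (a1 - a))\<^sup>2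
      \<le> (1 / 2 * (norm a)\<^sup>2 - eta * (a \<bullet> z) - eta * (a \<bullet> n))
      + (q / 2 * B + q * eta * om * (w \<bullet> b') + q * ((b' \<bullet> d) / (om * l))
      + q * eta\<^sup>2 * om\<^sup>2 * l * (norm w)\<^sup>2 + q / (om\<^sup>2 * l) * (norm d)\<^sup>2)
      + (th * ((a \<bullet> b') / l) + th * eta * om * (a \<bullet> w) + th * ((a \<bullet> d) / (om * l))
     - eta * th * (b * om * (w \<bullet> b') + om * B + (h \<bullet> b') / l) - eta * th * ((n \<bullet> b') / l)
     - th * eta\<^sup>2 * om * (z \<bullet> w) - th * eta\<^sup>2 * om * (n \<bullet> w))
      + 2 * th / (om\<^sup>2 * lo\<^sup>2) * (norm d)\<^sup>2 + cz * eta\<^sup>2 * (norm (z + n))\<^sup>2"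
      using e2 y_zd unfolding e3 i1 i4 cz_def by (simp add: algebra_simps)
    also have "\<dots> = base + lin + eta * F + eta\<^sup>2 * S + cz * eta\<^sup>2 * (norm n)\<^sup>2
       + (q * ((b' \<bullet> d) / (om * l)) + q / (om\<^sup>2 * l) * (norm d)\<^sup>2 + th * ((a \<bullet> d) / (om * l))
       + 2 * th / (om\<^sup>2 * lo\<^sup>2) * (norm d)\<^sup>2)"
      unfolding base_def lin F_def S_def zn az aw zwi wb mu_def
      by (simp add: algebra_simps power2_eq_square)
    finally show ?thesis .
  qed
  also have "\<dots> \<le> base + lin + cz * eta\<^sup>2 * (norm n)\<^sup>2
      - eta * KA * (norm a)\<^sup>2 - eta * KB * B
      + eta * KE * (norm e)\<^sup>2 + eta * KH * (norm h)\<^sup>2 + KD * (norm d)\<^sup>2"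
  proof -
    have "eta * F \<le> eta * (- ((1/2 - ca) * (b * om) * lo) * (norm a)\<^sup>2 + (th * om + th\<^sup>2 * om / 8 + 1) * (norm a)\<^sup>2
     + (b * om * hi / 2 + Q4 * hi + 2 * om) * (norm e)\<^sup>2 + (1/4 + th/2) * (norm h)\<^sup>2
     + (pb + p4 + th / (2 * lo) - th * om) * B)"
      using F eta_pos by (intro mult_left_mono) auto
    moreover have "eta\<^sup>2 * S \<le> eta\<^sup>2 * ((cz * cx * (b * om * hi)\<^sup>2 + 2 * mu * om\<^sup>2 * hi + 2 * th * om\<^sup>2) * (norm a)\<^sup>2
     + (cz * ce * (b * om * hi)\<^sup>2 + 2 * mu * om\<^sup>2 * hi + 2 * th * om\<^sup>2) * (norm e)\<^sup>2
     + (th / 2 + cz * cy) * om\<^sup>2 * hi * B + (cz * ch + th / 2) * (norm h)\<^sup>2)"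
      using S by (intro mult_left_mono) auto
    moreover have "eta * (- ((1/2 - ca) * (b * om) * lo) * (norm a)\<^sup>2 + (th * om + th\<^sup>2 * om / 8 + 1) * (norm a)\<^sup>2
     + (b * om * hi / 2 + Q4 * hi + 2 * om) * (norm e)\<^sup>2 + (1/4 + th/2) * (norm h)\<^sup>2
     + (pb + p4 + th / (2 * lo) - th * om) * B)
     + eta\<^sup>2 * ((cz * cx * (b * om * hi)\<^sup>2 + 2 * mu * om\<^sup>2 * hi + 2 * th * om\<^sup>2) * (norm a)\<^sup>2
     + (cz * ce * (b * om * hi)\<^sup>2 + 2 * mu * om\<^sup>2 * hi + 2 * th * om\<^sup>2) * (norm e)\<^sup>2
     + (th / 2 + cz * cy) * om\<^sup>2 * hi * B + (cz * ch + th / 2) * (norm h)\<^sup>2)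
     + eta * ya * B + eta * th / 4 * (norm a)\<^sup>2
     = - eta * KA * (norm a)\<^sup>2 - eta * KB * B + eta * KE * (norm e)\<^sup>2 + eta * KH * (norm h)\<^sup>2"
      unfolding KA_def KB_def KE_def KH_def mu_def by (simp add: algebra_simps power2_eq_square)
    moreover have "KD * (norm d)\<^sup>2 = q / (lo * om\<^sup>2) * (norm d)\<^sup>2 + q\<^sup>2 / (4 * eta * ya * om\<^sup>2 * lo) * (norm d)\<^sup>2
      + th / (eta * om\<^sup>2 * lo\<^sup>2) * (norm d)\<^sup>2 + 2 * th / (om\<^sup>2 * lo\<^sup>2) * (norm d)\<^sup>2"
      unfolding KD_def by (simp add: distrib_right)
    ultimately show ?thesis using y_bd y_ad ql by linarith
  qed
  finally show ?thesis unfolding base_def lin_def B_def w_def .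
qed

end

section \<open>Contracting weights\<close>

text \<open>
  The margins of the consensus error and of the dual variable, and the part of the noise constant
  that is due to the drift.
\<close>

context step_constants
begin

abbreviation "margin_X \<equiv> b * om * lo / 2 - (9 * om + 4) / 4 - 5 / 4 * Lf\<^sup>2
  - eta * ((4 * s + 3) * (b * om * hi)\<^sup>2 + (8 * s + 4) * Lf\<^sup>2 + 1 + 2 * om\<^sup>2)"

abbreviation "margin_Y \<equiv> (3 * om - 1) / 4 - 3 / lo - eta * (om\<^sup>2 * hi + 1 / lo + 4 * s * om\<^sup>2 * lo)"

abbreviation "drift_noise \<equiv> 2 * (1 + b)\<^sup>2 * Lf\<^sup>2 / (eta * om\<^sup>2 * lo) + (1 + b) * Lf\<^sup>2 / (om\<^sup>2 * lo)
  + Lf\<^sup>2 / (eta * om\<^sup>2 * lo\<^sup>2) + Lf\<^sup>2 / (om\<^sup>2 * lo\<^sup>2)"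

end

text \<open>
  Weights for which the Lyapunov function contracts with factor \<open>1 - \<eta> * rate\<close>. The function is
  at most \<open>(1/2 + th/(2 * c * lo)) * \<parallel>x\<parallel>\<^sub>K\<^sup>2 + (q + th * c)/2 * \<parallel>y\<parallel>\<^sub>P\<^sup>2\<close> plus the optimality gap and
  the compression error, so \<open>contr_X\<close> and \<open>contr_Y\<close> compare each decrease with \<open>rate\<close> times the
  coefficient here. The average of \<open>y\<close> is \<open>\<nabla>f / \<omega>\<close> and is not damped; by \<open>contr_N\<close> the
  squared gradient in the descent inequality pays for it. By \<open>contr_G\<close> the step along the
  averaged gradient is short.
\<close>

locale contracting_weights = lyapunov_weights +
  fixes c rate :: real
  assumes upper_c_pos: "0 < c" and rate_nonneg: "0 \<le> rate"
    and contr_X: "rate * (1 / 2 + th / (2 * c * lo)) \<le> KA - (KH + 1 / 2) * Lf\<^sup>2"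
    and contr_Y: "rate * ((q + th * c) / 2) \<le> KB"
    and contr_N: "ya + rate * ((q + th * c) / 2) \<le> lo * om\<^sup>2 / 3"
    and contr_G: "eta * (KD * Lf\<^sup>2 + Lf + s) \<le> 1 / 2"
    and contr_E: "KE \<le> (b * om / 2 + om) * hi + 2 * om + eta * ((4 * s + 3) * (b * om * hi)\<^sup>2 + 1 + 2 * om\<^sup>2)"
    and noise: "KD * Lf\<^sup>2 \<le> drift_noise + 1 / 8"
    and cz_le: "cz \<le> s + 5 / 8"

context step_constants
begin

lemma g_gt_4: "4 < b * om * lo"
proof -
  have "1 * 4 < b * (om * lo)" by (intro mult_strict_mono) (use b_gt_1 om_lo_gt in auto)
  then show ?thesis by (simp add: mult.assoc)
qed

lemma G_ge_g: "b * om * lo \<le> b * om * hi"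
  using lo_le_hi b_pos om_pos by (intro mult_left_mono) auto

lemma bracket_ge: "(4 * s + 3) * (b * om * hi)\<^sup>2
    \<le> (4 * s + 3) * (b * om * hi)\<^sup>2 + (8 * s + 4) * Lf\<^sup>2 + 1 + 2 * om\<^sup>2"
  using s_ge by simp

lemma eta_G_le: "eta * ((4 * s + 3) * (b * om * hi)\<^sup>2) \<le> b * om * lo / 2"
proof -
  have "eta * ((4 * s + 3) * (b * om * hi)\<^sup>2) \<le> b * om * lo / 2 - (9 * om + 4) / 4 - 5 / 4 * Lf\<^sup>2"
    using mult_left_mono[OF bracket_ge less_imp_le[OF eta_pos]] step_X by linarith
  moreover have "0 \<le> (9 * om + 4) / 4 + 5 / 4 * Lf\<^sup>2" using om_pos by simp
  ultimately show ?thesis by linarith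
qed

text \<open>
  The step size bound on \<open>\<eta> * (4 * s + 3) * \<gamma>\<^sup>2 * hi\<^sup>2\<close> divided by \<open>\<gamma>\<close>. It bounds \<open>\<eta> * \<gamma> * hi\<close> by
  \<open>lo / hi\<close> up to a constant, which pays for the estimate \<open>\<parallel>y\<parallel>\<^sup>2 \<le> hi * \<parallel>y\<parallel>\<^sub>P\<^sup>2\<close> in second-order terms.
\<close>

lemma eta_hi_le: "eta * om * b * (4 * s + 3) * hi\<^sup>2 \<le> lo / 2"
proof -
  have "(b * om) * (eta * om * b * (4 * s + 3) * hi\<^sup>2) \<le> (b * om) * (lo / 2)"
    using eta_G_le by (simp add: power_mult_distrib power2_eq_square algebra_simps)
  then show ?thesis by (rule mult_left_le_imp_le) (use b_pos om_pos in simp)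
qed

lemma eta_hi_le': "eta * om * hi * (b * (4 * s + 3)) \<le> 1 / 2"
proof -
  have "hi * (eta * om * hi * (b * (4 * s + 3))) \<le> hi * (1 / 2)"
    using eta_hi_le lo_le_hi by (simp add: power2_eq_square algebra_simps)
  then show ?thesis by (rule mult_left_le_imp_le) (use hi_pos in simp)
qed

lemma eta_s_le: "eta * s \<le> 1 / 32"
proof -
  let ?g = "b * om * lo"
  have "?g\<^sup>2 \<le> (b * om * hi)\<^sup>2" using G_ge_g g_gt_4 by (intro power_mono) auto
  then have "eta * ((4 * s) * ?g\<^sup>2) \<le> eta * ((4 * s + 3) * (b * om * hi)\<^sup>2)"
    using eta_pos s_ge by (intro mult_left_mono mult_mono) auto
  then have "?g * (8 * (eta * s) * ?g) \<le> ?g * 1" using eta_G_le by (simp add: power2_eq_square algebra_simps)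
  then have "8 * (eta * s) * ?g \<le> 1" by (rule mult_left_le_imp_le) (use g_gt_4 in simp)
  moreover have "8 * (eta * s) * 4 \<le> 8 * (eta * s) * ?g"
    using g_gt_4 eta_pos s_ge by (intro mult_left_mono) auto
  ultimately have "8 * (eta * s) * 4 \<le> 1" by (rule order_trans[rotated])
  then show ?thesis by simp
qed

lemma eta_le: "eta \<le> 1 / 96"
proof -
  have "eta * 3 \<le> eta * s" using eta_pos s_ge by (intro mult_left_mono) auto
  then show ?thesis using eta_s_le by simp
qed

lemma A_le: "(1 + b) * Lf\<^sup>2 / (om\<^sup>2 * lo) \<le> 1 / 16" "Lf\<^sup>2 / (om\<^sup>2 * lo\<^sup>2) \<le> 1 / 8"
  "0 \<le> (1 + b) * Lf\<^sup>2 / (om\<^sup>2 * lo)" "0 \<le> Lf\<^sup>2 / (om\<^sup>2 * lo\<^sup>2)"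
proof -
  show *: "0 \<le> (1 + b) * Lf\<^sup>2 / (om\<^sup>2 * lo)" "0 \<le> Lf\<^sup>2 / (om\<^sup>2 * lo\<^sup>2)"
    using b_pos lo_pos by auto
  have "0 \<le> eta * Lf" using eta_pos Lf_pos by simp
  then show "(1 + b) * Lf\<^sup>2 / (om\<^sup>2 * lo) \<le> 1 / 16" "Lf\<^sup>2 / (om\<^sup>2 * lo\<^sup>2) \<le> 1 / 8"
    using step_G * by linarith+
qed

text \<open>
  Splitting \<open>y \<bullet> P \<Delta>\<close> gives the drift a part \<open>T / \<eta>\<close>, with \<open>T\<close> inversely proportional to the
  damping spent on it. By \<open>step_G\<close> the value \<open>T \<le> 7\<close> is small enough for the descent along the
  averaged gradient to absorb it, and \<open>T \<le> 2 * (1 + b)\<close> keeps its noise within the noise constant.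
\<close>

lemma drift_bounds:
  fixes T KDL :: real
  assumes T: "0 \<le> T" "T \<le> 7" "T \<le> 2 * (1 + b)"
    and KDL: "KDL \<le> (T * ((1 + b) * Lf\<^sup>2 / (om\<^sup>2 * lo)) + Lf\<^sup>2 / (om\<^sup>2 * lo\<^sup>2)) / eta
      + (1 + b) * Lf\<^sup>2 / (om\<^sup>2 * lo) + 2 * (Lf\<^sup>2 / (om\<^sup>2 * lo\<^sup>2))"
  shows "eta * (KDL + Lf + s) \<le> 1 / 2"
    and "KDL \<le> drift_noise + 1 / 8"
proof -
  define A1 where "A1 = (1 + b) * Lf\<^sup>2 / (om\<^sup>2 * lo)"
  define A2 where "A2 = Lf\<^sup>2 / (om\<^sup>2 * lo\<^sup>2)"
  have A: "0 \<le> A1" "0 \<le> A2" "A1 \<le> 1 / 16" "A2 \<le> 1 / 8" "2 * A1 + A2 + eta * Lf \<le> 1 / 8"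
    using A_le step_G by (auto simp: A1_def A2_def)
  have K: "KDL \<le> (T * A1 + A2) / eta + A1 + 2 * A2" using KDL by (simp add: A1_def A2_def)
  have TA: "T * A1 \<le> 7 * A1" using T A by (intro mult_right_mono) auto
  have eL: "0 \<le> eta * Lf" using eta_pos Lf_pos by simp
  have "eta * KDL \<le> eta * ((T * A1 + A2) / eta + A1 + 2 * A2)"
    using K eta_pos by (intro mult_left_mono) auto
  also have "\<dots> = T * A1 + A2 + eta * (A1 + 2 * A2)" using eta_pos by (simp add: field_simps)
  also have "\<dots> \<le> 7 * A1 + A2 + 1 / 96 * (1 / 2)"
  proof -
    have "eta * (A1 + 2 * A2) \<le> 1 / 96 * (1 / 2)"
      using eta_le A eta_pos by (intro mult_mono) auto
    then show ?thesis using TA by linarith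
  qed
  finally have "eta * KDL + eta * Lf + eta * s \<le> 7 * A1 + A2 + 1 / 192 + eta * Lf + 1 / 32"
    using eta_s_le by linarith
  then show "eta * (KDL + Lf + s) \<le> 1 / 2" using A eL by (simp add: distrib_left)
  have "T * A1 / eta \<le> 2 * (1 + b) * A1 / eta"
    using T A eta_pos by (intro divide_right_mono mult_right_mono) auto
  then have "KDL \<le> 2 * (1 + b) * A1 / eta + A1 + A2 / eta + A2 + 1 / 8"
    using K A by (simp add: add_divide_distrib)
  then show "KDL \<le> drift_noise + 1 / 8"
    by (simp add: A1_def A2_def power2_eq_square mult_ac)
qed

text \<open>
  With \<open>th = 1\<close> and \<open>q = 1 + b\<close> the product \<open>a \<bullet> y\<close> cancels completely, and the decrease of the
  consensus error is at least its margin. The drift of the gradients has the weight \<open>q\<^sup>2\<close>, so the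
  damping can absorb it only if \<open>1 + b\<close> is at most of the order of \<open>om\<close>; the bound used here is
  equivalent to \<open>T \<le> 7\<close>.
\<close>

lemma contracting_weights_moderate_b:
  assumes small: "1 + b \<le> 7 / 4 * (om + 3)" and rate: "0 \<le> rate"
    and rX: "rate * (1 / 2 + b) \<le> margin_X"
    and rY: "rate * (1 / 2 + b) \<le> margin_Y"
  shows "contracting_weights lo hi Lf s om b eta 1 (1 + b) 0 0 (om / 4) om ((om + 3) / 16) 4 4 3 6 (1 / 9) rate"
proof -
  note omp = om_pos and bp = b_pos and hp = hi_pos
  interpret W: lyapunov_weights lo hi Lf s om b eta 1 "1 + b" 0 0 "om / 4" om "(om + 3) / 16" 4 4 3 6
    by unfold_locales (use omp bp in \<open>auto simp: power2_eq_square\<close>)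
  define G2 where "G2 = (b * om * hi)\<^sup>2"
  have b_hi: "9 / 2 < b * hi" using b_lo mult_left_mono[OF lo_le_hi, of b] bp by linarith
  have hiG: "2 * om\<^sup>2 * hi \<le> G2 / 2"
  proof -
    have "1 * (9 / 2) \<le> b * (b * hi)" using b_gt_1 b_hi by (intro mult_mono) auto
    then have "4 * (om\<^sup>2 * hi) \<le> (b * (b * hi)) * (om\<^sup>2 * hi)" using hp by (intro mult_right_mono) auto
    then show ?thesis by (simp add: G2_def power2_eq_square mult_ac)
  qed
  have KA: "W.KA = b * om * lo / 2 - om - om / 8 - 1 - 1 / 4 - eta * ((4 * s + 5 / 2) * G2 + 2 * om\<^sup>2 * hi + 2 * om\<^sup>2)"
    by (simp add: W.KA_def W.cz_def G2_def algebra_simps)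
  have KH: "W.KH = 3 / 4 + eta * (6 * s + 17 / 4)"
    by (simp add: W.KH_def W.cz_def algebra_simps)
  have KB: "W.KB = 3 / 4 * om - 1 / (2 * lo) - (om + 3) / 16 - eta * ((3 * s + 19 / 8) * om\<^sup>2 * hi)"
    by (simp add: W.KB_def W.cz_def algebra_simps)
  have KE: "W.KE = b * om * hi / 2 + om * hi + 2 * om + eta * ((4 * s + 5 / 2) * G2 + 2 * om\<^sup>2 * hi + 2 * om\<^sup>2)"
    by (simp add: W.KE_def W.cz_def G2_def algebra_simps)
  show ?thesis
  proof (unfold_locales)
    show "rate * (1 / 2 + 1 / (2 * (1 / 9) * lo)) \<le> W.KA - (W.KH + 1 / 2) * Lf\<^sup>2"
    proof -
      have "1 / (2 * (1 / 9) * lo) \<le> b" using b_lo lo_pos by (simp add: field_simps)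
      then have "rate * (1 / 2 + 1 / (2 * (1 / 9) * lo)) \<le> rate * (1 / 2 + b)"
        using rate by (intro mult_left_mono) auto
      also have "\<dots> \<le> b * om * lo / 2 - (9 * om + 4) / 4 - 5 / 4 * Lf\<^sup>2
        - eta * ((4 * s + 3) * G2 + (8 * s + 4) * Lf\<^sup>2 + 1 + 2 * om\<^sup>2)" using rX by (simp add: G2_def)
      also have "\<dots> \<le> W.KA - (W.KH + 1 / 2) * Lf\<^sup>2"
      proof -
        define Z1 where "Z1 = eta * ((4 * s + 5 / 2) * G2 + 2 * om\<^sup>2 * hi + 2 * om\<^sup>2 + (6 * s + 17 / 4) * Lf\<^sup>2)"
        define Z2 where "Z2 = eta * ((4 * s + 3) * G2 + (8 * s + 4) * Lf\<^sup>2 + 1 + 2 * om\<^sup>2)"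
        have "(6 * s + 17 / 4) * Lf\<^sup>2 \<le> (8 * s + 4) * Lf\<^sup>2" using s_ge by (intro mult_right_mono) auto
        then have "Z1 \<le> Z2" unfolding Z1_def Z2_def
          using hiG eta_pos by (intro mult_left_mono) (auto simp: algebra_simps)
        moreover have "W.KA - (W.KH + 1 / 2) * Lf\<^sup>2 = b * om * lo / 2 - 9 / 8 * om - 5 / 4 - 5 / 4 * Lf\<^sup>2 - Z1"
          unfolding KA KH Z1_def by (simp add: algebra_simps)
        ultimately show ?thesis using om_gt unfolding Z2_def[symmetric] by argo
      qed
      finally show ?thesis .
    qed
    have rY': "rate * ((1 + b + 1 * (1 / 9)) / 2) \<le> 3 / 4 * (margin_Y)"
    proof -
      have "rate * ((1 + b + 1 * (1 / 9)) / 2) \<le> rate * (3 / 4 * (1 / 2 + b))"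
        using rate b_gt_1 by (intro mult_left_mono) auto
      also have "\<dots> = 3 / 4 * (rate * (1 / 2 + b))" by simp
      also have "\<dots> \<le> 3 / 4 * (margin_Y)"
        using rY by (intro mult_left_mono) auto
      finally show ?thesis .
    qed
    show "rate * ((1 + b + 1 * (1 / 9)) / 2) \<le> W.KB"
    proof -
      \<comment> \<open>The cost of \<open>\<parallel>y\<parallel>\<^sup>2\<close> is proportional to \<open>hi\<close>, but the margin supplies only \<open>lo\<close>; \<open>J\<close> is
        the difference. The bound on \<open>\<eta>\<close> carries a factor \<open>lo / hi\<^sup>2\<close>, and \<open>J * lo / hi\<^sup>2\<close> is at
        most a multiple of \<open>4 * s + 3\<close>.\<close>
      define J where "J = (3 * s + 13 / 8) * hi - 3 * s * lo"
      have J0: "0 \<le> J"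
      proof -
        have "3 * s * lo \<le> (3 * s + 13 / 8) * hi" using s_ge lo_pos lo_le_hi by (intro mult_mono) auto
        then show ?thesis by (simp add: J_def)
      qed
      have poly: "J * lo / 2 \<le> hi\<^sup>2 * (4 * s + 3) / 8"
      proof -
        have "12 * 9 \<le> 12 * (s * s)" using s_ge mult_mono[of 3 s 3 s] by simp
        have "s * 3 \<le> s * s" using s_ge by (intro mult_left_mono) auto
        then have "0 \<le> 12 * (s * s) - 3 * s - 169 / 16" using s_ge by linarith
        \<comment> \<open>Completing the square in \<open>hi\<close>.\<close>
        then have "0 \<le> ((4 * s + 3) * hi - (6 * s + 13 / 4) * lo)\<^sup>2 + (12 * (s * s) - 3 * s - 169 / 16) * lo\<^sup>2"
          by simp
        also have "\<dots> = (4 * s + 3) * ((4 * s + 3) * hi\<^sup>2 - 4 * J * lo)"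
          by (simp add: J_def power2_eq_square algebra_simps)
        finally have "0 \<le> (4 * s + 3) * hi\<^sup>2 - 4 * J * lo"
          using s_ge by (simp add: zero_le_mult_iff)
        then show ?thesis by (simp add: mult_ac)
      qed
      have "eta * om * (4 * s + 3) * hi\<^sup>2 * 1 \<le> eta * om * (4 * s + 3) * hi\<^sup>2 * b"
        using b_gt_1 eta_pos omp s_ge by (intro mult_left_mono) auto
      then have "eta * om * (4 * s + 3) * hi\<^sup>2 \<le> lo / 2" using eta_hi_le by (simp add: mult_ac)
      then have "J * (eta * om * (4 * s + 3) * hi\<^sup>2) \<le> J * (lo / 2)" by (intro mult_left_mono J0)
      also have "\<dots> \<le> hi\<^sup>2 * (4 * s + 3) / 8" using poly by simp
      finally have "(hi\<^sup>2 * (4 * s + 3)) * (eta * om * J) \<le> (hi\<^sup>2 * (4 * s + 3)) * (1 / 8)" by (simp add: mult_ac)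
      then have "eta * om * J \<le> 1 / 8" by (rule mult_left_le_imp_le) (use hp s_ge in simp)
      then have "om * (eta * om * J) \<le> om * (1 / 8)" using omp by (intro mult_left_mono) auto
      then have J: "eta * om\<^sup>2 * J \<le> om / 8" by (simp add: power2_eq_square mult_ac)
      define t1 t2 t3 t4 t5 where "t1 = 1 / lo" and "t2 = eta * om\<^sup>2 * hi" and "t3 = eta * t1"
        and "t4 = eta * om\<^sup>2 * s * lo" and "t5 = eta * om\<^sup>2 * J"
      note ts = t1_def t2_def t3_def t4_def t5_def
      have "W.KB = 11 / 16 * om - 3 / 16 - 1 / 2 * t1 - (t5 + 3 / 4 * t2 + 3 * t4)"
        unfolding KB J_def ts by (simp add: algebra_simps add_divide_distrib)
      moreover have "3 / 4 * (margin_Y)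
        = 9 / 16 * om - 3 / 16 - 9 / 4 * t1 - 3 / 4 * t2 - 3 / 4 * t3 - 3 * t4"
        unfolding ts by (simp add: algebra_simps diff_divide_distrib)
      moreover have "0 \<le> t1" "0 \<le> t3" using lo_pos eta_pos by (auto simp: ts)
      ultimately have "3 / 4 * (margin_Y) \<le> W.KB"
        using J unfolding t5_def[symmetric] by linarith
      then show ?thesis using rY' by (rule order_trans[rotated])
    qed
    show "(om + 3) / 16 + rate * ((1 + b + 1 * (1 / 9)) / 2) \<le> lo * om\<^sup>2 / 3"
    proof -
      have "0 \<le> eta * (om\<^sup>2 * hi + 1 / lo + 4 * s * om\<^sup>2 * lo)" "0 \<le> 3 / lo"
        using eta_pos hp lo_pos s_ge by auto
      then have "(om + 3) / 16 + rate * ((1 + b + 1 * (1 / 9)) / 2) \<le> om * 1" using rY' omp by argo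
      also have "\<dots> \<le> om * (om * lo / 3)" using omp om_lo_gt by (intro mult_left_mono) auto
      finally show ?thesis by (simp add: power2_eq_square mult_ac)
    qed
    define T where "T = 4 * (1 + b) / (om + 3)"
    have T: "0 \<le> T" "T \<le> 7" "T \<le> 2 * (1 + b)"
    proof -
      show "0 \<le> T" using omp bp by (simp add: T_def)
      show "T \<le> 7" using small omp by (simp add: T_def divide_le_eq)
      have "4 / (om + 3) * (1 + b) \<le> 2 * (1 + b)" using omp bp by (intro mult_right_mono) (auto simp: divide_le_eq)
      then show "T \<le> 2 * (1 + b)" by (simp add: T_def)
    qed
    have KD: "W.KD * Lf\<^sup>2 \<le> (T * ((1 + b) * Lf\<^sup>2 / (om\<^sup>2 * lo)) + Lf\<^sup>2 / (om\<^sup>2 * lo\<^sup>2)) / eta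
      + (1 + b) * Lf\<^sup>2 / (om\<^sup>2 * lo) + 2 * (Lf\<^sup>2 / (om\<^sup>2 * lo\<^sup>2))"
    proof -
      have "(1 + b)\<^sup>2 / (4 * eta * ((om + 3) / 16) * om\<^sup>2 * lo) * Lf\<^sup>2
        = T * ((1 + b) * Lf\<^sup>2 / (om\<^sup>2 * lo)) / eta"
      proof -
        have "B\<^sup>2 / (4 * e * (m / 16) * o1 * l1) * F = 4 * B / m * (B * F / (o1 * l1)) / e" for B e m o1 l1 F :: real
          by (simp add: power2_eq_square mult_ac)
        then show ?thesis unfolding T_def .
      qed
      moreover define B where "B = 1 + b"
      ultimately show ?thesis unfolding W.KD_def unfolding B_def[symmetric] unfolding distrib_right
        by (simp add: add_divide_distrib mult_ac)
    qed
    show "eta * (W.KD * Lf\<^sup>2 + Lf + s) \<le> 1 / 2"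
      "W.KD * Lf\<^sup>2 \<le> drift_noise + 1 / 8"
      by (rule drift_bounds[OF T KD])+
    show "W.KE \<le> (b * om / 2 + om) * hi + 2 * om + eta * ((4 * s + 3) * (b * om * hi)\<^sup>2 + 1 + 2 * om\<^sup>2)"
    proof -
      have "eta * ((4 * s + 5 / 2) * G2 + 2 * om\<^sup>2 * hi + 2 * om\<^sup>2) \<le> eta * ((4 * s + 3) * G2 + 1 + 2 * om\<^sup>2)"
        using hiG eta_pos by (intro mult_left_mono) (auto simp: algebra_simps)
      then show ?thesis unfolding KE G2_def by (simp add: algebra_simps)
    qed
    show "W.cz \<le> s + 5 / 8" by (simp add: W.cz_def)
  qed (use rate in auto)
qed

text \<open>
  If \<open>b\<close> is large compared with \<open>om\<close>, the weights \<open>th = 4 / b\<close> and \<open>q = 4\<close> keep the drift small. Then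
  \<open>\<mu> = 0\<close>, and the product \<open>a \<bullet> y\<close> no longer cancels. It is absorbed because the consensus error has
  room to spare: the smoothness constant is negligible against \<open>b * om * lo\<close>, and the required rate
  is divided by \<open>1/2 + b\<close>.
\<close>

lemma contracting_weights_large_b:
  assumes large: "7 / 4 * (om + 3) < 1 + b" and rate: "0 \<le> rate"
    and rX: "rate * (1 / 2 + b) \<le> margin_X"
    and rY: "rate * (1 / 2 + b) \<le> margin_Y"
  shows "contracting_weights lo hi Lf s om b eta (4 / b) 4 (9 / 50) (25 * om / (18 * b)) 0 0
    (4 / b * ((om + 1) / 9)) 2 4 5 20 (1 / 2) rate"
proof -
  note omp = om_pos and bp = b_pos and hp = hi_pos
  have b_gt: "29 / 6 < b" using large om_gt by simp
  \<comment> \<open>Dividing by \<open>b\<close> is avoided below, so that the inequalities stay linear.\<close>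
  define ib where "ib = 1 / b"
  have ib: "0 < ib" "ib < 6 / 29" using b_gt by (auto simp: ib_def field_simps)
  have bib: "b * ib = 1" using bp by (simp add: ib_def)
  interpret W: lyapunov_weights lo hi Lf s om b eta "4 / b" 4 "9 / 50" "25 * om / (18 * b)" 0 0
    "4 / b * ((om + 1) / 9)" 2 4 5 20
    by unfold_locales (use omp bp b_gt in \<open>auto simp: power2_eq_square field_simps\<close>)
  define G2 where "G2 = (b * om * hi)\<^sup>2"
  define g where "g = b * om * lo"
  have th: "4 / b = 4 * ib" by (simp add: ib_def)
  have cz: "W.cz = s + 1 / 2 + ib / 2" by (simp add: W.cz_def ib_def)
  have KA: "W.KA = 8 / 25 * g - 4 * om * ib - 2 * om * ib\<^sup>2 - 1 - ib
      - eta * ((2 * s + 1 + ib) * G2 + 8 * ib * om\<^sup>2)"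
    unfolding W.KA_def cz g_def[symmetric] G2_def[symmetric] unfolding th
    using bib by (auto simp: algebra_simps power2_eq_square)
  have KH: "W.KH = 1 / 4 + 2 * ib + eta * (20 * s + 10 + 12 * ib)"
    unfolding W.KH_def cz unfolding th by (simp add: algebra_simps)
  have KB: "W.KB = 4 * ib * om - 25 / 18 * om * ib - 2 * ib / lo - 4 * ib * ((om + 1) / 9)
      - eta * ((2 * ib + 5 * W.cz) * om\<^sup>2 * hi)"
    unfolding W.KB_def by (simp add: ib_def)
  have KE: "W.KE = b * om * hi / 2 + 2 * om + eta * ((4 * s + 2 + 2 * ib) * G2 + 8 * ib * om\<^sup>2)"
    unfolding W.KE_def cz G2_def[symmetric] unfolding th using bib by (auto simp: algebra_simps)
  have g: "58 / 3 \<le> g"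
  proof -
    have "29 / 6 * 4 \<le> b * (om * lo)" using b_gt om_lo_gt by (intro mult_mono) auto
    then show ?thesis by (simp add: g_def mult_ac)
  qed
  have L: "Lf\<^sup>2 \<le> om\<^sup>2 * lo / (16 * (1 + b))"
    using A_le(1) omp lo_pos bp by (simp add: field_simps)
  \<comment> \<open>The smoothness constant is negligible to first order, and in the next step to second order.\<close>
  have L1: "Lf\<^sup>2 \<le> g / 100"
  proof -
    have "om / (1 + b) \<le> 4 / 7" using large bp omp by (simp add: divide_le_eq)
    then have "(om * lo / 16) * (om / (1 + b)) \<le> (om * lo / 16) * (4 / 7)"
      using omp lo_pos by (intro mult_left_mono) auto
    moreover have "om\<^sup>2 * lo / (16 * (1 + b)) = (om * lo / 16) * (om / (1 + b))"
      by (simp add: power2_eq_square)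
    ultimately have "Lf\<^sup>2 \<le> om * lo / 28" using L by linarith
    also have "\<dots> \<le> g / 100"
    proof -
      have "29 / 6 * (om * lo) \<le> b * (om * lo)" using b_gt omp lo_pos by (intro mult_right_mono) auto
      moreover have "0 < om * lo" using omp lo_pos by simp
      moreover have "g = b * (om * lo)" by (simp add: g_def)
      ultimately show ?thesis by linarith
    qed
    finally show ?thesis .
  qed
  have L2: "1000 * Lf\<^sup>2 \<le> G2"
  proof -
    have "g\<^sup>2 \<le> G2" unfolding g_def G2_def using G_ge_g g_gt_4 by (intro power_mono) auto
    moreover have "1000 * Lf\<^sup>2 \<le> g\<^sup>2"
    proof -
      have "29 / 6 * (9 / 2) \<le> b * (b * lo)" using b_gt b_lo by (intro mult_mono) auto
      then have k: "348 \<le> 16 * (b * (b * lo))" by simp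
      have "1000 * Lf\<^sup>2 \<le> 1000 * (om\<^sup>2 * lo / (16 * (1 + b)))" using L by simp
      also have "\<dots> = om\<^sup>2 * lo * (1000 / (16 * (1 + b)))" by simp
      also have "\<dots> \<le> om\<^sup>2 * lo * (b * (b * lo))"
      proof (rule mult_left_mono)
        have "1000 / (16 * (1 + b)) \<le> 1000 / (16 * 5)" using b_gt by (intro divide_left_mono) auto
        then show "1000 / (16 * (1 + b)) \<le> b * (b * lo)" using k by simp
      qed (use lo_pos in auto)
      also have "\<dots> = g\<^sup>2" by (simp add: g_def power2_eq_square mult_ac)
      finally show ?thesis .
    qed
    ultimately show ?thesis by linarith
  qed
  have G2om: "20 * om\<^sup>2 \<le> G2"
  proof -
    have "9 / 2 \<le> b * hi" using b_lo mult_left_mono[OF lo_le_hi, of b] bp by linarith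
    then have "(9 / 2)\<^sup>2 * om\<^sup>2 \<le> (b * hi)\<^sup>2 * om\<^sup>2" by (intro mult_right_mono power_mono) auto
    moreover have "20 * om\<^sup>2 \<le> (9 / 2)\<^sup>2 * om\<^sup>2" by (intro mult_right_mono) (auto simp: power2_eq_square)
    ultimately have "20 * om\<^sup>2 \<le> (b * hi)\<^sup>2 * om\<^sup>2" by linarith
    then show ?thesis by (simp add: G2_def power_mult_distrib mult_ac)
  qed
  have G20: "0 \<le> G2" by (simp add: G2_def)
  show ?thesis
  proof (unfold_locales)
    show "rate * (1 / 2 + 4 / b / (2 * (1 / 2) * lo)) \<le> W.KA - (W.KH + 1 / 2) * Lf\<^sup>2"
    proof -
      have "4 / b / (2 * (1 / 2) * lo) \<le> 8 / 9" using b_lo lo_pos bp by (simp add: field_simps)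
      then have "rate * (1 / 2 + 4 / b / (2 * (1 / 2) * lo)) \<le> rate * (11 / 20 * (1 / 2 + b))"
        using rate b_gt by (intro mult_left_mono) auto
      also have "\<dots> = 11 / 20 * (rate * (1 / 2 + b))" by simp
      also have "\<dots> \<le> 11 / 20 * (g / 2 - (9 * om + 4) / 4 - 5 / 4 * Lf\<^sup>2
        - eta * ((4 * s + 3) * G2 + (8 * s + 4) * Lf\<^sup>2 + 1 + 2 * om\<^sup>2))"
        using rX unfolding G2_def g_def by (intro mult_left_mono) auto
      also have "\<dots> \<le> W.KA - (W.KH + 1 / 2) * Lf\<^sup>2"
      proof -
        have sL: "s * (1000 * Lf\<^sup>2) \<le> s * G2" using L2 s_ge by (intro mult_left_mono) auto
        have sG: "3 * G2 \<le> s * G2" using s_ge G20 by (intro mult_right_mono)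
        have sL0: "0 \<le> s * Lf\<^sup>2" using s_ge by simp
        have i0: "ib * y \<le> 6 / 29 * y" if "0 \<le> y" for y
          using ib that by (intro mult_right_mono) auto
        have i1: "ib * G2 \<le> 6 / 29 * G2" "ib * om\<^sup>2 \<le> 6 / 29 * om\<^sup>2" "ib * Lf\<^sup>2 \<le> 6 / 29 * Lf\<^sup>2"
          using i0[OF G20] i0[of "om\<^sup>2"] i0[of "Lf\<^sup>2"] by auto
        define Z1 Z2 where "Z1 = eta * ((2 * s + 1 + ib) * G2 + 8 * ib * om\<^sup>2 + (20 * s + 10 + 12 * ib) * Lf\<^sup>2)"
          and "Z2 = eta * ((4 * s + 3) * G2 + (8 * s + 4) * Lf\<^sup>2 + 1 + 2 * om\<^sup>2)"
        define v1 v2 v3 v4 v5 where "v1 = s * G2" and "v2 = ib * G2" and "v3 = ib * om\<^sup>2"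
          and "v4 = ib * Lf\<^sup>2" and "v5 = s * Lf\<^sup>2"
        note vs = v1_def v2_def v3_def v4_def v5_def
        have "(2 * s + 1 + ib) * G2 + 8 * ib * om\<^sup>2 + (20 * s + 10 + 12 * ib) * Lf\<^sup>2
          = 2 * v1 + G2 + v2 + 8 * v3 + 20 * v5 + 10 * Lf\<^sup>2 + 12 * v4"
          unfolding vs by (simp add: algebra_simps)
        also have "\<dots> \<le> 11 / 20 * (4 * v1 + 3 * G2 + 8 * v5 + 4 * Lf\<^sup>2 + 1 + 2 * om\<^sup>2)"
        proof -
          have "1000 * v5 \<le> v1" using sL by (simp add: vs mult_ac)
          moreover have "3 * G2 \<le> v1" "0 \<le> v5" using sG sL0 by (simp_all add: vs)
          ultimately show ?thesis using i1[folded vs] G2om L2 zero_le_power2[of Lf] by argo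
        qed
        also have "\<dots> = 11 / 20 * ((4 * s + 3) * G2 + (8 * s + 4) * Lf\<^sup>2 + 1 + 2 * om\<^sup>2)"
          unfolding vs by (simp add: algebra_simps)
        finally have "(2 * s + 1 + ib) * G2 + 8 * ib * om\<^sup>2 + (20 * s + 10 + 12 * ib) * Lf\<^sup>2
          \<le> 11 / 20 * ((4 * s + 3) * G2 + (8 * s + 4) * Lf\<^sup>2 + 1 + 2 * om\<^sup>2)" .
        then have "eta * ((2 * s + 1 + ib) * G2 + 8 * ib * om\<^sup>2 + (20 * s + 10 + 12 * ib) * Lf\<^sup>2)
          \<le> eta * (11 / 20 * ((4 * s + 3) * G2 + (8 * s + 4) * Lf\<^sup>2 + 1 + 2 * om\<^sup>2))"
          using eta_pos by (intro mult_left_mono) auto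
        then have e: "Z1 \<le> 11 / 20 * Z2" unfolding Z1_def Z2_def by (simp only: mult.left_commute)
        have i2: "ib * om \<le> 6 / 29 * om" "ib\<^sup>2 * om \<le> (6 / 29)\<^sup>2 * om"
          using i0[of om] mult_right_mono[OF power_mono[of ib "6 / 29" 2], of om] ib omp by auto
        have "11 / 20 * (g / 2 - (9 * om + 4) / 4 - 5 / 4 * Lf\<^sup>2)
          = 11 / 40 * g - 99 / 80 * om - 11 / 20 - 11 / 16 * Lf\<^sup>2"
          by (simp add: algebra_simps add_divide_distrib)
        also have "\<dots> \<le> 8 / 25 * g - 4 * (ib * om) - 2 * (ib\<^sup>2 * om) - 1 - ib - 3 / 4 * Lf\<^sup>2 - 2 * (ib * Lf\<^sup>2)"
        proof -
          have "ib\<^sup>2 * om \<le> 36 / 841 * om" using i2(2) by (simp add: power2_eq_square)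
          then show ?thesis using i1(3) i2(1) L1 g ib omp zero_le_power2[of Lf] by argo
        qed
        also have "\<dots> = 8 / 25 * g - 4 * om * ib - 2 * om * ib\<^sup>2 - 1 - ib - (3 / 4 + 2 * ib) * Lf\<^sup>2"
          by (simp add: algebra_simps)
        finally have "11 / 20 * (g / 2 - (9 * om + 4) / 4 - 5 / 4 * Lf\<^sup>2)
          \<le> 8 / 25 * g - 4 * om * ib - 2 * om * ib\<^sup>2 - 1 - ib - (3 / 4 + 2 * ib) * Lf\<^sup>2" .
        moreover have "W.KA - (W.KH + 1 / 2) * Lf\<^sup>2
          = 8 / 25 * g - 4 * om * ib - 2 * om * ib\<^sup>2 - 1 - ib - (3 / 4 + 2 * ib) * Lf\<^sup>2 - Z1"
          unfolding KA KH Z1_def by (simp add: algebra_simps)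
        ultimately show ?thesis using e unfolding Z2_def[symmetric] by argo
      qed
      finally show ?thesis .
    qed
    have ebs: "0 \<le> eta * (om\<^sup>2 * hi + 1 / lo + 4 * s * om\<^sup>2 * lo)"
      using eta_pos hp lo_pos s_ge by auto
    have rY': "rate * ((4 + 4 / b * (1 / 2)) / 2) \<le> 2 * ib * ((3 * om - 1) / 4 - 3 / lo)"
    proof -
      have "rate * ((4 + 4 / b * (1 / 2)) / 2) = 2 * ib * (rate * (1 / 2 + b))"
        using bp by (simp add: ib_def field_simps)
      also have "\<dots> \<le> 2 * ib * ((3 * om - 1) / 4 - 3 / lo)"
        using rY ebs ib by (intro mult_left_mono) auto
      finally show ?thesis .
    qed
    show "rate * ((4 + 4 / b * (1 / 2)) / 2) \<le> W.KB"
    proof -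
      have "1 + 5 / 2 * b * W.cz \<le> 2 / 3 * (b * (4 * s + 3))"
      proof -
        have "b * W.cz = b * s + b / 2 + 1 / 2" using bib by (simp add: cz algebra_simps)
        moreover have "b * 3 \<le> b * s" using s_ge bp by (intro mult_left_mono) auto
        moreover have "1 + 5 / 2 * b * W.cz = 1 + 5 / 2 * (b * W.cz)" by simp
        moreover have "2 / 3 * (b * (4 * s + 3)) = 8 / 3 * (b * s) + 2 * b" by (simp add: algebra_simps)
        ultimately show ?thesis using b_gt by argo
      qed
      then have "eta * om * hi * (1 + 5 / 2 * b * W.cz) \<le> eta * om * hi * (2 / 3 * (b * (4 * s + 3)))"
        using eta_pos omp hp by (intro mult_left_mono) auto
      also have "\<dots> = 2 / 3 * (eta * om * hi * (b * (4 * s + 3)))" by simp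
      also have "\<dots> \<le> 2 / 3 * (1 / 2)" by (intro mult_left_mono eta_hi_le') simp
      finally have "om * (eta * om * hi * (1 + 5 / 2 * b * W.cz)) \<le> om * (1 / 3)"
        using omp by (intro mult_left_mono) auto
      moreover define t U where "t = 1 / lo" and "U = om * (eta * om * hi * (1 + 5 / 2 * b * W.cz))"
      moreover have "0 \<le> t" using lo_pos by (simp add: t_def)
      ultimately have "(3 * om - 1) / 4 - 3 * t \<le> 2 * om - 25 / 36 * om - t - 2 * ((om + 1) / 9) - U"
        using omp by argo
      then have "(3 * om - 1) / 4 - 3 / lo \<le> 2 * om - 25 / 36 * om - 1 / lo - 2 * ((om + 1) / 9)
         - om * (eta * om * hi * (1 + 5 / 2 * b * W.cz))"
        by (simp add: t_def U_def)
      then have "2 * ib * ((3 * om - 1) / 4 - 3 / lo) \<le> 2 * ib * (2 * om - 25 / 36 * om - 1 / lo - 2 * ((om + 1) / 9)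
         - om * (eta * om * hi * (1 + 5 / 2 * b * W.cz)))"
        using ib by (intro mult_left_mono) auto
      also have "\<dots> = 4 * ib * om - 25 / 18 * om * ib - 2 * ib / lo - 4 * ib * ((om + 1) / 9)
         - om * (eta * om * hi * (2 * ib + 5 * (b * ib) * W.cz))"
        by (simp add: algebra_simps)
      also have "\<dots> = W.KB" unfolding KB bib by (simp add: power2_eq_square algebra_simps)
      finally show ?thesis using rY' by linarith
    qed
    show "4 / b * ((om + 1) / 9) + rate * ((4 + 4 / b * (1 / 2)) / 2) \<le> lo * om\<^sup>2 / 3"
    proof -
      have "0 \<le> 3 / lo" using lo_pos by simp
      then have "(3 * om - 1) / 4 - 3 / lo \<le> (3 * om - 1) / 4" by linarith
      then have "2 * ib * ((3 * om - 1) / 4 - 3 / lo) \<le> 2 * ib * ((3 * om - 1) / 4)"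
        using ib by (intro mult_left_mono) auto
      then have "4 / b * ((om + 1) / 9) + rate * ((4 + 4 / b * (1 / 2)) / 2)
        \<le> 4 / b * ((om + 1) / 9) + 2 * ib * ((3 * om - 1) / 4)"
        using rY' by linarith
      also have "\<dots> = ib * (4 * ((om + 1) / 9) + 2 * ((3 * om - 1) / 4))"
        by (simp add: th field_simps)
      also have "\<dots> \<le> 1 / 4 * (4 * ((om + 1) / 9) + 2 * ((3 * om - 1) / 4))"
        using ib om_gt by (intro mult_right_mono) auto
      also have "\<dots> \<le> om * 1" using om_gt by argo
      also have "\<dots> \<le> om * (om * lo / 3)" using omp om_lo_gt by (intro mult_left_mono) auto
      finally show ?thesis by (simp add: power2_eq_square mult_ac)
    qed
    define T where "T = 9 / (om + 1)"
    have T: "0 \<le> T" "T \<le> 7" "T \<le> 2 * (1 + b)"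
    proof -
      show "0 \<le> T" using omp by (simp add: T_def)
      show "T \<le> 7" using om_gt by (simp add: T_def divide_le_eq)
      then show "T \<le> 2 * (1 + b)" using b_gt by simp
    qed
    have KD: "W.KD * Lf\<^sup>2 \<le> (T * ((1 + b) * Lf\<^sup>2 / (om\<^sup>2 * lo)) + Lf\<^sup>2 / (om\<^sup>2 * lo\<^sup>2)) / eta
      + (1 + b) * Lf\<^sup>2 / (om\<^sup>2 * lo) + 2 * (Lf\<^sup>2 / (om\<^sup>2 * lo\<^sup>2))"
    proof -
      have "W.KD * Lf\<^sup>2 = 4 * (Lf\<^sup>2 / (om\<^sup>2 * lo)) + T * (b * (Lf\<^sup>2 / (om\<^sup>2 * lo))) / eta
        + 4 * ib * (Lf\<^sup>2 / (om\<^sup>2 * lo\<^sup>2)) / eta + 8 * ib * (Lf\<^sup>2 / (om\<^sup>2 * lo\<^sup>2))"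
      proof -
        have "16 / (4 * eta * (4 / b * ((om + 1) / 9)) * om\<^sup>2 * lo) * Lf\<^sup>2 = T * (b * (Lf\<^sup>2 / (om\<^sup>2 * lo))) / eta"
        proof -
          have "16 / (4 * e * (4 / b * (m / 9)) * o1 * l1) * F = 9 / m * (b * (F / (o1 * l1))) / e" for e m o1 l1 F :: real
            using bp by (simp add: mult_ac)
          then show ?thesis unfolding T_def .
        qed
        then show ?thesis unfolding W.KD_def distrib_right by (simp add: ib_def mult_ac)
      qed
      also have "\<dots> \<le> (1 + b) * (Lf\<^sup>2 / (om\<^sup>2 * lo)) + T * ((1 + b) * (Lf\<^sup>2 / (om\<^sup>2 * lo))) / eta
        + 1 * (Lf\<^sup>2 / (om\<^sup>2 * lo\<^sup>2)) / eta + 2 * (Lf\<^sup>2 / (om\<^sup>2 * lo\<^sup>2))"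
        using b_gt ib eta_pos lo_pos T(1)
        by (intro add_mono mult_right_mono divide_right_mono mult_left_mono) auto
      finally show ?thesis by (simp add: add_divide_distrib)
    qed
    show "eta * (W.KD * Lf\<^sup>2 + Lf + s) \<le> 1 / 2"
      "W.KD * Lf\<^sup>2 \<le> drift_noise + 1 / 8"
      by (rule drift_bounds[OF T KD])+
    show "W.KE \<le> (b * om / 2 + om) * hi + 2 * om + eta * ((4 * s + 3) * (b * om * hi)\<^sup>2 + 1 + 2 * om\<^sup>2)"
    proof -
      have "(4 * s + 2 + 2 * ib) * G2 \<le> (4 * s + 3) * G2" "8 * ib * om\<^sup>2 \<le> 2 * om\<^sup>2"
        using ib G20 by (intro mult_right_mono; simp)+
      then have "eta * ((4 * s + 2 + 2 * ib) * G2 + 8 * ib * om\<^sup>2) \<le> eta * ((4 * s + 3) * G2 + 1 + 2 * om\<^sup>2)"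
        using eta_pos by (intro mult_left_mono) auto
      moreover have "0 \<le> om * hi" using omp hp by simp
      ultimately show ?thesis unfolding KE G2_def by (simp add: algebra_simps)
    qed
    show "W.cz \<le> s + 5 / 8" using ib by (simp add: cz)
  qed (use rate in auto)
qed

end

section \<open>Modal coordinates and the spectrum of the Laplacian\<close>

definition modal :: "real^'m^'n \<Rightarrow> real^'d^'n \<Rightarrow> 'm \<Rightarrow> real^'d" where
  "modal R x k = (\<Sum>i\<in>UNIV. R $ i $ k *\<^sub>R x $ i)"

text \<open>
  The coordinate along \<open>\<rho>\<close>. Together with the modes it gives an isometry of the stacked space, which
  is why it is scaled with \<open>1 / \<surd>n\<close> and not with \<open>1 / n\<close>.
\<close>

definition mean_mode :: "real^'d^'n \<Rightarrow> real^'d" where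
  "mean_mode x = (1 / sqrt (real CARD('n))) *\<^sub>R (\<Sum>i\<in>UNIV. x $ i)"

lemma modal_add: "modal R (x + y) k = modal R x k + modal R y k"
  by (simp add: modal_def scaleR_add_right sum.distrib)

lemma modal_diff: "modal R (x - y) k = modal R x k - modal R y k"
  by (simp add: modal_def scaleR_diff_right sum_subtractf)

lemma modal_scaleR: "modal R (c *\<^sub>R x) k = c *\<^sub>R modal R x k"
  by (simp add: modal_def scaleR_sum_right mult.commute)

lemma mean_mode_add: "mean_mode (x + y) = mean_mode x + mean_mode y"
  by (simp add: mean_mode_def scaleR_add_right sum.distrib)

lemma mean_mode_diff: "mean_mode (x - y) = mean_mode x - mean_mode y"
  by (simp add: mean_mode_def scaleR_diff_right sum_subtractf)

lemma mean_mode_scaleR: "mean_mode (c *\<^sub>R x) = c *\<^sub>R mean_mode x"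
  by (simp add: mean_mode_def scaleR_sum_right mult.commute)

lemma mean_mode_agent_mean:
  fixes x :: "real^'d^'n::finite"
  shows "mean_mode x = sqrt (real CARD('n)) *\<^sub>R agent_mean (($) x)"
proof -
  have "sqrt (real CARD('n)) * (1 / real CARD('n)) = 1 / sqrt (real CARD('n))"
    by (simp add: real_div_sqrt field_simps)
  then show ?thesis by (simp add: mean_mode_def agent_mean_def)
qed

locale eigen_decomp =
  fixes L :: "real^'n::finite^'n" and lam :: "real^'m::finite" and R :: "real^'m^'n"
  assumes decomp: "laplacian_eigen_decomp L lam R"
begin

lemma lam_pos: "0 < lam $ k"
  using decomp by (simp add: laplacian_eigen_decomp_def)

lemma R_orthonormal: "(\<Sum>i\<in>UNIV. R $ i $ k * R $ i $ l) = (if k = l then 1 else 0)"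
proof -
  have "(transpose R ** R) $ k $ l = (mat 1 :: real^'m^'m) $ k $ l"
    using decomp by (simp add: laplacian_eigen_decomp_def)
  then show ?thesis by (simp add: matrix_matrix_mult_def transpose_def mat_def)
qed

lemma R_sum_zero: "(\<Sum>i\<in>UNIV. R $ i $ k) = 0"
proof -
  have "(transpose R *v rho_vec) $ k = (0 :: real^'m) $ k"
    using decomp by (simp add: laplacian_eigen_decomp_def)
  then show ?thesis
    by (simp add: matrix_vector_mult_def transpose_def rho_vec_def sum_divide_distrib[symmetric])
qed

lemma R_complete: "(\<Sum>k\<in>UNIV. R $ i $ k * R $ j $ k) = (if i = j then 1 else 0) - 1 / real CARD('n)"
proof -
  have "(outer rho_vec rho_vec + R ** transpose R) $ i $ j = (mat 1 :: real^'n^'n) $ i $ j"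
    using decomp by (simp add: laplacian_eigen_decomp_def)
  then show ?thesis
    by (simp add: matrix_matrix_mult_def transpose_def mat_def outer_def rho_vec_def)
qed

lemma L_entry: "L $ i $ j = (\<Sum>k\<in>UNIV. lam $ k * (R $ i $ k * R $ j $ k))"
proof -
  have "L $ i $ j = (R ** diag_mat lam ** transpose R) $ i $ j"
    using decomp by (simp add: laplacian_eigen_decomp_def)
  also have "\<dots> = (\<Sum>k\<in>UNIV. (\<Sum>l\<in>UNIV. R $ i $ l * (if l = k then lam $ l else 0)) * R $ j $ k)"
    by (simp add: matrix_matrix_mult_def transpose_def diag_mat_def)
  also have "\<dots> = (\<Sum>k\<in>UNIV. lam $ k * (R $ i $ k * R $ j $ k))"
    by (intro sum.cong refl) (simp add: if_distrib[of "(*) _"] cong: if_cong)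
  finally show ?thesis .
qed

lemma parseval:
  fixes x y :: "real^'d^'n"
  shows "(\<Sum>k\<in>UNIV. modal R x k \<bullet> modal R y k) + mean_mode x \<bullet> mean_mode y = x \<bullet> y"
proof -
  let ?n = "real CARD('n)"
  have "(\<Sum>k\<in>UNIV. modal R x k \<bullet> modal R y k)
    = (\<Sum>k\<in>UNIV. \<Sum>i\<in>UNIV. \<Sum>j\<in>UNIV. (R $ i $ k * R $ j $ k) * (x $ i \<bullet> y $ j))"
    by (simp add: modal_def inner_sum_left inner_sum_right sum_distrib_left mult.assoc)
      (rule sum.cong[OF refl], subst sum.swap, simp add: mult.left_commute)
  also have "\<dots> = (\<Sum>i\<in>UNIV. \<Sum>j\<in>UNIV. (\<Sum>k\<in>UNIV. R $ i $ k * R $ j $ k) * (x $ i \<bullet> y $ j))"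
    by (subst sum.swap, rule sum.cong, rule refl, subst sum.swap) (simp add: sum_distrib_right)
  also have "\<dots> = (\<Sum>i\<in>UNIV. \<Sum>j\<in>UNIV. (if i = j then x $ i \<bullet> y $ j else 0)) - (\<Sum>i\<in>UNIV. \<Sum>j\<in>UNIV. (x $ i \<bullet> y $ j) / ?n)"
    unfolding R_complete sum_subtractf[symmetric]
    by (intro sum.cong refl) (simp add: left_diff_distrib)
  also have "\<dots> = x \<bullet> y - mean_mode x \<bullet> mean_mode y"
    unfolding inner_vec_def[of x y]
    by (simp add: mean_mode_def inner_sum_left inner_sum_right sum_divide_distrib[symmetric]) (rule sum.swap)
  finally show ?thesis by simp
qed

lemma parseval_norm:
  fixes x :: "real^'d^'n"
  shows "(\<Sum>k\<in>UNIV. (norm (modal R x k))\<^sup>2) + (norm (mean_mode x))\<^sup>2 = (norm x)\<^sup>2"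
  using parseval[of x x] by (simp add: power2_norm_eq_inner)

text \<open>
  All matrices in the analysis (\<open>L\<close>, \<open>K\<close>, \<open>P\<close>) are functions of the Laplacian, with eigenvalue \<open>a\<close> on
  \<open>\<rho>\<close> and \<open>c k\<close> on column \<open>k\<close> of \<open>R\<close>, and act diagonally in modal coordinates.
\<close>

definition spectral_mat :: "real \<Rightarrow> ('m \<Rightarrow> real) \<Rightarrow> real^'n^'n \<Rightarrow> bool" where
  "spectral_mat a c A \<longleftrightarrow> (\<forall>i j. A $ i $ j = a / real CARD('n) + (\<Sum>k\<in>UNIV. c k * (R $ i $ k * R $ j $ k)))"

lemma modal_kron_spectral:
  assumes "spectral_mat a c A"
  shows "modal R (kron_id A x) k = c k *\<^sub>R modal R x k"
proof -
  have A: "(\<Sum>i\<in>UNIV. R $ i $ k * A $ i $ j) = c k * R $ j $ k" for j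
  proof -
    have "(\<Sum>i\<in>UNIV. R $ i $ k * A $ i $ j)
      = (\<Sum>i\<in>UNIV. R $ i $ k) * (a / real CARD('n)) + (\<Sum>i\<in>UNIV. \<Sum>l\<in>UNIV. (c l * R $ j $ l) * (R $ i $ k * R $ i $ l))"
      using assms by (simp add: spectral_mat_def distrib_left sum.distrib sum_distrib_left sum_distrib_right mult_ac)
    also have "\<dots> = (\<Sum>l\<in>UNIV. (c l * R $ j $ l) * (\<Sum>i\<in>UNIV. R $ i $ k * R $ i $ l))"
      by (subst sum.swap) (simp add: R_sum_zero sum_distrib_left)
    also have "\<dots> = c k * R $ j $ k"
      by (simp add: R_orthonormal if_distrib[of "(*) _"] cong: if_cong)
    finally show ?thesis .
  qed
  have "modal R (kron_id A x) k = (\<Sum>j\<in>UNIV. (\<Sum>i\<in>UNIV. R $ i $ k * A $ i $ j) *\<^sub>R x $ j)"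
    unfolding modal_def kron_id_def
    by (simp add: scaleR_sum_right scaleR_sum_left) (rule sum.swap)
  also have "\<dots> = c k *\<^sub>R modal R x k" unfolding A modal_def by (simp add: scaleR_sum_right)
  finally show ?thesis .
qed

lemma mean_mode_kron_spectral:
  assumes "spectral_mat a c A"
  shows "mean_mode (kron_id A x) = a *\<^sub>R mean_mode x"
proof -
  have A: "(\<Sum>i\<in>UNIV. A $ i $ j) = a" for j
  proof -
    have "(\<Sum>i\<in>UNIV. A $ i $ j) = a + (\<Sum>i\<in>UNIV. \<Sum>l\<in>UNIV. (c l * R $ j $ l) * R $ i $ l)"
      using assms by (simp add: spectral_mat_def sum.distrib mult_ac)
    also have "\<dots> = a"
      by (subst sum.swap) (simp add: R_sum_zero sum_distrib_left[symmetric])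
    finally show ?thesis .
  qed
  have "(\<Sum>i\<in>UNIV. kron_id A x $ i) = (\<Sum>j\<in>UNIV. (\<Sum>i\<in>UNIV. A $ i $ j) *\<^sub>R x $ j)"
    unfolding kron_id_def by (simp add: scaleR_sum_left) (rule sum.swap)
  then show ?thesis unfolding A mean_mode_def by (simp add: scaleR_sum_right mult.commute)
qed

lemma inner_kron_spectral:
  fixes x y :: "real^'d^'n"
  assumes "spectral_mat a c A"
  shows "x \<bullet> kron_id A y = (\<Sum>k\<in>UNIV. c k * (modal R x k \<bullet> modal R y k)) + a * (mean_mode x \<bullet> mean_mode y)"
  unfolding parseval[of x "kron_id A y", symmetric]
  by (simp add: modal_kron_spectral[OF assms] mean_mode_kron_spectral[OF assms])

lemma spectral_L: "spectral_mat 0 (($) lam) L"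
  by (simp add: spectral_mat_def L_entry)

lemma spectral_K: "spectral_mat 0 (\<lambda>_. 1) K_mat"
  unfolding spectral_mat_def by (simp add: R_complete K_mat_def outer_def mat_def)

lemma spectral_P: "spectral_mat (1 / Max (range (($) lam))) (\<lambda>k. 1 / lam $ k) (P_mat lam R)"
proof -
  define D where "D = (diag_mat (\<chi> k. 1 / lam $ k) :: real^'m^'m)"
  have lp: "lam $ k \<noteq> 0" for k using lam_pos[of k] by simp
  have mult: "diag_mat u ** diag_mat w = diag_mat (\<chi> k. u $ k * w $ k)" for u w :: "real^'m"
    by (auto simp: vec_eq_iff matrix_matrix_mult_def diag_mat_def if_distrib[of "\<lambda>x. x * _"] cong: if_cong)
  have one: "diag_mat (\<chi> k. 1) = (mat 1 :: real^'m^'m)"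
    by (simp add: vec_eq_iff diag_mat_def mat_def)
  have DD: "diag_mat lam ** D = mat 1" "D ** diag_mat lam = mat 1"
    using lp by (simp_all add: D_def mult one)
  have inv: "matrix_inv (diag_mat lam) = D"
  proof -
    have "matrix_inv (diag_mat lam) ** diag_mat lam = mat 1"
      unfolding matrix_inv_def by (rule someI2[of _ D]) (use DD in auto)
    then have "matrix_inv (diag_mat lam) ** (diag_mat lam ** D) = D" by (simp add: matrix_mul_assoc)
    then show ?thesis by (simp add: DD)
  qed
  have "(R ** D ** transpose R) $ i $ j = (\<Sum>k\<in>UNIV. 1 / lam $ k * (R $ i $ k * R $ j $ k))" for i j
    by (auto simp: D_def matrix_matrix_mult_def transpose_def diag_mat_def if_distrib[of "(*) _"] cong: if_cong
        intro!: sum.cong)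
  then show ?thesis
    by (simp add: spectral_mat_def P_mat_def inv outer_def rho_vec_def)
qed

lemma consensus_error_modal:
  fixes x :: "real^'d^'n"
  shows "(\<Sum>i\<in>UNIV. (norm (x $ i - agent_mean (($) x)))\<^sup>2) = (\<Sum>k\<in>UNIV. (norm (modal R x k))\<^sup>2)"
proof -
  define m where "m = agent_mean (($) x)"
  have "(\<Sum>i\<in>UNIV. (norm (x $ i - m))\<^sup>2)
    = (\<Sum>i\<in>UNIV. (norm (x $ i))\<^sup>2) - 2 * ((\<Sum>i\<in>UNIV. x $ i) \<bullet> m) + real CARD('n) * (norm m)\<^sup>2"
    by (simp add: power2_norm_eq_inner inner_simps inner_commute sum.distrib sum_subtractf inner_sum_right
        sum_distrib_left[symmetric])
  also have "(\<Sum>i\<in>UNIV. x $ i) = real CARD('n) *\<^sub>R m" by (simp add: m_def agent_mean_def)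
  also have "(\<Sum>i\<in>UNIV. (norm (x $ i))\<^sup>2) = (norm x)\<^sup>2"
    unfolding power2_norm_eq_inner inner_vec_def[of x x] ..
  also have "(norm x)\<^sup>2 - 2 * ((real CARD('n) *\<^sub>R m) \<bullet> m) + real CARD('n) * (norm m)\<^sup>2 = (norm x)\<^sup>2 - (norm (mean_mode x))\<^sup>2"
    by (simp add: mean_mode_agent_mean m_def power_mult_distrib dot_square_norm)
  also have "\<dots> = (\<Sum>k\<in>UNIV. (norm (modal R x k))\<^sup>2)" using parseval_norm[of x] by simp
  finally show ?thesis by (simp add: m_def)
qed

end

text \<open>
  Stated over an arbitrary field because the smallest positive eigenvalue is taken over the reals
  and the spectral radius over the complex numbers.
\<close>

lemma eigenvalue_spectral_sum:
  fixes A :: "'a::field^'n::finite^'n" and r :: "'n \<Rightarrow> 'm::finite \<Rightarrow> 'a"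
  assumes A: "\<And>i j. A $ i $ j = (\<Sum>k\<in>UNIV. l k * (r i k * r j k))"
    and orth: "\<And>k k'. (\<Sum>i\<in>UNIV. r i k * r i k') = (if k = k' then 1 else 0)"
  shows "is_eigenvalue A \<mu> \<Longrightarrow> \<mu> = 0 \<or> \<mu> \<in> range l" and "is_eigenvalue A (l k)"
proof -
  have Av: "(A *v v) $ i = (\<Sum>k\<in>UNIV. l k * r i k * (\<Sum>j\<in>UNIV. r j k * v $ j))" for v i
    unfolding matrix_vector_mult_def A
    by (simp add: sum_distrib_left sum_distrib_right mult.assoc) (rule sum.swap)
  show "\<mu> = 0 \<or> \<mu> \<in> range l" if e: "is_eigenvalue A \<mu>"
  proof -
    obtain v where v: "v \<noteq> 0" "A *v v = \<mu> *s v" using e by (auto simp: is_eigenvalue_def)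
    define w where "w k = (\<Sum>j\<in>UNIV. r j k * v $ j)" for k
    have "\<mu> * w k = l k * w k" for k
    proof -
      have "\<mu> * w k = (\<Sum>i\<in>UNIV. r i k * (A *v v) $ i)"
        unfolding v(2) w_def by (simp add: sum_distrib_left mult_ac)
      also have "\<dots> = (\<Sum>k'\<in>UNIV. l k' * w k' * (\<Sum>i\<in>UNIV. r i k * r i k'))"
        unfolding Av w_def[symmetric] by (simp add: sum_distrib_left mult_ac) (rule sum.swap)
      also have "\<dots> = l k * w k" by (simp add: orth if_distrib[of "(*) _"] cong: if_cong)
      finally show ?thesis .
    qed
    moreover have "\<mu> = 0" if "\<And>k. w k = 0"
    proof -
      have "A *v v = 0" using that by (simp add: vec_eq_iff Av w_def[symmetric])
      then show ?thesis using v by (simp add: vec_eq_iff) blast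
    qed
    ultimately show ?thesis by (metis mult_right_cancel rangeI)
  qed
  show "is_eigenvalue A (l k)"
    unfolding is_eigenvalue_def
  proof (intro exI conjI)
    let ?v = "\<chi> i. r i k"
    show "A *v ?v = l k *s ?v"
      by (simp add: vec_eq_iff Av orth if_distrib[of "(*) _"] cong: if_cong)
    show "?v \<noteq> 0"
    proof
      assume "?v = 0"
      then have "r i k = 0" for i by (simp add: vec_eq_iff)
      then show False using orth[of k k] by simp
    qed
  qed
qed

context eigen_decomp
begin

lemma lam_ge_min: "min_pos_eigenvalue L \<le> lam $ k"
  and min_pos: "0 < min_pos_eigenvalue L"
proof -
  note e = eigenvalue_spectral_sum[of L "($) lam" "\<lambda>i k. R $ i $ k", OF L_entry R_orthonormal]
  let ?S = "{\<mu>. 0 < \<mu> \<and> is_eigenvalue L \<mu>}"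
  have fin: "finite ?S"
    by (rule finite_subset[of _ "insert 0 (range (($) lam))"]) (use e(1) in auto)
  have mem: "lam $ k \<in> ?S" for k using e(2) lam_pos by simp
  show "min_pos_eigenvalue L \<le> lam $ k"
    unfolding min_pos_eigenvalue_def by (rule Min_le[OF fin mem])
  have "Min ?S \<in> ?S" using mem by (intro Min_in[OF fin]) auto
  then show "0 < min_pos_eigenvalue L" by (simp add: min_pos_eigenvalue_def)
qed

lemma lam_le_max: "lam $ k \<le> spec_radius L"
proof -
  let ?A = "map_matrix complex_of_real L"
  have A: "?A $ i $ j = (\<Sum>k\<in>UNIV. complex_of_real (lam $ k) * (complex_of_real (R $ i $ k) * complex_of_real (R $ j $ k)))" for i j
    by (simp add: map_matrix_def L_entry)
  have orth: "(\<Sum>i\<in>UNIV. complex_of_real (R $ i $ k) * complex_of_real (R $ i $ k')) = (if k = k' then 1 else 0)" for k k'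
    using arg_cong[OF R_orthonormal[of k k'], of complex_of_real] by (simp split: if_splits)
  note e = eigenvalue_spectral_sum[of ?A "\<lambda>k. complex_of_real (lam $ k)", OF A orth]
  have "finite {\<mu>. is_eigenvalue ?A \<mu>}"
    by (rule finite_subset[of _ "insert 0 (range (\<lambda>k. complex_of_real (lam $ k)))"]) (use e(1) in auto)
  then have fin: "finite {cmod \<mu> |\<mu>. is_eigenvalue ?A \<mu>}" by simp
  have "cmod (complex_of_real (lam $ k)) \<in> {cmod \<mu> |\<mu>. is_eigenvalue ?A \<mu>}" using e(2) by blast
  then show ?thesis unfolding spec_radius_def using lam_pos[of k] Max_ge[OF fin] by fastforce
qed

end

section \<open>Smooth functions\<close>

lemma grad_eqI:
  assumes "GDERIV h x :> D"
  shows "grad h x = D"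
proof -
  have "D' = D" if "GDERIV h x :> D'" for D'
  proof -
    have "(\<lambda>v. v \<bullet> D') = (\<lambda>v. v \<bullet> D)"
      using that assms unfolding gderiv_def by (rule has_derivative_unique)
    then show ?thesis by (metis inner_commute vector_eq_ldot)
  qed
  then show ?thesis unfolding grad_def using assms by blast
qed

lemma GDERIV_grad:
  assumes "L_smooth l h"
  shows "GDERIV h x :> grad h x"
proof -
  obtain D where D: "GDERIV h x :> D" using assms unfolding L_smooth_def by blast
  then show ?thesis by (simp add: grad_eqI)
qed

lemma L_smooth_grad_diff: "L_smooth l h \<Longrightarrow> norm (grad h x - grad h y) \<le> l * norm (x - y)"
  unfolding L_smooth_def by blast

text \<open>
  The mean value theorem gives the descent inequality with the constant \<open>l\<close> instead of \<open>l / 2\<close>; this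
  is sharp enough for the given constants.
\<close>

lemma L_smooth_descent:
  fixes h :: "'v::real_inner \<Rightarrow> real"
  assumes h: "L_smooth l h" and l: "0 \<le> l"
  shows "h (x + d) \<le> h x + grad h x \<bullet> d + l * (norm d)\<^sup>2"
proof -
  define ph where "ph t = h (x + t *\<^sub>R d)" for t :: real
  have der: "(ph has_real_derivative (grad h (x + t *\<^sub>R d) \<bullet> d)) (at t)" for t
  proof -
    have "(h has_derivative (\<lambda>v. v \<bullet> grad h (x + t *\<^sub>R d))) (at (x + t *\<^sub>R d))"
      using GDERIV_grad[OF h] unfolding gderiv_def .
    moreover have "((\<lambda>t. x + t *\<^sub>R d) has_derivative (\<lambda>s. s *\<^sub>R d)) (at t)"
      by (auto intro!: derivative_eq_intros)
    ultimately have "((\<lambda>t. h (x + t *\<^sub>R d)) has_derivative (\<lambda>s. (s *\<^sub>R d) \<bullet> grad h (x + t *\<^sub>R d))) (at t)"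
      by (rule has_derivative_compose[rotated])
    then show ?thesis unfolding has_field_derivative_def ph_def
      by (simp add: inner_commute mult_commute_abs)
  qed
  obtain z where z: "0 < z" "z < 1" "ph 1 - ph 0 = (1 - 0) * (grad h (x + z *\<^sub>R d) \<bullet> d)"
    using MVT2[of 0 1 ph "\<lambda>t. grad h (x + t *\<^sub>R d) \<bullet> d"] der by auto
  have "(grad h (x + z *\<^sub>R d) - grad h x) \<bullet> d \<le> norm (grad h (x + z *\<^sub>R d) - grad h x) * norm d"
    by (rule norm_cauchy_schwarz)
  also have "\<dots> \<le> (l * norm (x + z *\<^sub>R d - x)) * norm d"
    by (intro mult_right_mono L_smooth_grad_diff[OF h]) simp
  also have "\<dots> = z * (l * (norm d)\<^sup>2)" using z by (simp add: power2_eq_square)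
  also have "\<dots> \<le> 1 * (l * (norm d)\<^sup>2)" using z l by (intro mult_right_mono) auto
  finally show ?thesis using z(3) by (simp add: ph_def inner_diff_left)
qed

lemma continuous_grad:
  fixes h :: "'v::real_inner \<Rightarrow> real"
  assumes "L_smooth l h" "0 \<le> l"
  shows "continuous_on UNIV (grad h)"
proof -
  have "l-lipschitz_on UNIV (grad h)"
    using assms by (auto simp: lipschitz_on_def L_smooth_def dist_norm)
  then show ?thesis by (rule lipschitz_on_continuous_on)
qed

lemma continuous_L_smooth:
  fixes h :: "'v::real_inner \<Rightarrow> real"
  assumes "L_smooth l h"
  shows "continuous_on UNIV h"
  using GDERIV_grad[OF assms] unfolding gderiv_def
  by (meson continuous_at_imp_continuous_on has_derivative_continuous)

lemma grad_avg_obj: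
  fixes f :: "'n::finite \<Rightarrow> 'v::real_inner \<Rightarrow> real"
  assumes "\<And>i. L_smooth l (f i)"
  shows "GDERIV (avg_obj f) x :> agent_mean (\<lambda>i. grad (f i) x)"
    and "grad (avg_obj f) x = agent_mean (\<lambda>i. grad (f i) x)"
proof -
  have "(f i has_derivative (\<lambda>v. v \<bullet> grad (f i) x)) (at x)" for i
    using GDERIV_grad[OF assms] unfolding gderiv_def .
  then have "(avg_obj f has_derivative (\<lambda>v. (1 / real CARD('n)) * (\<Sum>i\<in>UNIV. v \<bullet> grad (f i) x))) (at x)"
    unfolding avg_obj_def by (intro has_derivative_mult_right has_derivative_sum) auto
  then show "GDERIV (avg_obj f) x :> agent_mean (\<lambda>i. grad (f i) x)"
    unfolding gderiv_def agent_mean_def by (simp add: inner_sum_right)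
  then show "grad (avg_obj f) x = agent_mean (\<lambda>i. grad (f i) x)" by (rule grad_eqI)
qed

lemma L_smooth_avg_obj:
  fixes f :: "'n::finite \<Rightarrow> 'v::real_inner \<Rightarrow> real"
  assumes f: "\<And>i. L_smooth l (f i)"
  shows "L_smooth l (avg_obj f)"
proof -
  have "norm (grad (avg_obj f) x - grad (avg_obj f) y) \<le> l * norm (x - y)" for x y
  proof -
    have "norm (\<Sum>i\<in>UNIV. grad (f i) x - grad (f i) y) \<le> (\<Sum>i\<in>(UNIV::'n set). l * norm (x - y))"
      using f by (intro sum_norm_le) (auto simp: L_smooth_def)
    then have "(1 / real CARD('n)) * norm (\<Sum>i\<in>UNIV. grad (f i) x - grad (f i) y) \<le> l * norm (x - y)"
      by (simp add: field_simps)
    then show ?thesis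
      by (simp add: grad_avg_obj(2)[OF f] agent_mean_def sum_subtractf scaleR_diff_right[symmetric])
  qed
  then show ?thesis using grad_avg_obj(1)[of l f, OF f] unfolding L_smooth_def by blast
qed

section \<open>Pathwise decrease of the Lyapunov function\<close>

text \<open>
  The deterministic data of a step. Here \<open>ph2\<close> and \<open>r0\<close> are the contraction and the amplification
  constant of the compression, and \<open>contr_U\<close> says that its contraction outweighs the error that it
  feeds into the modes.
\<close>

locale lyapunov_step = eigen_decomp L lam R +
  contracting_weights lo hi Lf s om b eta th q ca pb p4 Q4 ya cx ce cy ch c rate
  for L :: "real^'n::finite^'n" and lam :: "real^'m::finite" and R
    and lo hi Lf s om b eta th q ca pb p4 Q4 ya cx ce cy ch c rate :: real +
  fixes f :: "'n \<Rightarrow> real^'d::finite \<Rightarrow> real" and nu ph2 r0 :: real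
  assumes lam_bounds: "lo \<le> lam $ k" "lam $ k \<le> hi"
    and smooth: "\<And>i. L_smooth Lf (f i)"
    and bdd: "bdd_below (range (avg_obj f))"
    and PL: "0 < nu" "polyak_lojasiewicz nu (avg_obj f)"
    and ph2: "0 < ph2" "s = 1 + 2 / ph2" and r0: "0 \<le> r0"
    and contr_PL: "rate \<le> nu / 3"
    and contr_U: "eta * rate \<le> ph2 / 2 + ph2\<^sup>2 / 2 - eta * (r0 * ((b * om / 2 + om) * hi + 2 * om
      + eta * ((4 * s + 3) * (b * om * hi)\<^sup>2 + 1 + 2 * om\<^sup>2)))"
begin

abbreviation "disagreement x \<equiv> (\<Sum>k\<in>UNIV. (norm (modal R x k))\<^sup>2)"
abbreviation "dual_energy y \<equiv> (\<Sum>k\<in>UNIV. (norm (modal R y k))\<^sup>2 / lam $ k)"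

definition "grads (x :: real^'d^'n) = (\<chi> i. grad (f i) (x $ i))"
definition "mean_grads (x :: real^'d^'n) = (\<chi> i. grad (f i) (agent_mean (($) x)))"
definition "gap x = avg_obj f x - Inf (range (avg_obj f))"
text \<open>
  In the stationary regime \<open>\<omega> v\<close> cancels the local gradients at the average, so this is the error of
  the dual variable.
\<close>

definition "dual x v = v + (1 / om) *\<^sub>R mean_grads x"
definition "M0 = Max (range (($) lam))"

definition "consensus_part (x :: real^'d^'n) y = 1 / 2 * disagreement x
  + q / 2 * (dual_energy y + (norm (mean_mode y))\<^sup>2 / M0)
  + th * (\<Sum>k\<in>UNIV. (modal R x k \<bullet> modal R y k) / lam $ k)"

text \<open>
  The Lyapunov function, with \<open>V_lyap\<close> as the case \<open>th = 1\<close>, \<open>q = 1 + b\<close>.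
\<close>

definition "W x v xc = consensus_part x (dual x v)
  + real CARD('n) * gap (agent_mean (($) x)) + (norm (x - xc))\<^sup>2"

text \<open>
  A step with compression error \<open>e = xh - x\<close> and gradient noise \<open>w\<close>.
\<close>

definition "next_x x v e w = x - eta *\<^sub>R ((b * om) *\<^sub>R kron_id L (x + e) + om *\<^sub>R v + grads x + w)"
definition "next_v x v e = v + (eta * om) *\<^sub>R kron_id L (x + e)"

lemma lo_le_M0: "lo \<le> M0"
proof -
  have "lam $ undefined \<le> M0" unfolding M0_def by (intro Max_ge) auto
  then show ?thesis using lam_bounds(1)[of undefined] by linarith
qed

lemma M0_pos: "0 < M0" using lo_le_M0 lo_pos by linarith

lemma gap_nonneg: "0 \<le> gap x"
  unfolding gap_def using cInf_lower[OF _ bdd, of "avg_obj f x"] by simp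

lemma mean_mode_mean_grads: "mean_mode (mean_grads x) = sqrt (real CARD('n)) *\<^sub>R grad (avg_obj f) (agent_mean (($) x))"
  by (simp add: mean_mode_agent_mean mean_grads_def grad_avg_obj(2)[of Lf f, OF smooth]) (simp add: agent_mean_def)

lemma gap_le: "real CARD('n) * gap (agent_mean (($) x)) \<le> (norm (mean_mode (mean_grads x)))\<^sup>2 / (2 * nu)"
proof -
  have "nu * gap (agent_mean (($) x)) \<le> 1 / 2 * (norm (grad (avg_obj f) (agent_mean (($) x))))\<^sup>2"
    using PL(2) by (simp add: polyak_lojasiewicz_def gap_def)
  then have "real CARD('n) * (nu * gap (agent_mean (($) x))) \<le> real CARD('n) * (1 / 2 * (norm (grad (avg_obj f) (agent_mean (($) x))))\<^sup>2)"
    by (intro mult_left_mono) auto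
  then show ?thesis using PL(1) by (simp add: mean_mode_mean_grads power_mult_distrib field_simps)
qed

lemma grads_deviation: "(norm (grads x - mean_grads x))\<^sup>2 \<le> Lf\<^sup>2 * disagreement x"
proof -
  have "(norm (grads x - mean_grads x))\<^sup>2 = (\<Sum>i\<in>UNIV. (norm (grad (f i) (x $ i) - grad (f i) (agent_mean (($) x))))\<^sup>2)"
    unfolding power2_norm_eq_inner inner_vec_def[of "grads x - mean_grads x"]
    by (simp add: grads_def mean_grads_def)
  also have "\<dots> \<le> (\<Sum>i\<in>UNIV. Lf\<^sup>2 * (norm (x $ i - agent_mean (($) x)))\<^sup>2)"
    unfolding power_mult_distrib[symmetric]
    by (intro sum_mono power_mono L_smooth_grad_diff[OF smooth]) auto
  finally show ?thesis by (simp add: consensus_error_modal sum_distrib_left[symmetric])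
qed

lemma next_x_modal: "modal R (next_x x v e w) k = modal R x k - eta *\<^sub>R
    (((b * om * lam $ k) *\<^sub>R (modal R x k + modal R e k) + om *\<^sub>R modal R (dual x v) k
      + modal R (grads x - mean_grads x) k) + modal R w k)"
proof -
  have "om *\<^sub>R modal R (dual x v) k = om *\<^sub>R modal R v k + modal R (mean_grads x) k"
    using om_pos by (simp add: dual_def modal_add modal_scaleR scaleR_add_right)
  then show ?thesis
    unfolding next_x_def modal_add modal_diff modal_scaleR modal_kron_spectral[OF spectral_L]
    by (simp add: modal_add)
qed

lemma next_x_mean:
  assumes "mean_mode v = 0"
  shows "mean_mode (next_x x v e w) = mean_mode x - eta *\<^sub>R mean_mode (grads x + w)"
  using assms unfolding next_x_def
  by (simp add: mean_mode_add mean_mode_diff mean_mode_scaleR mean_mode_kron_spectral[OF spectral_L])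

lemma next_x_agent_mean:
  assumes "mean_mode v = 0"
  shows "agent_mean (($) (next_x x v e w))
    = agent_mean (($) x) + (- (eta / sqrt (real CARD('n)))) *\<^sub>R mean_mode (grads x + w)"
proof -
  have *: "agent_mean (($) z) = (1 / sqrt (real CARD('n))) *\<^sub>R mean_mode z" for z :: "real^'d^'n"
    by (simp add: mean_mode_agent_mean)
  show ?thesis unfolding * next_x_mean[OF assms] by (simp add: scaleR_diff_right)
qed

lemma mean_mode_next_v: "mean_mode v = 0 \<Longrightarrow> mean_mode (next_v x v e) = 0"
  by (simp add: next_v_def mean_mode_add mean_mode_scaleR mean_mode_kron_spectral[OF spectral_L])

lemma dual_next: "dual (next_x x v e w) (next_v x v e)
    = dual x v + (eta * om) *\<^sub>R kron_id L (x + e)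
      + (1 / om) *\<^sub>R (mean_grads (next_x x v e w) - mean_grads x)"
  by (simp add: dual_def next_v_def scaleR_diff_right)

lemma drift_bound:
  assumes "mean_mode v = 0"
  shows "(norm (mean_grads (next_x x v e w) - mean_grads x))\<^sup>2 \<le> Lf\<^sup>2 * eta\<^sup>2 * (norm (mean_mode (grads x + w)))\<^sup>2"
proof -
  let ?x' = "next_x x v e w"
  let ?d = "agent_mean (($) ?x') - agent_mean (($) x)"
  have "(norm (mean_grads ?x' - mean_grads x))\<^sup>2
    = (\<Sum>i\<in>UNIV. (norm (grad (f i) (agent_mean (($) ?x')) - grad (f i) (agent_mean (($) x))))\<^sup>2)"
    unfolding power2_norm_eq_inner inner_vec_def[of "mean_grads ?x' - mean_grads x"]
    by (simp add: mean_grads_def)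
  also have "\<dots> \<le> (\<Sum>i\<in>(UNIV::'n set). (Lf * norm ?d)\<^sup>2)"
    by (intro sum_mono power_mono L_smooth_grad_diff[OF smooth]) auto
  also have "\<dots> = real CARD('n) * (Lf * norm ?d)\<^sup>2" by simp
  also have "norm ?d = eta / sqrt (real CARD('n)) * norm (mean_mode (grads x + w))"
    unfolding next_x_agent_mean[OF assms] using eta_pos by simp
  also have "real CARD('n) * (Lf * (eta / sqrt (real CARD('n)) * norm (mean_mode (grads x + w))))\<^sup>2
    = Lf\<^sup>2 * eta\<^sup>2 * (norm (mean_mode (grads x + w)))\<^sup>2"
    by (simp add: power_mult_distrib power_divide)
  finally show ?thesis .
qed

text \<open>
  The average moves along the averaged stochastic gradient, because \<open>L\<close> and \<open>v\<close> have average zero.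
\<close>

lemma gap_step:
  assumes "mean_mode v = 0"
  shows "real CARD('n) * gap (agent_mean (($) (next_x x v e w))) \<le> real CARD('n) * gap (agent_mean (($) x))
    - eta * (mean_mode (mean_grads x) \<bullet> mean_mode (grads x + w)) + Lf * eta\<^sup>2 * (norm (mean_mode (grads x + w)))\<^sup>2"
proof -
  let ?n = "real CARD('n)" and ?G = "mean_mode (grads x + w)"
  let ?d = "(- (eta / sqrt ?n)) *\<^sub>R ?G"
  have "gap (agent_mean (($) (next_x x v e w))) \<le> gap (agent_mean (($) x))
      + grad (avg_obj f) (agent_mean (($) x)) \<bullet> ?d + Lf * (norm ?d)\<^sup>2"
    unfolding next_x_agent_mean[OF assms] gap_def
    using L_smooth_descent[OF L_smooth_avg_obj[of Lf f, OF smooth], of "agent_mean (($) x)" ?d] Lf_pos by simp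
  then have "?n * gap (agent_mean (($) (next_x x v e w))) \<le> ?n * (gap (agent_mean (($) x))
      + grad (avg_obj f) (agent_mean (($) x)) \<bullet> ?d + Lf * (norm ?d)\<^sup>2)"
    by (intro mult_left_mono) auto
  also have "\<dots> = ?n * gap (agent_mean (($) x)) - eta * (?n / sqrt ?n * (grad (avg_obj f) (agent_mean (($) x)) \<bullet> ?G))
      + Lf * eta\<^sup>2 * (norm ?G)\<^sup>2"
    by (simp add: power_mult_distrib power_divide algebra_simps)
  also have "?n / sqrt ?n * (grad (avg_obj f) (agent_mean (($) x)) \<bullet> ?G) = mean_mode (mean_grads x) \<bullet> ?G"
    by (simp add: mean_mode_mean_grads real_div_sqrt)
  finally show ?thesis .
qed

text \<open>
  The part of the increment that is linear in the noise \<open>w\<close> has a factor that depends on the state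
  and one that is linear in the compression error; they are kept apart because their expectations
  vanish for different reasons.
\<close>

definition "lin_mode x v k = - eta *\<^sub>R modal R x k - (eta * th / lam $ k) *\<^sub>R modal R (dual x v) k
   - (eta\<^sup>2 * th * om) *\<^sub>R modal R x k
   + (2 * cz * eta\<^sup>2) *\<^sub>R ((b * om * lam $ k) *\<^sub>R modal R x k + om *\<^sub>R modal R (dual x v) k
      + modal R (grads x - mean_grads x) k)"

definition "bil_coeff k = - (eta\<^sup>2 * th * om) + 2 * cz * eta\<^sup>2 * (b * om * lam $ k)"

lemma KD_nonneg: "0 \<le> KD"
  unfolding KD_def using q_pos lo_pos om_pos eta_pos ya_pos th by auto

lemma cz_nonneg: "0 \<le> cz" using th s_ge by (simp add: cz_def)

lemma KE_nonneg: "0 \<le> KE"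
  unfolding KE_def using b_pos om_pos hi_pos p4 eta_pos cz_nonneg c_pos q_th th
  by (auto intro!: add_nonneg_nonneg)

lemma KH_nonneg: "0 \<le> KH"
  unfolding KH_def using eta_pos cz_nonneg c_pos th by (auto intro!: add_nonneg_nonneg)

text \<open>
  The sum of the one-mode inequalities. The average of the dual variable is not touched by the
  Laplacian and changes only through the drift of the gradients, which costs \<open>ya\<close> times its square.
\<close>

lemma consensus_step:
  fixes x v e w :: "real^'d^'n"
  assumes v: "mean_mode v = 0"
  defines "x' \<equiv> next_x x v e w" and "h \<equiv> grads x - mean_grads x"
  shows "consensus_part x' (dual x' (next_v x v e)) + s * (norm (x' - x))\<^sup>2
    \<le> consensus_part x (dual x v)
      + (\<Sum>k\<in>UNIV. modal R w k \<bullet> lin_mode x v k) + (\<Sum>k\<in>UNIV. bil_coeff k * (modal R w k \<bullet> modal R e k))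
      + cz * eta\<^sup>2 * disagreement w
      - eta * KA * disagreement x
      - eta * KB * dual_energy (dual x v)
      + eta * KE * disagreement e + eta * KH * disagreement h
      + KD * (norm (mean_grads x' - mean_grads x))\<^sup>2
      + eta * ya * ((norm (mean_mode (dual x v)))\<^sup>2 / M0)
      + s * eta\<^sup>2 * (norm (mean_mode (grads x + w)))\<^sup>2"
proof -
  define y where "y = dual x v"
  define y' where "y' = dual x' (next_v x v e)"
  define D where "D = mean_grads x' - mean_grads x"
  have x'k: "modal R x' k = modal R x k - eta *\<^sub>R (((b * om * lam $ k) *\<^sub>R (modal R x k + modal R e k)
      + om *\<^sub>R modal R y k + modal R h k) + modal R w k)" for k
    unfolding x'_def y_def h_def by (rule next_x_modal)
  have y'k: "modal R y' k = modal R y k + (eta * om * lam $ k) *\<^sub>R (modal R x k + modal R e k) + (1 / om) *\<^sub>R modal R D k" for k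
    unfolding y'_def x'_def dual_next unfolding y_def D_def x'_def
    by (simp add: modal_add modal_scaleR modal_kron_spectral[OF spectral_L])
  have y'm: "mean_mode y' = mean_mode y + (1 / om) *\<^sub>R mean_mode D"
    unfolding y'_def x'_def dual_next unfolding y_def D_def x'_def
    by (simp add: mean_mode_add mean_mode_scaleR mean_mode_kron_spectral[OF spectral_L])
  have lin: "modal R w k \<bullet> (- eta *\<^sub>R modal R x k - (eta * th / lam $ k) *\<^sub>R modal R y k
       - (eta\<^sup>2 * th * om) *\<^sub>R (modal R x k + modal R e k)
       + (2 * cz * eta\<^sup>2) *\<^sub>R ((b * om * lam $ k) *\<^sub>R (modal R x k + modal R e k) + om *\<^sub>R modal R y k + modal R h k))
     = modal R w k \<bullet> lin_mode x v k + bil_coeff k * (modal R w k \<bullet> modal R e k)" for k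
    unfolding lin_mode_def bil_coeff_def y_def h_def
    by (simp add: inner_simps algebra_simps)
  have mode: "1 / 2 * (norm (modal R x' k))\<^sup>2 + q / 2 * ((norm (modal R y' k))\<^sup>2 / lam $ k)
       + th * ((modal R x' k \<bullet> modal R y' k) / lam $ k) + s * (norm (modal R (x' - x) k))\<^sup>2
     \<le> 1 / 2 * (norm (modal R x k))\<^sup>2 + q / 2 * ((norm (modal R y k))\<^sup>2 / lam $ k)
       + th * ((modal R x k \<bullet> modal R y k) / lam $ k)
       + (modal R w k \<bullet> lin_mode x v k + bil_coeff k * (modal R w k \<bullet> modal R e k))
       + cz * eta\<^sup>2 * (norm (modal R w k))\<^sup>2
       - eta * KA * (norm (modal R x k))\<^sup>2 - eta * KB * ((norm (modal R y k))\<^sup>2 / lam $ k)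
       + eta * KE * (norm (modal R e k))\<^sup>2 + eta * KH * (norm (modal R h k))\<^sup>2 + KD * (norm (modal R D k))\<^sup>2" for k
    unfolding lin[symmetric] modal_diff unfolding x'k y'k
    by (rule mode_step[OF lam_bounds])
  have sums: "1 / 2 * disagreement x' + q / 2 * dual_energy y'
       + th * (\<Sum>k\<in>UNIV. (modal R x' k \<bullet> modal R y' k) / lam $ k) + s * disagreement (x' - x)
     \<le> 1 / 2 * disagreement x + q / 2 * dual_energy y
       + th * (\<Sum>k\<in>UNIV. (modal R x k \<bullet> modal R y k) / lam $ k)
       + ((\<Sum>k\<in>UNIV. modal R w k \<bullet> lin_mode x v k) + (\<Sum>k\<in>UNIV. bil_coeff k * (modal R w k \<bullet> modal R e k)))
       + cz * eta\<^sup>2 * disagreement w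
       - eta * KA * disagreement x - eta * KB * dual_energy y
       + eta * KE * disagreement e + eta * KH * disagreement h
       + KD * disagreement D"
    using sum_mono[of UNIV, OF mode] by (simp only: sum.distrib sum_subtractf sum_distrib_left)
  have mean: "q / 2 * ((norm (mean_mode y'))\<^sup>2 / M0) \<le> q / 2 * ((norm (mean_mode y))\<^sup>2 / M0)
      + eta * ya * ((norm (mean_mode y))\<^sup>2 / M0) + KD * (norm (mean_mode D))\<^sup>2"
  proof -
    have "q / (om * M0) * (mean_mode y \<bullet> mean_mode D)
      \<le> eta * ya / M0 * (norm (mean_mode y))\<^sup>2 + q\<^sup>2 / (4 * eta * ya * om\<^sup>2 * M0) * (norm (mean_mode D))\<^sup>2"
      using q_pos M0_pos om_pos eta_pos ya_pos
      by (intro young_inner) (auto simp: power_mult_distrib field_simps power2_eq_square)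
    moreover have "(norm (mean_mode y'))\<^sup>2 = (norm (mean_mode y))\<^sup>2 + 2 / om * (mean_mode y \<bullet> mean_mode D)
        + 1 / om\<^sup>2 * (norm (mean_mode D))\<^sup>2"
      unfolding y'm power2_norm_eq_inner by (simp add: inner_simps inner_commute power2_eq_square algebra_simps)
    then have "q / 2 * ((norm (mean_mode y'))\<^sup>2 / M0) = q / 2 * ((norm (mean_mode y))\<^sup>2 / M0)
      + q / (om * M0) * (mean_mode y \<bullet> mean_mode D) + q / (2 * om\<^sup>2 * M0) * (norm (mean_mode D))\<^sup>2"
      by (simp add: add_divide_distrib distrib_left mult_ac)
    moreover have "(q\<^sup>2 / (4 * eta * ya * om\<^sup>2 * M0) + q / (2 * om\<^sup>2 * M0)) * (norm (mean_mode D))\<^sup>2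
      \<le> KD * (norm (mean_mode D))\<^sup>2"
    proof (rule mult_right_mono)
      have "q\<^sup>2 / (4 * eta * ya * om\<^sup>2 * M0) \<le> q\<^sup>2 / (4 * eta * ya * om\<^sup>2 * lo)"
        using lo_le_M0 lo_pos M0_pos om_pos eta_pos ya_pos by (intro divide_left_mono mult_left_mono mult_pos_pos) auto
      moreover have "q / (2 * om\<^sup>2 * M0) \<le> q / (lo * om\<^sup>2)"
      proof (rule divide_left_mono)
        show "lo * om\<^sup>2 \<le> 2 * om\<^sup>2 * M0" using lo_le_M0 M0_pos mult_right_mono[of lo "2 * M0" "om\<^sup>2"] by (simp add: mult_ac)
      qed (use q_pos lo_pos om_pos M0_pos in auto)
      moreover have "0 \<le> th / (eta * om\<^sup>2 * lo\<^sup>2) + 2 * th / (om\<^sup>2 * lo\<^sup>2)" using th eta_pos by auto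
      ultimately show "q\<^sup>2 / (4 * eta * ya * om\<^sup>2 * M0) + q / (2 * om\<^sup>2 * M0) \<le> KD" unfolding KD_def by linarith
    qed simp
    ultimately show ?thesis by (simp add: distrib_right)
  qed
  have D: "KD * disagreement D + KD * (norm (mean_mode D))\<^sup>2 = KD * (norm D)\<^sup>2"
    unfolding parseval_norm[of D, symmetric] by (simp add: distrib_left)
  have mx: "mean_mode (x' - x) = - eta *\<^sub>R mean_mode (grads x + w)"
    unfolding x'_def mean_mode_diff next_x_mean[OF v] by simp
  have "s * (norm (x' - x))\<^sup>2 = s * disagreement (x' - x) + s * eta\<^sup>2 * (norm (mean_mode (grads x + w)))\<^sup>2"
    unfolding parseval_norm[of "x' - x", symmetric] mx by (simp add: power_mult_distrib distrib_left)
  then show ?thesis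
    using sums mean D unfolding consensus_part_def y_def[symmetric] y'_def[symmetric] D_def[symmetric] distrib_left[of "q / 2"]
    by linarith
qed

text \<open>
  The inequality holds for every realisation of \<open>e\<close> and \<open>w\<close>; taking expectations afterwards only
  requires the first two moments.
\<close>

lemma pathwise_step:
  fixes x v xc xc' e w :: "real^'d^'n"
  assumes v: "mean_mode v = 0"
  defines "x' \<equiv> next_x x v e w" and "h \<equiv> grads x - mean_grads x" and "G \<equiv> mean_mode (grads x + w)"
  shows "W x' (next_v x v e) xc'
    \<le> W x v xc - (norm (x - xc))\<^sup>2 + (1 + ph2 / 2) * (norm (x - xc'))\<^sup>2
      + (\<Sum>k\<in>UNIV. modal R w k \<bullet> lin_mode x v k) + (\<Sum>k\<in>UNIV. bil_coeff k * (modal R w k \<bullet> modal R e k))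
      + cz * eta\<^sup>2 * (norm w)\<^sup>2
      - eta * KA * disagreement x
      - eta * KB * dual_energy (dual x v)
      + eta * KE * (norm e)\<^sup>2 + eta * KH * (norm h)\<^sup>2
      + (KD * Lf\<^sup>2 + Lf + s) * eta\<^sup>2 * (norm G)\<^sup>2
      - eta * (mean_mode (mean_grads x) \<bullet> G)
      + eta * ya * ((norm (mean_mode (dual x v)))\<^sup>2 / M0)"
proof -
  have le: "disagreement z \<le> (norm z)\<^sup>2" for z :: "real^'d^'n"
    unfolding parseval_norm[of z, symmetric] by simp
  note KE = KE_nonneg and KH = KH_nonneg
  have i1: "cz * eta\<^sup>2 * disagreement w \<le> cz * eta\<^sup>2 * (norm w)\<^sup>2"
    using cz_nonneg by (intro mult_left_mono le) auto
  have i2: "eta * KE * disagreement e \<le> eta * KE * (norm e)\<^sup>2"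
    using KE eta_pos by (intro mult_left_mono le) auto
  have i3: "eta * KH * disagreement h \<le> eta * KH * (norm h)\<^sup>2"
    using KH eta_pos by (intro mult_left_mono le) auto
  have i4: "KD * (norm (mean_grads x' - mean_grads x))\<^sup>2 \<le> KD * Lf\<^sup>2 * eta\<^sup>2 * (norm G)\<^sup>2"
    unfolding x'_def G_def mult.assoc[of KD] using KD_nonneg by (intro mult_left_mono drift_bound v) auto
  have i5: "(norm (x' - xc'))\<^sup>2 \<le> (1 + ph2 / 2) * (norm (x - xc'))\<^sup>2 + s * (norm (x' - x))\<^sup>2"
  proof -
    have "2 * ((x - xc') \<bullet> (x' - x)) \<le> ph2 / 2 * (norm (x - xc'))\<^sup>2 + 2 / ph2 * (norm (x' - x))\<^sup>2"
      using ph2 by (intro young_inner) auto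
    moreover have "(norm (x' - xc'))\<^sup>2 = (norm (x - xc'))\<^sup>2 + 2 * ((x - xc') \<bullet> (x' - x)) + (norm (x' - x))\<^sup>2"
      unfolding power2_norm_eq_inner by (simp add: inner_simps inner_commute)
    ultimately show ?thesis unfolding ph2(2) by (simp add: distrib_right)
  qed
  have "(KD * Lf\<^sup>2 + Lf + s) * eta\<^sup>2 * (norm G)\<^sup>2
    = KD * Lf\<^sup>2 * eta\<^sup>2 * (norm G)\<^sup>2 + Lf * eta\<^sup>2 * (norm G)\<^sup>2 + s * eta\<^sup>2 * (norm G)\<^sup>2"
    by (simp add: distrib_right)
  then show ?thesis
    using consensus_step[OF v, of x e w, folded x'_def h_def G_def] gap_step[OF v, of x e w, folded x'_def G_def]
      i1 i2 i3 i4 i5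
    unfolding W_def by linarith
qed

end

section \<open>Expected decrease of the Lyapunov function\<close>

context lyapunov_step
begin

lemma cross_term_le:
  assumes "0 < t"
  shows "\<bar>(modal R x k \<bullet> modal R y k) / lam $ k\<bar>
    \<le> 1 / (2 * t * lo) * (norm (modal R x k))\<^sup>2 + t / 2 * ((norm (modal R y k))\<^sup>2 / lam $ k)"
proof -
  have l: "0 < lam $ k" by (rule lam_pos)
  have "1 / (2 * t * lam $ k) * (norm (modal R x k))\<^sup>2 \<le> 1 / (2 * t * lo) * (norm (modal R x k))\<^sup>2"
    using lam_bounds(1)[of k] lo_pos assms by (intro mult_right_mono divide_left_mono) auto
  moreover have "(1 / lam $ k) * (modal R x k \<bullet> modal R y k)
      \<le> 1 / (2 * t * lam $ k) * (norm (modal R x k))\<^sup>2 + t / (2 * lam $ k) * (norm (modal R y k))\<^sup>2"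
    using l assms by (intro young_inner) (auto simp: power2_eq_square)
  moreover have "(- (1 / lam $ k)) * (modal R x k \<bullet> modal R y k)
      \<le> 1 / (2 * t * lam $ k) * (norm (modal R x k))\<^sup>2 + t / (2 * lam $ k) * (norm (modal R y k))\<^sup>2"
    using l assms by (intro young_inner) (auto simp: power2_eq_square)
  ultimately show ?thesis by (simp add: abs_le_iff)
qed

lemma sum_cross_term_le:
  assumes "0 < t"
  shows "\<bar>\<Sum>k\<in>UNIV. (modal R x k \<bullet> modal R y k) / lam $ k\<bar>
    \<le> 1 / (2 * t * lo) * disagreement x + t / 2 * dual_energy y"
proof -
  have "\<bar>\<Sum>k\<in>UNIV. (modal R x k \<bullet> modal R y k) / lam $ k\<bar>
    \<le> (\<Sum>k\<in>UNIV. \<bar>(modal R x k \<bullet> modal R y k) / lam $ k\<bar>)" by (rule sum_abs)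
  also have "\<dots> \<le> (\<Sum>k\<in>UNIV. 1 / (2 * t * lo) * (norm (modal R x k))\<^sup>2 + t / 2 * ((norm (modal R y k))\<^sup>2 / lam $ k))"
    by (intro sum_mono cross_term_le assms)
  finally show ?thesis by (simp only: sum.distrib sum_distrib_left)
qed

lemma dual_energy_nonneg: "0 \<le> dual_energy y"
  by (intro sum_nonneg) (simp add: less_imp_le[OF lam_pos])

lemma W_lower: "(1 / 2 - th / (2 * b * lo)) * disagreement x + real CARD('n) * gap (agent_mean (($) x)) \<le> W x v xc"
proof -
  let ?y = "dual x v"
  define S where "S = (\<Sum>k\<in>UNIV. (modal R x k \<bullet> modal R ?y k) / lam $ k)"
  have "- S \<le> 1 / (2 * b * lo) * disagreement x + b / 2 * dual_energy ?y"
    using sum_cross_term_le[OF b_pos, of x ?y] unfolding S_def by linarith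
  then have "th * (- S) \<le> th * (1 / (2 * b * lo) * disagreement x + b / 2 * dual_energy ?y)"
    using th by (intro mult_left_mono) auto
  moreover have "th * (1 / (2 * b * lo) * disagreement x + b / 2 * dual_energy ?y)
    = th / (2 * b * lo) * disagreement x + th * b / 2 * dual_energy ?y"
    by (simp add: distrib_left)
  moreover have "th * (- S) = - (th * S)" by simp
  moreover have "th * b / 2 * dual_energy ?y \<le> q / 2 * dual_energy ?y"
    using q_th dual_energy_nonneg by (intro mult_right_mono) auto
  moreover have "0 \<le> q / 2 * ((norm (mean_mode ?y))\<^sup>2 / M0)" using q_pos M0_pos by simp
  moreover have "0 \<le> (norm (x - xc))\<^sup>2" by simp
  ultimately show ?thesis
    unfolding W_def consensus_part_def S_def[symmetric] distrib_left[of "q / 2"] left_diff_distrib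
    by linarith
qed

lemma W_nonneg: "0 \<le> W x v xc"
proof -
  have "th / (2 * b * lo) \<le> 1 / (2 * b * lo)" using th b_pos lo_pos by (intro divide_right_mono) auto
  also have "\<dots> \<le> 1 / 2" using b_lo b_pos lo_pos by (simp add: field_simps)
  finally have "0 \<le> (1 / 2 - th / (2 * b * lo)) * disagreement x" by (intro mult_nonneg_nonneg sum_nonneg) auto
  moreover have "0 \<le> real CARD('n) * gap (agent_mean (($) x))" using gap_nonneg by simp
  ultimately show ?thesis using W_lower[of x v xc] by linarith
qed

lemma W_upper: "W x v xc \<le> (1 / 2 + th / (2 * c * lo)) * disagreement x
    + (q + th * c) / 2 * (dual_energy (dual x v) + (norm (mean_mode (dual x v)))\<^sup>2 / M0)
    + real CARD('n) * gap (agent_mean (($) x)) + (norm (x - xc))\<^sup>2"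
proof -
  let ?y = "dual x v"
  define S where "S = (\<Sum>k\<in>UNIV. (modal R x k \<bullet> modal R ?y k) / lam $ k)"
  define Ym where "Ym = (norm (mean_mode ?y))\<^sup>2 / M0"
  have "S \<le> 1 / (2 * c * lo) * disagreement x + c / 2 * dual_energy ?y"
    using sum_cross_term_le[OF upper_c_pos, of x ?y] unfolding S_def by linarith
  then have "th * S \<le> th * (1 / (2 * c * lo) * disagreement x + c / 2 * dual_energy ?y)"
    using th by (intro mult_left_mono) auto
  moreover have "0 \<le> th * c / 2 * Ym"
    unfolding Ym_def using th upper_c_pos M0_pos by simp
  moreover have "(q + th * c) / 2 * (dual_energy ?y + Ym)
    = q / 2 * (dual_energy ?y + Ym) + th * c / 2 * dual_energy ?y + th * c / 2 * Ym"
    by (simp add: algebra_simps add_divide_distrib)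
  ultimately show ?thesis unfolding W_def consensus_part_def S_def[symmetric] Ym_def[symmetric]
    by (simp add: distrib_left distrib_right)
qed

definition "noise_const = KD * Lf\<^sup>2 + Lf + s + real CARD('n) * cz"

text \<open>
  The expected value of the right-hand side of the pathwise inequality, with \<open>Et\<close>, \<open>Ee\<close>, \<open>Ew\<close> for the
  expected squares. Of the descent term \<open>- N / 2\<close>, \<open>N / 3\<close> pays for the average of the dual variable and
  \<open>N / 6\<close>, through the Polyak-Lojasiewicz inequality, for the contraction of the optimality gap;
  \<open>- G / 2\<close> pays for the drift.
\<close>

lemma mean_decrease:
  fixes x v xc :: "real^'d^'n"
  assumes v: "mean_mode v = 0" and sg: "0 \<le> \<sigma>2"
    and E: "Et \<le> (1 - ph2) * (norm (x - xc))\<^sup>2" "Ee \<le> r0 * (norm (x - xc))\<^sup>2" "Ew \<le> real CARD('n) * \<sigma>2"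
  shows "W x v xc - (norm (x - xc))\<^sup>2 + (1 + ph2 / 2) * Et + cz * eta\<^sup>2 * Ew
      - eta * KA * disagreement x - eta * KB * dual_energy (dual x v)
      + eta * KE * Ee + eta * KH * (norm (grads x - mean_grads x))\<^sup>2
      + (KD * Lf\<^sup>2 + Lf + s) * eta\<^sup>2 * ((norm (mean_mode (grads x)))\<^sup>2 + Ew / real CARD('n))
      - eta * (mean_mode (mean_grads x) \<bullet> mean_mode (grads x))
      + eta * ya * ((norm (mean_mode (dual x v)))\<^sup>2 / M0)
    \<le> (1 - eta * rate) * W x v xc + eta\<^sup>2 * noise_const * \<sigma>2"
proof -
  define n where "n = real CARD('n)"
  have n: "0 < n" by (simp add: n_def)
  define X Y Ym U N G Gp where "X = disagreement x" and "Y = dual_energy (dual x v)"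
    and "Ym = (norm (mean_mode (dual x v)))\<^sup>2 / M0" and "U = (norm (x - xc))\<^sup>2"
    and "N = (norm (mean_mode (mean_grads x)))\<^sup>2" and "G = (norm (mean_mode (grads x)))\<^sup>2"
    and "Gp = n * gap (agent_mean (($) x))"
  define H where "H = (norm (grads x - mean_grads x))\<^sup>2"
  define K where "K = KD * Lf\<^sup>2 + Lf + s"
  have K0: "0 \<le> K" using KD_nonneg Lf_pos s_ge by (simp add: K_def)
  have nn: "0 \<le> X" "0 \<le> Y" "0 \<le> Ym" "0 \<le> U" "0 \<le> N" "0 \<le> G"
    using dual_energy_nonneg M0_pos by (auto simp: X_def Y_def Ym_def U_def N_def G_def sum_nonneg)
  note KE = KE_nonneg and KH = KH_nonneg
  have HX: "H \<le> Lf\<^sup>2 * X" unfolding H_def X_def by (rule grads_deviation)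
  have ip: "- (mean_mode (mean_grads x) \<bullet> mean_mode (grads x)) \<le> - (N / 2) - G / 2 + Lf\<^sup>2 * X / 2"
  proof -
    have "(norm (mean_mode (grads x - mean_grads x)))\<^sup>2 \<le> H"
      unfolding H_def parseval_norm[of "grads x - mean_grads x", symmetric] by (simp add: sum_nonneg)
    moreover have "(norm (mean_mode (grads x - mean_grads x)))\<^sup>2 = G - 2 * (mean_mode (mean_grads x) \<bullet> mean_mode (grads x)) + N"
      unfolding G_def N_def mean_mode_diff power2_norm_eq_inner by (simp add: inner_simps inner_commute)
    ultimately show ?thesis using HX by linarith
  qed
  have Ym: "Ym \<le> N / (lo * om\<^sup>2)"
  proof -
    have "mean_mode (dual x v) = (1 / om) *\<^sub>R mean_mode (mean_grads x)"
      by (simp add: dual_def mean_mode_add mean_mode_scaleR v)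
    then have "Ym = N / (M0 * om\<^sup>2)" by (simp add: Ym_def N_def power_divide mult.commute)
    also have "\<dots> \<le> N / (lo * om\<^sup>2)"
      using lo_le_M0 lo_pos M0_pos om_pos nn by (intro divide_left_mono mult_right_mono mult_pos_pos) auto
    finally show ?thesis .
  qed
  define WY where "WY = (q + th * c) / 2"
  have WY: "0 \<le> WY" using q_pos th upper_c_pos by (simp add: WY_def)
  have N3: "(ya + rate * WY) * Ym \<le> N / 3"
  proof -
    have "(ya + rate * WY) * Ym \<le> (ya + rate * WY) * (N / (lo * om\<^sup>2))"
      using ya_pos rate_nonneg WY Ym by (intro mult_left_mono) auto
    also have "\<dots> \<le> (lo * om\<^sup>2 / 3) * (N / (lo * om\<^sup>2))"
      using contr_N nn lo_pos by (intro mult_right_mono) (auto simp: WY_def)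
    also have "\<dots> = N / 3" using lo_pos om_pos by simp
    finally show ?thesis .
  qed
  have gp: "rate * Gp \<le> N / 6"
  proof -
    have "rate * Gp \<le> nu / 3 * (N / (2 * nu))"
      using gap_le[of x] contr_PL PL rate_nonneg gap_nonneg[of "agent_mean (($) x)"]
      unfolding Gp_def n_def N_def by (intro mult_mono) auto
    then show ?thesis using PL by simp
  qed
  have up: "rate * W x v xc \<le> rate * ((1 / 2 + th / (2 * c * lo)) * X + WY * (Y + Ym) + Gp + U)"
    using W_upper[of x v xc] rate_nonneg unfolding X_def Y_def Ym_def U_def Gp_def n_def WY_def
    by (intro mult_left_mono) auto
  have x1: "rate * ((1 / 2 + th / (2 * c * lo)) * X) \<le> KA * X - KH * (Lf\<^sup>2 * X) - Lf\<^sup>2 * X / 2"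
    using mult_right_mono[OF contr_X nn(1)] by (simp add: algebra_simps)
  have y1: "rate * (WY * Y) \<le> KB * Y"
    using mult_right_mono[OF contr_Y nn(2)] by (simp add: WY_def mult.assoc)
  have g1: "eta * (K * G) \<le> G / 2"
    using mult_right_mono[OF contr_G nn(6)] by (simp add: K_def mult.assoc)
  have h1: "KH * H \<le> KH * (Lf\<^sup>2 * X)" by (intro mult_left_mono HX KH)
  have first: "- (KA * X) - KB * Y + KH * H + K * eta * G - (mean_mode (mean_grads x) \<bullet> mean_mode (grads x)) + ya * Ym
    \<le> - (rate * W x v xc) + rate * U"
  proof -
    have "rate * W x v xc \<le> rate * ((1 / 2 + th / (2 * c * lo)) * X) + rate * (WY * Y) + rate * WY * Ym + rate * Gp + rate * U"
      using up by (simp add: distrib_left mult.assoc)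
    moreover have "(ya + rate * WY) * Ym = ya * Ym + rate * WY * Ym" by (simp add: distrib_right)
    moreover have "K * eta * G = eta * (K * G)" by simp
    ultimately show ?thesis using x1 y1 g1 h1 ip N3 gp nn by linarith
  qed
  have u1: "(1 + ph2 / 2) * Et \<le> U - (ph2 / 2 + ph2\<^sup>2 / 2) * U"
  proof -
    have "(1 + ph2 / 2) * Et \<le> (1 + ph2 / 2) * ((1 - ph2) * U)"
      using E(1) ph2 by (intro mult_left_mono) (auto simp: U_def)
    also have "\<dots> = U - (ph2 / 2 + ph2\<^sup>2 / 2) * U" by (simp add: field_simps power2_eq_square)
    finally show ?thesis .
  qed
  have u2: "eta * (KE * Ee) \<le> (ph2 / 2 + ph2\<^sup>2 / 2) * U - eta * rate * U"
  proof -
    define B where "B = (b * om / 2 + om) * hi + 2 * om + eta * ((4 * s + 3) * (b * om * hi)\<^sup>2 + 1 + 2 * om\<^sup>2)"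
    have "eta * (KE * Ee) \<le> eta * (KE * (r0 * U))"
      using E(2) KE eta_pos by (intro mult_left_mono) (auto simp: U_def)
    also have "\<dots> \<le> eta * (B * (r0 * U))"
      using contr_E eta_pos r0 nn unfolding B_def by (intro mult_left_mono mult_right_mono) auto
    also have "\<dots> = eta * (r0 * B) * U" by simp
    also have "\<dots> \<le> (ph2 / 2 + ph2\<^sup>2 / 2 - eta * rate) * U"
      using contr_U nn unfolding B_def by (intro mult_right_mono) auto
    finally show ?thesis by (simp add: left_diff_distrib)
  qed
  have w1: "cz * eta\<^sup>2 * Ew + K * eta\<^sup>2 * (Ew / n) \<le> eta\<^sup>2 * noise_const * \<sigma>2"
  proof -
    have "Ew / n \<le> \<sigma>2" using E(3) n by (simp add: n_def divide_le_eq mult.commute)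
    then have "K * eta\<^sup>2 * (Ew / n) \<le> K * eta\<^sup>2 * \<sigma>2" using K0 by (intro mult_left_mono) auto
    moreover have "cz * eta\<^sup>2 * Ew \<le> cz * eta\<^sup>2 * (n * \<sigma>2)"
      using E(3) cz_nonneg unfolding n_def by (intro mult_left_mono) auto
    ultimately show ?thesis by (simp add: noise_const_def K_def n_def algebra_simps)
  qed
  have f: "eta * (- (KA * X) - KB * Y + KH * H + K * eta * G - (mean_mode (mean_grads x) \<bullet> mean_mode (grads x)) + ya * Ym)
    \<le> eta * (- (rate * W x v xc) + rate * U)"
    using first eta_pos by (intro mult_left_mono) auto
  have "W x v xc - U + (1 + ph2 / 2) * Et + cz * eta\<^sup>2 * Ew
      - eta * KA * X - eta * KB * Y + eta * KE * Ee + eta * KH * H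
      + K * eta\<^sup>2 * (G + Ew / n) - eta * (mean_mode (mean_grads x) \<bullet> mean_mode (grads x)) + eta * ya * Ym
    = W x v xc - U + (1 + ph2 / 2) * Et + (cz * eta\<^sup>2 * Ew + K * eta\<^sup>2 * (Ew / n)) + eta * (KE * Ee)
      + eta * (- (KA * X) - KB * Y + KH * H + K * eta * G - (mean_mode (mean_grads x) \<bullet> mean_mode (grads x)) + ya * Ym)"
    by (simp add: distrib_left right_diff_distrib power2_eq_square mult_ac)
  also have "\<dots> \<le> W x v xc - U + (U - (ph2 / 2 + ph2\<^sup>2 / 2) * U) + eta\<^sup>2 * noise_const * \<sigma>2
      + ((ph2 / 2 + ph2\<^sup>2 / 2) * U - eta * rate * U) + eta * (- (rate * W x v xc) + rate * U)"
    by (intro add_mono order_refl u1 u2 w1 f)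
  also have "\<dots> = (1 - eta * rate) * W x v xc + eta\<^sup>2 * noise_const * \<sigma>2" by (simp add: algebra_simps)
  finally show ?thesis unfolding X_def Y_def Ym_def U_def G_def H_def K_def n_def by simp
qed

end

lemma norm_stack_sq: "(norm (z :: real^'d^'n::finite))\<^sup>2 = (\<Sum>i\<in>UNIV. (norm (z $ i))\<^sup>2)"
  unfolding power2_norm_eq_inner inner_vec_def[of z z] ..

lemma has_bochner_integral_modal_inner_modal:
  fixes w e :: "'w \<Rightarrow> real^'d^'n::finite"
  assumes "\<And>i j. has_bochner_integral M (\<lambda>u. w u $ i \<bullet> e u $ j) 0"
  shows "has_bochner_integral M (\<lambda>u. modal R (w u) k \<bullet> modal R (e u) k) 0"
proof -
  have "has_bochner_integral M (\<lambda>u. \<Sum>j\<in>UNIV. \<Sum>i\<in>UNIV. R $ j $ k * (R $ i $ k * (w u $ i \<bullet> e u $ j))) (\<Sum>j\<in>UNIV. \<Sum>i\<in>UNIV. R $ j $ k * (R $ i $ k * 0))"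
    by (intro has_bochner_integral_sum has_bochner_integral_mult_right assms)
  then show ?thesis by (simp add: modal_def inner_sum_left inner_sum_right sum_distrib_left)
qed

lemma has_bochner_integral_modal_inner:
  fixes w :: "'w \<Rightarrow> real^'d^'n::finite"
  assumes "\<And>i. has_bochner_integral M (\<lambda>u. w u $ i) 0"
  shows "has_bochner_integral M (\<lambda>u. modal R (w u) k \<bullet> a) 0"
proof -
  have "has_bochner_integral M (\<lambda>u. \<Sum>i\<in>UNIV. R $ i $ k * (w u $ i \<bullet> a)) (\<Sum>i\<in>UNIV. R $ i $ k * (0 \<bullet> a))"
    by (intro has_bochner_integral_sum has_bochner_integral_mult_right has_bochner_integral_inner_left assms)
  then show ?thesis by (simp add: modal_def inner_sum_left)
qed

lemma has_bochner_integral_mean_mode_inner: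
  fixes w :: "'w \<Rightarrow> real^'d^'n::finite"
  assumes "\<And>i. has_bochner_integral M (\<lambda>u. w u $ i) 0"
  shows "has_bochner_integral M (\<lambda>u. mean_mode (w u) \<bullet> a) 0"
proof -
  have "has_bochner_integral M (\<lambda>u. 1 / sqrt (real CARD('n)) * (\<Sum>i\<in>UNIV. w u $ i \<bullet> a)) (1 / sqrt (real CARD('n)) * (\<Sum>i\<in>(UNIV::'n set). 0 \<bullet> a))"
    by (intro has_bochner_integral_sum has_bochner_integral_mult_right has_bochner_integral_inner_left assms)
  then show ?thesis by (simp add: mean_mode_def inner_sum_left)
qed

text \<open>
  The noises of different agents are uncorrelated, so averaging divides the variance by \<open>n\<close>.
\<close>

lemma has_bochner_integral_mean_mode_sq:
  fixes w :: "'w \<Rightarrow> real^'d^'n::finite"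
  assumes sq: "\<And>i. has_bochner_integral M (\<lambda>u. (norm (w u $ i))\<^sup>2) (S i)"
    and cross: "\<And>i j. i \<noteq> j \<Longrightarrow> has_bochner_integral M (\<lambda>u. w u $ i \<bullet> w u $ j) 0"
  shows "has_bochner_integral M (\<lambda>u. (norm (mean_mode (w u)))\<^sup>2) ((\<Sum>i\<in>UNIV. S i) / real CARD('n))"
proof -
  have ij: "has_bochner_integral M (\<lambda>u. w u $ i \<bullet> w u $ j) (if i = j then S i else 0)" for i j
    using sq[of i] cross[of i j] by (auto simp: power2_norm_eq_inner)
  have "has_bochner_integral M (\<lambda>u. 1 / real CARD('n) * (\<Sum>j\<in>UNIV. \<Sum>i\<in>UNIV. w u $ i \<bullet> w u $ j))
      (1 / real CARD('n) * (\<Sum>j\<in>UNIV. \<Sum>i\<in>UNIV. if i = j then S i else 0))"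
    by (intro has_bochner_integral_sum has_bochner_integral_mult_right ij)
  then show ?thesis
    by (simp add: mean_mode_def power_mult_distrib power_divide power2_norm_eq_inner inner_sum_left inner_sum_right)
qed

context lyapunov_step
begin

text \<open>
  The state \<open>x, v, xc\<close> is fixed and only the fresh randomness is integrated. The Lyapunov function
  itself is integrated as a nonnegative function, so that only the upper bound must be shown
  integrable.
\<close>

lemma expected_step:
  fixes M :: "'w measure" and e w xc' :: "'w \<Rightarrow> real^'d^'n" and x v xc :: "real^'d^'n"
  assumes M: "prob_space M" and v: "mean_mode v = 0" and sg: "0 \<le> \<sigma>2"
    and w: "\<And>i. has_bochner_integral M (\<lambda>u. w u $ i) 0"
    and ww: "\<And>i. integrable M (\<lambda>u. (norm (w u $ i))\<^sup>2)" "\<And>i. (\<integral>u. (norm (w u $ i))\<^sup>2 \<partial>M) \<le> \<sigma>2"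
    and cross: "\<And>i j. i \<noteq> j \<Longrightarrow> has_bochner_integral M (\<lambda>u. w u $ i \<bullet> w u $ j) 0"
    and we: "\<And>i j. has_bochner_integral M (\<lambda>u. w u $ i \<bullet> e u $ j) 0"
    and ee: "\<And>i. integrable M (\<lambda>u. (norm (e u $ i))\<^sup>2)"
      "\<And>i. (\<integral>u. (norm (e u $ i))\<^sup>2 \<partial>M) \<le> r0 * (norm (x $ i - xc $ i))\<^sup>2"
    and tt: "\<And>i. integrable M (\<lambda>u. (norm (x $ i - xc' u $ i))\<^sup>2)"
      "\<And>i. (\<integral>u. (norm (x $ i - xc' u $ i))\<^sup>2 \<partial>M) \<le> (1 - ph2) * (norm (x $ i - xc $ i))\<^sup>2"
  shows "(\<integral>\<^sup>+u. ennreal (W (next_x x v (e u) (w u)) (next_v x v (e u)) (xc' u)) \<partial>M)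
    \<le> ennreal ((1 - eta * rate) * W x v xc + eta\<^sup>2 * noise_const * \<sigma>2)"
proof -
  interpret prob_space M by fact
  define n where "n = real CARD('n)"
  define Ew where "Ew = (\<Sum>i\<in>UNIV. \<integral>u. (norm (w u $ i))\<^sup>2 \<partial>M)"
  define Ee where "Ee = (\<Sum>i\<in>UNIV. \<integral>u. (norm (e u $ i))\<^sup>2 \<partial>M)"
  define Et where "Et = (\<Sum>i\<in>UNIV. \<integral>u. (norm (x $ i - xc' u $ i))\<^sup>2 \<partial>M)"
  have U: "(norm (x - xc))\<^sup>2 = (\<Sum>i\<in>UNIV. (norm (x $ i - xc $ i))\<^sup>2)" by (simp add: norm_stack_sq)
  have hw: "has_bochner_integral M (\<lambda>u. (norm (w u))\<^sup>2) Ew"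
    unfolding norm_stack_sq Ew_def by (intro has_bochner_integral_sum has_bochner_integral_integrable ww)
  have he: "has_bochner_integral M (\<lambda>u. (norm (e u))\<^sup>2) Ee"
    unfolding norm_stack_sq Ee_def by (intro has_bochner_integral_sum has_bochner_integral_integrable ee)
  have ht: "has_bochner_integral M (\<lambda>u. (norm (x - xc' u))\<^sup>2) Et"
    unfolding norm_stack_sq Et_def vector_minus_component
    by (intro has_bochner_integral_sum has_bochner_integral_integrable tt)
  have hm: "has_bochner_integral M (\<lambda>u. (norm (mean_mode (w u)))\<^sup>2) (Ew / n)"
    unfolding Ew_def n_def
    by (intro has_bochner_integral_mean_mode_sq has_bochner_integral_integrable ww cross)
  have hG: "has_bochner_integral M (\<lambda>u. (norm (mean_mode (grads x + w u)))\<^sup>2) ((norm (mean_mode (grads x)))\<^sup>2 + Ew / n)"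
  proof -
    have "has_bochner_integral M (\<lambda>u. (norm (mean_mode (grads x)))\<^sup>2 + 2 * (mean_mode (w u) \<bullet> mean_mode (grads x))
        + (norm (mean_mode (w u)))\<^sup>2) ((norm (mean_mode (grads x)))\<^sup>2 * measure M (space M) + 2 * 0 + Ew / n)"
      by (intro has_bochner_integral_add has_bochner_integral_mult_right has_bochner_integral_mean_mode_inner w hm)
        (simp add: has_bochner_integral_iff)
    moreover have "(norm (mean_mode (grads x + w u)))\<^sup>2 = (norm (mean_mode (grads x)))\<^sup>2
        + 2 * (mean_mode (w u) \<bullet> mean_mode (grads x)) + (norm (mean_mode (w u)))\<^sup>2" for u
      by (simp add: mean_mode_add power2_norm_eq_inner inner_simps inner_commute)
    ultimately show ?thesis by (simp add: prob_space)
  qed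
  have hg: "has_bochner_integral M (\<lambda>u. mean_mode (mean_grads x) \<bullet> mean_mode (grads x + w u)) (mean_mode (mean_grads x) \<bullet> mean_mode (grads x))"
  proof -
    have "has_bochner_integral M (\<lambda>u. mean_mode (mean_grads x) \<bullet> mean_mode (grads x) + mean_mode (w u) \<bullet> mean_mode (mean_grads x))
        ((mean_mode (mean_grads x) \<bullet> mean_mode (grads x)) * measure M (space M) + 0)"
      by (intro has_bochner_integral_add has_bochner_integral_mean_mode_inner w) (simp add: has_bochner_integral_iff)
    then show ?thesis by (simp add: prob_space mean_mode_add inner_simps inner_commute)
  qed
  define A0 where "A0 = W x v xc - (norm (x - xc))\<^sup>2 - eta * KA * disagreement x - eta * KB * dual_energy (dual x v)
    + eta * KH * (norm (grads x - mean_grads x))\<^sup>2 + eta * ya * ((norm (mean_mode (dual x v)))\<^sup>2 / M0)"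
  define H where "H u = A0 + (1 + ph2 / 2) * (norm (x - xc' u))\<^sup>2
      + (\<Sum>k\<in>UNIV. modal R (w u) k \<bullet> lin_mode x v k) + (\<Sum>k\<in>UNIV. bil_coeff k * (modal R (w u) k \<bullet> modal R (e u) k))
      + cz * eta\<^sup>2 * (norm (w u))\<^sup>2 + eta * KE * (norm (e u))\<^sup>2
      + (KD * Lf\<^sup>2 + Lf + s) * eta\<^sup>2 * (norm (mean_mode (grads x + w u)))\<^sup>2
      - eta * (mean_mode (mean_grads x) \<bullet> mean_mode (grads x + w u))" for u
  define V where "V = A0 * measure M (space M) + (1 + ph2 / 2) * Et + (\<Sum>k\<in>(UNIV::'m set). 0) + (\<Sum>k\<in>(UNIV::'m set). bil_coeff k * 0)
      + cz * eta\<^sup>2 * Ew + eta * KE * Ee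
      + (KD * Lf\<^sup>2 + Lf + s) * eta\<^sup>2 * ((norm (mean_mode (grads x)))\<^sup>2 + Ew / n)
      - eta * (mean_mode (mean_grads x) \<bullet> mean_mode (grads x))"
  have HV: "has_bochner_integral M H V"
    unfolding H_def V_def
    by (intro has_bochner_integral_add has_bochner_integral_diff has_bochner_integral_sum
        has_bochner_integral_mult_right ht hw he hG hg w we
        has_bochner_integral_modal_inner has_bochner_integral_modal_inner_modal) (simp add: has_bochner_integral_iff)
  have WH: "W (next_x x v (e u) (w u)) (next_v x v (e u)) (xc' u) \<le> H u" for u
    using pathwise_step[OF v, of x "e u" "w u" "xc' u" xc] unfolding H_def A0_def by simp
  have H0: "0 \<le> H u" for u using WH[of u] W_nonneg order_trans by blast
  have "(\<integral>\<^sup>+u. ennreal (W (next_x x v (e u) (w u)) (next_v x v (e u)) (xc' u)) \<partial>M) \<le> (\<integral>\<^sup>+u. ennreal (H u) \<partial>M)"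
    by (intro nn_integral_mono ennreal_leI WH)
  also have "\<dots> = ennreal (integral\<^sup>L M H)"
    using HV H0 by (intro nn_integral_eq_integral) (auto simp: has_bochner_integral_iff)
  also have "integral\<^sup>L M H = V" using HV by (simp add: has_bochner_integral_iff)
  also have "V \<le> (1 - eta * rate) * W x v xc + eta\<^sup>2 * noise_const * \<sigma>2"
  proof -
    have "Et \<le> (1 - ph2) * (norm (x - xc))\<^sup>2" unfolding Et_def U sum_distrib_left by (intro sum_mono tt)
    moreover have "Ee \<le> r0 * (norm (x - xc))\<^sup>2" unfolding Ee_def U sum_distrib_left by (intro sum_mono ee)
    moreover have "Ew \<le> real CARD('n) * \<sigma>2"
      using sum_bounded_above[of UNIV "\<lambda>i. \<integral>u. (norm (w u $ i))\<^sup>2 \<partial>M" \<sigma>2] ww(2) by (simp add: Ew_def)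
    ultimately show ?thesis
      using mean_decrease[OF v sg, of Et x xc Ee Ew] by (simp add: V_def A0_def n_def prob_space algebra_simps)
  qed
  finally show ?thesis by (simp add: ennreal_leI)
qed

end

context lyapunov_step
begin

text \<open>
  The weighted function exceeds \<open>V\<close>, the case \<open>th = 1\<close> and \<open>q = 1 + b\<close>, by at most
  \<open>(1 - th) / (2 * b * lo) * \<parallel>x\<parallel>\<^sub>K\<^sup>2\<close>. The lower bound of the weighted function gains exactly the same
  amount in the coefficient of \<open>\<parallel>x\<parallel>\<^sub>K\<^sup>2\<close>.
\<close>

lemma W_le_full_energy:
  fixes x v xc :: "real^'d^'n"
  defines "y \<equiv> dual x v"
  defines "V \<equiv> 1 / 2 * disagreement x + (1 + b) / 2 * (dual_energy y + (norm (mean_mode y))\<^sup>2 / M0)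
    + (\<Sum>k\<in>UNIV. (modal R x k \<bullet> modal R y k) / lam $ k)
    + real CARD('n) * gap (agent_mean (($) x)) + (norm (x - xc))\<^sup>2"
  shows "W x v xc \<le> V + (1 - th) / (2 * b * lo) * disagreement x"
    and "(1 / 2 - 1 / (2 * b * lo)) * disagreement x \<le> V"
proof -
  define S where "S = (\<Sum>k\<in>UNIV. (modal R x k \<bullet> modal R y k) / lam $ k)"
  define X where "X = disagreement x"
  define Y where "Y = dual_energy y"
  define Ym where "Ym = (norm (mean_mode y))\<^sup>2 / M0"
  define G where "G = real CARD('n) * gap (agent_mean (($) x)) + (norm (x - xc))\<^sup>2"
  have nn: "0 \<le> Y" "0 \<le> Ym" "0 \<le> G"
    using dual_energy_nonneg M0_pos gap_nonneg by (auto simp: Y_def Ym_def G_def)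
  have S: "- S \<le> 1 / (2 * b * lo) * X + b / 2 * Y"
    using sum_cross_term_le[OF b_pos, of x y] unfolding S_def X_def Y_def by linarith
  have V: "V = 1 / 2 * X + (1 + b) / 2 * (Y + Ym) + S + G"
    by (simp add: V_def X_def Y_def Ym_def S_def G_def)
  have W: "W x v xc = 1 / 2 * X + q / 2 * (Y + Ym) + th * S + G"
    by (simp add: W_def consensus_part_def y_def[symmetric] X_def Y_def Ym_def S_def G_def)
  have "(1 - th) * (- S) \<le> (1 - th) * (1 / (2 * b * lo) * X + b / 2 * Y)"
    using S th by (intro mult_left_mono) auto
  also have "\<dots> = (1 - th) / (2 * b * lo) * X + (b / 2 - th * b / 2) * Y"
    by (simp add: algebra_simps diff_divide_distrib)
  finally have a: "(1 - th) * (- S) \<le> (1 - th) / (2 * b * lo) * X + (b / 2 - th * b / 2) * Y" .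
  have "q / 2 * (Y + Ym) \<le> (1 + th * b) / 2 * (Y + Ym)"
    using q_th nn by (intro mult_right_mono) auto
  moreover have "(1 + th * b) / 2 * (Y + Ym) + (b / 2 - th * b / 2) * Y + (b / 2 - th * b / 2) * Ym = (1 + b) / 2 * (Y + Ym)"
  proof -
    have "(1 + b) / 2 = (1 + th * b) / 2 + (b / 2 - th * b / 2)" by (simp add: add_divide_distrib)
    then show ?thesis by (simp only: distrib_left distrib_right add.assoc)
  qed
  moreover have "0 \<le> (b / 2 - th * b / 2) * Ym"
    using th b_pos nn by (intro mult_nonneg_nonneg) (auto simp: mult_le_cancel_right1)
  moreover have "(1 - th) * (- S) = th * S - S" by (simp add: algebra_simps)
  ultimately show "W x v xc \<le> V + (1 - th) / (2 * b * lo) * disagreement x"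
    unfolding V W X_def[symmetric] using a by linarith
  have "(1 + b) / 2 * (Y + Ym) = b / 2 * Y + (1 / 2 * Y + (1 + b) / 2 * Ym)"
    by (simp add: field_simps)
  moreover have "0 \<le> 1 / 2 * Y + (1 + b) / 2 * Ym" using nn b_pos by simp
  ultimately show "(1 / 2 - 1 / (2 * b * lo)) * disagreement x \<le> V"
    unfolding V X_def[symmetric] left_diff_distrib using S nn by linarith
qed

end

section \<open>Independence of past and fresh randomness\<close>

lemma borel_measurable_vec_nth' [measurable (raw)]:
  fixes F :: "'a \<Rightarrow> ('v::euclidean_space)^'n::finite"
  assumes "F \<in> borel_measurable N"
  shows "(\<lambda>u. F u $ i) \<in> borel_measurable N"
  by (rule borel_measurable_continuous_on[OF linear_continuous_on[OF bounded_linear_vec_nth] assms])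

lemma borel_measurable_vec_lambda' [measurable (raw)]:
  fixes F :: "'a \<Rightarrow> 'n::finite \<Rightarrow> 'v::euclidean_space"
  assumes "\<And>i. (\<lambda>u. F u i) \<in> borel_measurable N"
  shows "(\<lambda>u. \<chi> i. F u i) \<in> borel_measurable N"
proof (rule iffD2[OF borel_measurable_euclidean_space], rule ballI)
  fix z :: "'v^'n"
  assume "z \<in> Basis"
  then obtain i b where z: "z = axis i b" unfolding Basis_vec_def by auto
  have "(\<lambda>u. F u i \<bullet> b) \<in> borel_measurable N"
    by (rule borel_measurable_inner[OF assms borel_measurable_const])
  then show "(\<lambda>u. (\<chi> i. F u i) \<bullet> z) \<in> borel_measurable N" by (simp add: z inner_axis)
qed

lemma (in prob_space) has_bochner_integral_indep_inner:
  fixes X Y :: "'a \<Rightarrow> real^'d::finite"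
  assumes ind: "indep_var borel X borel Y" and X: "integrable M X" and Y: "integrable M Y"
    and X0: "expectation X = 0"
  shows "has_bochner_integral M (\<lambda>u. X u \<bullet> Y u) 0"
proof -
  have comp: "has_bochner_integral M (\<lambda>u. X u $ i * Y u $ i) 0" for i
  proof -
    have i: "indep_var borel (\<lambda>u. X u $ i) borel (\<lambda>u. Y u $ i)"
      using indep_var_compose[OF ind, of "\<lambda>z. z $ i" borel "\<lambda>z. z $ i" borel] by (simp add: comp_def)
    have iX: "integrable M (\<lambda>u. X u $ i)" by (rule integrable_bounded_linear[OF bounded_linear_vec_nth X])
    have iY: "integrable M (\<lambda>u. Y u $ i)" by (rule integrable_bounded_linear[OF bounded_linear_vec_nth Y])
    have "(\<integral>u. X u $ i \<partial>M) = 0"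
      using integral_bounded_linear[OF bounded_linear_vec_nth X, of i] X0 by simp
    then show ?thesis
      using indep_var_lebesgue_integral[OF i iX iY] indep_var_integrable[OF i iX iY]
      by (simp add: has_bochner_integral_iff)
  qed
  have "has_bochner_integral M (\<lambda>u. \<Sum>i\<in>UNIV. X u $ i * Y u $ i) (\<Sum>i\<in>(UNIV::'d set). 0)"
    by (intro has_bochner_integral_sum comp)
  then show ?thesis by (simp add: inner_vec_def)
qed

text \<open>
  Independence is stated as the product rule for preimages because \<open>X\<close> and \<open>Y\<close> take values in
  different types and so are not members of one family of random variables.
\<close>

lemma (in prob_space) nn_integral_indep:
  assumes X: "X \<in> M \<rightarrow>\<^sub>M N1" and Y: "Y \<in> M \<rightarrow>\<^sub>M N2"
    and ind: "\<And>A B. A \<in> sets N1 \<Longrightarrow> B \<in> sets N2 \<Longrightarrow>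
      prob ((X -` A \<inter> space M) \<inter> (Y -` B \<inter> space M)) = prob (X -` A \<inter> space M) * prob (Y -` B \<inter> space M)"
    and h: "case_prod h \<in> borel_measurable (N1 \<Otimes>\<^sub>M N2)"
  shows "(\<integral>\<^sup>+u. h (X u) (Y u) \<partial>M) = (\<integral>\<^sup>+u. \<integral>\<^sup>+u'. h (X u) (Y u') \<partial>M \<partial>M)"
proof -
  interpret DX: prob_space "distr M N1 X" by (rule prob_space_distr[OF X])
  interpret DY: prob_space "distr M N2 Y" by (rule prob_space_distr[OF Y])
  have hm: "case_prod h \<in> borel_measurable (distr M N1 X \<Otimes>\<^sub>M distr M N2 Y)"
    using h by (simp cong: measurable_cong_sets sets_pair_measure_cong)
  have "(\<integral>\<^sup>+u. h (X u) (Y u) \<partial>M) = (\<integral>\<^sup>+z. case_prod h z \<partial>(distr M (N1 \<Otimes>\<^sub>M N2) (\<lambda>u. (X u, Y u))))"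
    by (subst nn_integral_distr) (use X Y h in auto)
  also have "\<dots> = (\<integral>\<^sup>+z. case_prod h z \<partial>(distr M N1 X \<Otimes>\<^sub>M distr M N2 Y))"
  proof -
    have "distr M N1 X \<Otimes>\<^sub>M distr M N2 Y = distr M (N1 \<Otimes>\<^sub>M N2) (\<lambda>u. (X u, Y u))"
    proof (rule pair_measure_eqI)
      fix A B assume A: "A \<in> sets (distr M N1 X)" and B: "B \<in> sets (distr M N2 Y)"
      have "(\<lambda>u. (X u, Y u)) -` (A \<times> B) \<inter> space M = (X -` A \<inter> space M) \<inter> (Y -` B \<inter> space M)" by auto
      then show "emeasure (distr M N1 X) A * emeasure (distr M N2 Y) B
          = emeasure (distr M (N1 \<Otimes>\<^sub>M N2) (\<lambda>u. (X u, Y u))) (A \<times> B)"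
        using A B X Y ind[of A B]
        by (simp add: emeasure_distr emeasure_eq_measure ennreal_mult[symmetric])
    qed (simp_all add: DX.sigma_finite_measure_axioms DY.sigma_finite_measure_axioms cong: sets_pair_measure_cong)
    then show ?thesis by simp
  qed
  also have "\<dots> = (\<integral>\<^sup>+a. \<integral>\<^sup>+y. h a y \<partial>(distr M N2 Y) \<partial>(distr M N1 X))"
    using DY.nn_integral_fst[OF hm] by simp
  also have "\<dots> = (\<integral>\<^sup>+a. \<integral>\<^sup>+u'. h a (Y u') \<partial>M \<partial>(distr M N1 X))"
  proof (rule nn_integral_cong)
    fix a assume "a \<in> space (distr M N1 X)"
    then have "h a \<in> borel_measurable N2" using measurable_Pair2[OF h, of a] by simp
    then show "(\<integral>\<^sup>+y. h a y \<partial>(distr M N2 Y)) = (\<integral>\<^sup>+u'. h a (Y u') \<partial>M)"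
      by (intro nn_integral_distr) (use Y in simp_all)
  qed
  also have "\<dots> = (\<integral>\<^sup>+u. \<integral>\<^sup>+u'. h (X u) (Y u') \<partial>M \<partial>M)"
  proof -
    have "(\<lambda>z. h (fst z) (Y (snd z))) \<in> borel_measurable (N1 \<Otimes>\<^sub>M M)"
      using measurable_compose[OF measurable_Pair[OF measurable_fst measurable_compose[OF measurable_snd Y]] h]
      by simp
    then have "(\<lambda>(a, u'). h a (Y u')) \<in> borel_measurable (N1 \<Otimes>\<^sub>M M)" by (simp add: split_beta')
    then have "(\<lambda>a. \<integral>\<^sup>+u'. h a (Y u') \<partial>M) \<in> borel_measurable N1"
      by (rule borel_measurable_nn_integral)
    then show ?thesis by (intro nn_integral_distr) (use X in simp_all)
  qed
  finally show ?thesis .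
qed

locale fresh_draws = prob_space M
  for M :: "'w measure" +
  fixes S :: "'n::finite \<Rightarrow> 's measure" and \<xi> :: "'n \<Rightarrow> nat \<Rightarrow> 'w \<Rightarrow> 's"
    and Q :: "'c measure" and \<zeta> :: "'n \<Rightarrow> nat \<Rightarrow> 'w \<Rightarrow> 'c"
  assumes xi: "\<xi> i k \<in> M \<rightarrow>\<^sub>M S i" and draws: "fresh_compressor_draws M S \<xi> Q \<zeta>"
begin

lemma zeta: "\<zeta> i k \<in> M \<rightarrow>\<^sub>M Q" and zeta_distr: "distr M Q (\<zeta> i k) = Q"
  using draws by (auto simp: fresh_compressor_draws_def)

definition "draw_events a = (case a of
    Inl (i, k) \<Rightarrow> {\<xi> i k -` A \<inter> space M |A. A \<in> sets (S i)}
  | Inr (i, k) \<Rightarrow> {\<zeta> i k -` A \<inter> space M |A. A \<in> sets Q})"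

definition "info J = sigma (space M) (\<Union>a\<in>J. draw_events a)"

lemma draw_events_subset: "draw_events a \<subseteq> Pow (space M)"
  by (auto simp: draw_events_def split: sum.splits)

lemma space_info [simp]: "space (info J) = space M"
  by (simp add: info_def space_measure_of_conv)

lemma sets_info: "sets (info J) = sigma_sets (space M) (\<Union>a\<in>J. draw_events a)"
  unfolding info_def by (rule sets_measure_of) (use draw_events_subset in blast)

lemma info_subset: "sets (info J) \<subseteq> sets M"
proof -
  have "draw_events a \<subseteq> sets M" for a
    using measurable_sets[OF xi] measurable_sets[OF zeta] by (auto simp: draw_events_def split: sum.splits)
  then show ?thesis unfolding sets_info by (intro sets.sigma_sets_subset) auto
qed

lemma measurable_info_mono: "f \<in> info J \<rightarrow>\<^sub>M N \<Longrightarrow> J \<subseteq> J' \<Longrightarrow> f \<in> info J' \<rightarrow>\<^sub>M N"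
proof -
  assume f: "f \<in> info J \<rightarrow>\<^sub>M N" and J: "J \<subseteq> J'"
  have "sets (info J) \<subseteq> sets (info J')" unfolding sets_info using J by (intro sigma_sets_mono') auto
  with f show "f \<in> info J' \<rightarrow>\<^sub>M N" by (auto simp: measurable_def)
qed

lemma measurable_info: "f \<in> info J \<rightarrow>\<^sub>M N \<Longrightarrow> f \<in> M \<rightarrow>\<^sub>M N"
  using info_subset[of J] by (auto simp: measurable_def)

lemma xi_info: "Inl (i, k) \<in> J \<Longrightarrow> \<xi> i k \<in> info J \<rightarrow>\<^sub>M S i"
proof (rule measurableI)
  fix A assume J: "Inl (i, k) \<in> J" and A: "A \<in> sets (S i)"
  have "\<xi> i k -` A \<inter> space M \<in> draw_events (Inl (i, k))" using A by (auto simp: draw_events_def)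
  then show "\<xi> i k -` A \<inter> space (info J) \<in> sets (info J)" unfolding sets_info using J by auto
qed (use measurable_space[OF xi] in auto)

lemma zeta_info: "Inr (i, k) \<in> J \<Longrightarrow> \<zeta> i k \<in> info J \<rightarrow>\<^sub>M Q"
proof (rule measurableI)
  fix A assume J: "Inr (i, k) \<in> J" and A: "A \<in> sets Q"
  have "\<zeta> i k -` A \<inter> space M \<in> draw_events (Inr (i, k))" using A by (auto simp: draw_events_def)
  then show "\<zeta> i k -` A \<inter> space (info J) \<in> sets (info J)" unfolding sets_info using J by auto
qed (use measurable_space[OF zeta] in auto)

text \<open>
  Disjoint sets of draws carry independent information. This single fact serves three purposes:
  past against present, gradient samples against compressor draws, and gradient samples of
  different agents against each other.
\<close>

lemma indep_set_info:
  assumes J: "J1 \<inter> J2 = {}"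
  shows "indep_set (sets (info J1)) (sets (info J2))"
proof -
  have stable: "Int_stable {Z -` A \<inter> space M |A. A \<in> sets N}" for N and Z :: "'w \<Rightarrow> 'z"
  proof (rule Int_stableI, clarsimp)
    fix A B assume "A \<in> sets N" "B \<in> sets N"
    then show "\<exists>D. Z -` A \<inter> space M \<inter> (Z -` B \<inter> space M) = Z -` D \<inter> space M \<and> D \<in> sets N"
      by (intro exI[of _ "A \<inter> B"]) auto
  qed
  have "indep_sets draw_events UNIV"
    using draws unfolding fresh_compressor_draws_def draw_events_def[abs_def] by simp
  then have "indep_sets draw_events (\<Union>j\<in>UNIV. case_bool J1 J2 j)" by (rule indep_sets_mono_index[rotated]) simp
  then have "indep_sets (\<lambda>j. sigma_sets (space M) (\<Union>a\<in>case_bool J1 J2 j. draw_events a)) UNIV"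
  proof (rule indep_sets_collect_sigma)
    show "Int_stable (draw_events a)" for a
      unfolding draw_events_def by (cases a) (auto intro: stable)
    show "disjoint_family_on (case_bool J1 J2) UNIV"
      using J by (auto simp: disjoint_family_on_def split: bool.splits)
  qed
  then show ?thesis
    unfolding indep_set_def by (rule indep_sets_mono_sets) (auto simp: sets_info split: bool.splits)
qed

lemma indep_var_info:
  assumes X: "X \<in> info J1 \<rightarrow>\<^sub>M N1" and Y: "Y \<in> info J2 \<rightarrow>\<^sub>M N2" and J: "J1 \<inter> J2 = {}"
  shows "indep_var N1 X N2 Y"
proof -
  have sub: "sigma_sets (space M) {Z -` A \<inter> space M |A. A \<in> sets N} \<subseteq> sets (info J)"
    if "Z \<in> info J \<rightarrow>\<^sub>M N" for Z :: "'w \<Rightarrow> 'z" and N J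
    using sets.sigma_sets_subset[of "{Z -` A \<inter> space M |A. A \<in> sets N}" "info J"] measurable_sets[OF that] by auto
  have "indep_set (sigma_sets (space M) {X -` A \<inter> space M |A. A \<in> sets N1})
     (sigma_sets (space M) {Y -` A \<inter> space M |A. A \<in> sets N2})"
    unfolding indep_set_def
    by (rule indep_sets_mono_sets[OF indep_set_info[OF J, unfolded indep_set_def]]) (use sub[OF X] sub[OF Y] in \<open>auto split: bool.splits\<close>)
  then show ?thesis
    unfolding indep_var_eq using measurable_info[OF X] measurable_info[OF Y] by simp
qed

lemma nn_integral_indep_info:
  assumes X: "X \<in> info J1 \<rightarrow>\<^sub>M N1" and Y: "Y \<in> info J2 \<rightarrow>\<^sub>M N2" and J: "J1 \<inter> J2 = {}"
    and h: "case_prod h \<in> borel_measurable (N1 \<Otimes>\<^sub>M N2)"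
  shows "(\<integral>\<^sup>+u. h (X u) (Y u) \<partial>M) = (\<integral>\<^sup>+u. \<integral>\<^sup>+u'. h (X u) (Y u') \<partial>M \<partial>M)"
proof (rule nn_integral_indep[OF measurable_info[OF X] measurable_info[OF Y] _ h])
  fix A B assume "A \<in> sets N1" "B \<in> sets N2"
  then have "X -` A \<inter> space M \<in> sets (info J1)" "Y -` B \<inter> space M \<in> sets (info J2)"
    using measurable_sets[OF X] measurable_sets[OF Y] by auto
  then show "prob ((X -` A \<inter> space M) \<inter> (Y -` B \<inter> space M)) = prob (X -` A \<inter> space M) * prob (Y -` B \<inter> space M)"
    by (rule indep_setD[OF indep_set_info[OF J]])
qed

lemma
  fixes h :: "'c \<Rightarrow> real"
  assumes "h \<in> borel_measurable Q"
  shows integrable_zeta: "integrable M (\<lambda>u. h (\<zeta> i k u)) \<longleftrightarrow> integrable Q h"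
    and integral_zeta: "(\<integral>u. h (\<zeta> i k u) \<partial>M) = integral\<^sup>L Q h"
  using integrable_distr_eq[OF zeta assms, of i k] integral_distr[OF zeta assms, of i k]
  by (simp_all add: zeta_distr)

end

section \<open>The stochastic recursion\<close>

locale cp_sgd_process =
  lyapunov_step L lam R lo hi Lf s om b eta th q ca pb p4 Q4 ya cx ce cy ch c rate f nu ph2 r0 +
  fresh_draws M S \<xi> Q \<zeta>
  for L :: "real^'n::finite^'n" and lam :: "real^'m::finite" and R
    and lo hi Lf s om b eta th q ca pb p4 Q4 ya cx ce cy ch c rate :: real
    and f :: "'n \<Rightarrow> real^'d::finite \<Rightarrow> real" and nu ph2 r0 :: real
    and M :: "'w measure" and S :: "'n \<Rightarrow> 's measure" and \<xi> :: "'n \<Rightarrow> nat \<Rightarrow> 'w \<Rightarrow> 's"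
    and Q :: "'c measure" and \<zeta> :: "'n \<Rightarrow> nat \<Rightarrow> 'w \<Rightarrow> 'c" +
  fixes g :: "'n \<Rightarrow> real^'d \<Rightarrow> 's \<Rightarrow> real^'d" and C :: "'c \<Rightarrow> real^'d \<Rightarrow> real^'d"
    and rC ph ax \<sigma> :: real and x0 :: "real^'d^'n" and x xh xc v :: "'n \<Rightarrow> nat \<Rightarrow> 'w \<Rightarrow> real^'d"
  assumes unbiased: "stochastic_gradients M S \<xi> f g"
    and variance: "variance_bounded M \<xi> f g \<sigma>"
    and compr: "0 < rC" "0 < ph" "ph \<le> 1" "compressor Q C rC ph" "0 < ax" "ax * rC < 1"
    and ph2_eq: "ph2 = ax * rC * ph" and r0_eq: "r0 = 2 * rC\<^sup>2 * (1 - ph) + 2 * (1 - rC)\<^sup>2"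
    and algorithm: "\<And>w. w \<in> space M \<Longrightarrow>
      cp_sgd L g C (\<lambda>k. eta) (\<lambda>k. b * om) (\<lambda>k. om) ax x0
        (\<lambda>i k. \<xi> i k w) (\<lambda>i k. \<zeta> i k w)
        (\<lambda>i k. x i k w) (\<lambda>i k. xh i k w) (\<lambda>i k. xc i k w) (\<lambda>i k. v i k w)"
begin

definition "compr_err X XC z = (\<chi> i. C (z i) (X $ i - XC $ i) - (X $ i - XC $ i))"
definition "grad_noise X a = (\<chi> i. g i (X $ i) (a i) - grad (f i) (X $ i))"
definition "next_xc X XC e = XC + ax *\<^sub>R (X - XC + e)"

definition "st_x k w = (\<chi> i. x i k w)"
definition "st_v k w = (\<chi> i. v i k w)"
definition "st_xc k w = (\<chi> i. xc i k w)"
definition "energy k w = W (st_x k w) (st_v k w) (st_xc k w)"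

definition "W_next X V XC a z = W (next_x X V (compr_err X XC z) (grad_noise X a))
  (next_v X V (compr_err X XC z)) (next_xc X XC (compr_err X XC z))"

lemma st_init:
  assumes "w \<in> space M"
  shows "st_x 0 w = x0" "st_v 0 w = 0" "st_xc 0 w = 0"
  using algorithm[OF assms] by (auto simp: cp_sgd_def st_x_def st_v_def st_xc_def vec_eq_iff)

lemma st_step:
  fixes k w
  assumes w: "w \<in> space M"
  defines "e \<equiv> compr_err (st_x k w) (st_xc k w) (\<lambda>i. \<zeta> i k w)"
  shows "st_x (Suc k) w = next_x (st_x k w) (st_v k w) e (grad_noise (st_x k w) (\<lambda>i. \<xi> i k w))"
    and "st_v (Suc k) w = next_v (st_x k w) (st_v k w) e"
    and "st_xc (Suc k) w = next_xc (st_x k w) (st_xc k w) e"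
proof -
  have xh: "xh i k w = xc i k w + C (\<zeta> i k w) (x i k w - xc i k w)"
    and xcS: "xc i (Suc k) w = (1 - ax) *\<^sub>R xc i k w + ax *\<^sub>R xh i k w"
    and xS: "x i (Suc k) w = x i k w - eta *\<^sub>R ((b * om) *\<^sub>R (\<Sum>j\<in>UNIV. (L $ i $ j) *\<^sub>R xh j k w)
           + om *\<^sub>R v i k w + g i (x i k w) (\<xi> i k w))"
    and vS: "v i (Suc k) w = v i k w + (eta * om) *\<^sub>R (\<Sum>j\<in>UNIV. (L $ i $ j) *\<^sub>R xh j k w)" for i
    using algorithm[OF w] by (auto simp: cp_sgd_def)
  have xhe: "(st_x k w + e) $ i = xh i k w" for i
    by (simp add: e_def compr_err_def st_x_def st_xc_def xh)
  have kron: "kron_id L (st_x k w + e) $ i = (\<Sum>j\<in>UNIV. (L $ i $ j) *\<^sub>R xh j k w)" for i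
    unfolding kron_id_def using xhe by simp
  show "st_x (Suc k) w = next_x (st_x k w) (st_v k w) e (grad_noise (st_x k w) (\<lambda>i. \<xi> i k w))"
    unfolding next_x_def vec_eq_iff vector_minus_component vector_add_component vector_scaleR_component kron
    by (simp add: st_x_def st_v_def grad_noise_def grads_def xS)
  show "st_v (Suc k) w = next_v (st_x k w) (st_v k w) e"
    unfolding next_v_def vec_eq_iff vector_add_component vector_scaleR_component kron
    by (simp add: st_v_def vS)
  show "st_xc (Suc k) w = next_xc (st_x k w) (st_xc k w) e"
    by (simp add: next_xc_def vec_eq_iff e_def compr_err_def st_x_def st_xc_def xcS xh algebra_simps)
qed

text \<open>
  The average of the dual variables stays zero, since it starts at zero and the Laplacian annihilates
  averages. Without this invariant the average would not follow the averaged gradient.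
\<close>

lemma mean_mode_st_v: "w \<in> space M \<Longrightarrow> mean_mode (st_v k w) = 0"
proof (induction k)
  case 0
  then show ?case by (simp add: st_init mean_mode_def)
next
  case (Suc k)
  then show ?case by (simp add: st_step mean_mode_next_v)
qed

lemma grad_measurable [measurable]: "grad (f i) \<in> borel_measurable borel"
  using continuous_grad[OF smooth] Lf_pos by (intro borel_measurable_continuous_onI) auto

lemma avg_obj_measurable [measurable]: "avg_obj f \<in> borel_measurable borel"
  by (intro borel_measurable_continuous_onI continuous_L_smooth[OF L_smooth_avg_obj[of Lf f, OF smooth]])

lemma W_measurable:
  assumes [measurable]: "X \<in> borel_measurable N" "V \<in> borel_measurable N" "XC \<in> borel_measurable N"
  shows "(\<lambda>u. W (X u) (V u) (XC u)) \<in> borel_measurable N"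
  unfolding W_def consensus_part_def dual_def mean_grads_def gap_def modal_def mean_mode_def agent_mean_def
  by measurable

lemma compr_measurable:
  assumes X: "X \<in> borel_measurable N" and Z: "Z \<in> N \<rightarrow>\<^sub>M Q"
  shows "(\<lambda>u. C (Z u) (X u)) \<in> borel_measurable N"
proof -
  have "(\<lambda>(c, x). C c x) \<in> borel_measurable (Q \<Otimes>\<^sub>M borel)" using compr(4) by (simp add: compressor_def)
  from measurable_compose[OF measurable_Pair[OF Z X] this] show ?thesis by simp
qed

lemma g_measurable:
  assumes X: "X \<in> borel_measurable N" and A: "A \<in> N \<rightarrow>\<^sub>M S i"
  shows "(\<lambda>u. g i (X u) (A u)) \<in> borel_measurable N"
proof -
  have "(\<lambda>(x, a). g i x a) \<in> borel_measurable (borel \<Otimes>\<^sub>M S i)"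
    using unbiased by (simp add: stochastic_gradients_def)
  from measurable_compose[OF measurable_Pair[OF X A] this] show ?thesis by simp
qed

lemma next_measurable:
  assumes [measurable]: "X \<in> borel_measurable N" "V \<in> borel_measurable N" "XC \<in> borel_measurable N"
    and A: "\<And>i. (\<lambda>u. A u i) \<in> N \<rightarrow>\<^sub>M S i" and Z: "\<And>i. (\<lambda>u. Z u i) \<in> N \<rightarrow>\<^sub>M Q"
  shows "(\<lambda>u. next_x (X u) (V u) (compr_err (X u) (XC u) (Z u)) (grad_noise (X u) (A u))) \<in> borel_measurable N"
    and "(\<lambda>u. next_v (X u) (V u) (compr_err (X u) (XC u) (Z u))) \<in> borel_measurable N"
    and "(\<lambda>u. next_xc (X u) (XC u) (compr_err (X u) (XC u) (Z u))) \<in> borel_measurable N"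
proof -
  have [measurable]: "(\<lambda>u. C (Z u i) (X u $ i - XC u $ i)) \<in> borel_measurable N" for i
    by (rule compr_measurable[OF _ Z]) measurable
  have [measurable]: "(\<lambda>u. g i (X u $ i) (A u i)) \<in> borel_measurable N" for i
    by (rule g_measurable[OF _ A]) measurable
  have [measurable]: "(\<lambda>u. compr_err (X u) (XC u) (Z u)) \<in> borel_measurable N"
    unfolding compr_err_def by measurable
  have [measurable]: "(\<lambda>u. grad_noise (X u) (A u)) \<in> borel_measurable N"
    unfolding grad_noise_def by measurable
  have [measurable]: "(\<lambda>u. kron_id L (X u + compr_err (X u) (XC u) (Z u))) \<in> borel_measurable N"
    unfolding kron_id_def by measurable
  have [measurable]: "(\<lambda>u. grads (X u)) \<in> borel_measurable N"
    unfolding grads_def by measurable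
  show "(\<lambda>u. next_x (X u) (V u) (compr_err (X u) (XC u) (Z u)) (grad_noise (X u) (A u))) \<in> borel_measurable N"
    unfolding next_x_def by measurable
  show "(\<lambda>u. next_v (X u) (V u) (compr_err (X u) (XC u) (Z u))) \<in> borel_measurable N"
    unfolding next_v_def by measurable
  show "(\<lambda>u. next_xc (X u) (XC u) (compr_err (X u) (XC u) (Z u))) \<in> borel_measurable N"
    unfolding next_xc_def by measurable
qed

definition past :: "nat \<Rightarrow> ('n \<times> nat + 'n \<times> nat) set" where
  "past k = {a. case a of Inl (i, j) \<Rightarrow> j < k | Inr (i, j) \<Rightarrow> j < k}"
definition present :: "nat \<Rightarrow> ('n \<times> nat + 'n \<times> nat) set" where
  "present k = {a. case a of Inl (i, j) \<Rightarrow> j = k | Inr (i, j) \<Rightarrow> j = k}"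

lemma st_measurable:
  "st_x k \<in> borel_measurable (info (past k)) \<and> st_v k \<in> borel_measurable (info (past k))
   \<and> st_xc k \<in> borel_measurable (info (past k))"
proof (induction k)
  case 0
  have "st_x 0 \<in> borel_measurable (info (past 0)) \<longleftrightarrow> (\<lambda>_. x0) \<in> borel_measurable (info (past 0))"
    "st_v 0 \<in> borel_measurable (info (past 0)) \<longleftrightarrow> (\<lambda>_. 0 :: real^'d^'n) \<in> borel_measurable (info (past 0))"
    "st_xc 0 \<in> borel_measurable (info (past 0)) \<longleftrightarrow> (\<lambda>_. 0 :: real^'d^'n) \<in> borel_measurable (info (past 0))"
    by (intro measurable_cong; simp add: st_init)+
  then show ?case by simp
next
  case (Suc k)
  let ?N = "info (past (Suc k))"
  have sub: "past k \<subseteq> past (Suc k)" by (auto simp: past_def split: sum.splits)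
  have m: "st_x k \<in> borel_measurable ?N" "st_v k \<in> borel_measurable ?N" "st_xc k \<in> borel_measurable ?N"
    using Suc measurable_info_mono[OF _ sub] by auto
  have A: "(\<lambda>u. \<xi> i k u) \<in> ?N \<rightarrow>\<^sub>M S i" for i by (rule xi_info) (simp add: past_def)
  have Z: "(\<lambda>u. \<zeta> i k u) \<in> ?N \<rightarrow>\<^sub>M Q" for i by (rule zeta_info) (simp add: past_def)
  note n = next_measurable[OF m, where A="\<lambda>u i. \<xi> i k u" and Z="\<lambda>u i. \<zeta> i k u", OF A Z]
  have "st_x (Suc k) \<in> borel_measurable ?N" using n(1) by (subst measurable_cong) (auto simp: st_step)
  moreover have "st_v (Suc k) \<in> borel_measurable ?N" using n(2) by (subst measurable_cong) (auto simp: st_step)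
  moreover have "st_xc (Suc k) \<in> borel_measurable ?N" using n(3) by (subst measurable_cong) (auto simp: st_step)
  ultimately show ?case by blast
qed

lemma st_measurable_M: "st_x k \<in> borel_measurable M" "st_v k \<in> borel_measurable M" "st_xc k \<in> borel_measurable M"
  using st_measurable[of k] measurable_info by blast+

lemma energy_measurable [measurable]: "energy k \<in> borel_measurable M"
  unfolding energy_def by (rule W_measurable[OF st_measurable_M])

lemma square_integrable_imp_integrable:
  fixes F :: "'w \<Rightarrow> real^'d"
  assumes "F \<in> borel_measurable M" "integrable M (\<lambda>u. (norm (F u))\<^sup>2)"
  shows "integrable M F"
proof (rule Bochner_Integration.integrable_bound)
  show "integrable M (\<lambda>u. 1 + (norm (F u))\<^sup>2)" using assms by simp
  have "norm z \<le> 1 + (norm z)\<^sup>2" for z :: "real^'d"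
  proof -
    have "2 * norm z \<le> 1 + (norm z)\<^sup>2"
      using zero_le_power2[of "norm z - 1"] by (simp add: power2_eq_square algebra_simps)
    then show ?thesis using norm_ge_zero[of z] by linarith
  qed
  then show "AE u in M. norm (F u) \<le> norm (1 + (norm (F u))\<^sup>2)" by simp
qed (use assms in simp)

lemma integrable_dominated:
  fixes F G :: "'w \<Rightarrow> real"
  assumes F: "F \<in> borel_measurable M" and G: "integrable M G" and le: "\<And>u. 0 \<le> F u" "\<And>u. F u \<le> G u"
  shows "integrable M F"
proof (rule Bochner_Integration.integrable_bound[OF G F], rule AE_I2)
  show "norm (F u) \<le> norm (G u)" for u
    using le[of u] by simp
qed

text \<open>
  With \<open>D = C(y)/r - y\<close> the error is \<open>r D + (r - 1) y\<close>, and \<open>y - \<alpha>\<^sub>x C(y)\<close> is the convex combination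
  \<open>(1 - t) y + t (- D)\<close> with \<open>t = \<alpha>\<^sub>x r\<close>.
\<close>

lemma compression_moments:
  fixes y :: "real^'d" and i :: 'n and k :: nat
  defines "d \<equiv> (\<lambda>u. C (\<zeta> i k u) y - y)"
  shows "integrable M (\<lambda>u. (norm (d u))\<^sup>2)"
    and "(\<integral>u. (norm (d u))\<^sup>2 \<partial>M) \<le> r0 * (norm y)\<^sup>2"
    and "integrable M (\<lambda>u. (norm (y - ax *\<^sub>R (y + d u)))\<^sup>2)"
    and "(\<integral>u. (norm (y - ax *\<^sub>R (y + d u)))\<^sup>2 \<partial>M) \<le> (1 - ph2) * (norm y)\<^sup>2"
proof -
  define D where "D u = (1 / rC) *\<^sub>R C (\<zeta> i k u) y - y" for u
  have Cm: "(\<lambda>c. C c y) \<in> borel_measurable Q" by (rule compr_measurable) auto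
  have hm: "(\<lambda>c. (norm ((1 / rC) *\<^sub>R C c y - y))\<^sup>2) \<in> borel_measurable Q" using Cm by measurable
  have dm [measurable]: "(\<lambda>u. C (\<zeta> i k u) y) \<in> borel_measurable M" by (rule compr_measurable[OF _ zeta]) simp
  have D: "integrable M (\<lambda>u. (norm (D u))\<^sup>2)" "(\<integral>u. (norm (D u))\<^sup>2 \<partial>M) \<le> (1 - ph) * (norm y)\<^sup>2"
    using integrable_zeta[OF hm, of i k] integral_zeta[OF hm, of i k] compr(4)
    by (auto simp: compressor_def D_def)
  have dD: "d u = rC *\<^sub>R D u + (rC - 1) *\<^sub>R y" for u
    using compr(1) by (simp add: d_def D_def algebra_simps)
  have b1: "(norm (d u))\<^sup>2 \<le> 2 * rC\<^sup>2 * (norm (D u))\<^sup>2 + 2 * (1 - rC)\<^sup>2 * (norm y)\<^sup>2" for u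
    using norm_add_sq_le[of "rC *\<^sub>R D u" "(rC - 1) *\<^sub>R y"] unfolding dD
    by (simp add: power_mult_distrib power2_commute[of 1 rC] mult.assoc)
  have i1: "integrable M (\<lambda>u. 2 * rC\<^sup>2 * (norm (D u))\<^sup>2 + 2 * (1 - rC)\<^sup>2 * (norm y)\<^sup>2)" using D by simp
  show id: "integrable M (\<lambda>u. (norm (d u))\<^sup>2)"
    by (rule integrable_dominated[OF _ i1 _ b1]) (simp_all add: d_def)
  have "(\<integral>u. (norm (d u))\<^sup>2 \<partial>M) \<le> (\<integral>u. 2 * rC\<^sup>2 * (norm (D u))\<^sup>2 + 2 * (1 - rC)\<^sup>2 * (norm y)\<^sup>2 \<partial>M)"
    by (intro integral_mono id i1 b1)
  also have "\<dots> = 2 * rC\<^sup>2 * (\<integral>u. (norm (D u))\<^sup>2 \<partial>M) + 2 * (1 - rC)\<^sup>2 * (norm y)\<^sup>2"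
    using D by (simp add: prob_space)
  also have "\<dots> \<le> 2 * rC\<^sup>2 * ((1 - ph) * (norm y)\<^sup>2) + 2 * (1 - rC)\<^sup>2 * (norm y)\<^sup>2"
    using D by (intro add_mono mult_left_mono) auto
  also have "\<dots> = r0 * (norm y)\<^sup>2" by (simp add: r0_eq algebra_simps)
  finally show "(\<integral>u. (norm (d u))\<^sup>2 \<partial>M) \<le> r0 * (norm y)\<^sup>2" .
  define t where "t = ax * rC"
  have t: "0 \<le> t" "t \<le> 1" using compr by (auto simp: t_def)
  have b2: "(norm (y - ax *\<^sub>R (y + d u)))\<^sup>2 \<le> (1 - t) * (norm y)\<^sup>2 + t * (norm (D u))\<^sup>2" for u
  proof -
    have eq: "y - ax *\<^sub>R (y + d u) = (1 - t) *\<^sub>R y + t *\<^sub>R (- D u)"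
      unfolding dD t_def by (simp add: algebra_simps)
    have "(norm (y - ax *\<^sub>R (y + d u)))\<^sup>2 = (1 - t) * (norm y)\<^sup>2 + t * (norm (D u))\<^sup>2
        - t * (1 - t) * (norm (y + D u))\<^sup>2"
      unfolding eq power2_norm_eq_inner by (simp add: inner_simps inner_commute algebra_simps)
    then show ?thesis using t by simp
  qed
  have i2: "integrable M (\<lambda>u. (1 - t) * (norm y)\<^sup>2 + t * (norm (D u))\<^sup>2)" using D by simp
  show it: "integrable M (\<lambda>u. (norm (y - ax *\<^sub>R (y + d u)))\<^sup>2)"
    by (rule integrable_dominated[OF _ i2 _ b2]) (simp_all add: d_def)
  have "(\<integral>u. (norm (y - ax *\<^sub>R (y + d u)))\<^sup>2 \<partial>M) \<le> (\<integral>u. (1 - t) * (norm y)\<^sup>2 + t * (norm (D u))\<^sup>2 \<partial>M)"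
    by (intro integral_mono it i2 b2)
  also have "\<dots> = (1 - t) * (norm y)\<^sup>2 + t * (\<integral>u. (norm (D u))\<^sup>2 \<partial>M)"
    using D by (simp add: prob_space)
  also have "\<dots> \<le> (1 - t) * (norm y)\<^sup>2 + t * ((1 - ph) * (norm y)\<^sup>2)"
    using D t by (intro add_mono mult_left_mono) auto
  also have "\<dots> = (1 - ph2) * (norm y)\<^sup>2" by (simp add: ph2_eq t_def algebra_simps)
  finally show "(\<integral>u. (norm (y - ax *\<^sub>R (y + d u)))\<^sup>2 \<partial>M) \<le> (1 - ph2) * (norm y)\<^sup>2" .
qed

lemma one_step:
  fixes X V XC :: "real^'d^'n"
  assumes V: "mean_mode V = 0"
  shows "(\<integral>\<^sup>+u. ennreal (W_next X V XC (\<lambda>i. \<xi> i k u) (\<lambda>i. \<zeta> i k u)) \<partial>M)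
    \<le> ennreal ((1 - eta * rate) * W X V XC + eta\<^sup>2 * noise_const * \<sigma>\<^sup>2)"
proof -
  define e where "e u = compr_err X XC (\<lambda>i. \<zeta> i k u)" for u
  define w where "w u = grad_noise X (\<lambda>i. \<xi> i k u)" for u
  have ei: "e u $ i = C (\<zeta> i k u) (X $ i - XC $ i) - (X $ i - XC $ i)" for u i
    by (simp add: e_def compr_err_def)
  have wi: "w u $ i = g i (X $ i) (\<xi> i k u) - grad (f i) (X $ i)" for u i
    by (simp add: w_def grad_noise_def)
  have wint: "integrable M (\<lambda>u. w u $ i)" "(\<integral>u. w u $ i \<partial>M) = 0" for i
    using unbiased unfolding wi stochastic_gradients_def by (auto simp: prob_space)
  have wsq: "integrable M (\<lambda>u. (norm (w u $ i))\<^sup>2)" "(\<integral>u. (norm (w u $ i))\<^sup>2 \<partial>M) \<le> \<sigma>\<^sup>2" for i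
    using variance unfolding wi variance_bounded_def by auto
  have winfo: "(\<lambda>u. w u $ i) \<in> borel_measurable (info {Inl (i, k)})" for i
  proof -
    have [measurable]: "(\<lambda>u. g i (X $ i) (\<xi> i k u)) \<in> borel_measurable (info {Inl (i, k)})"
      by (rule g_measurable[OF _ xi_info]) auto
    show ?thesis unfolding wi by measurable
  qed
  have einfo: "(\<lambda>u. e u $ i) \<in> borel_measurable (info {Inr (i, k)})" for i
  proof -
    have [measurable]: "(\<lambda>u. C (\<zeta> i k u) (X $ i - XC $ i)) \<in> borel_measurable (info {Inr (i, k)})"
      by (rule compr_measurable[OF _ zeta_info]) auto
    show ?thesis unfolding ei by measurable
  qed
  have eint: "integrable M (\<lambda>u. e u $ i)" for i
    by (rule square_integrable_imp_integrable[OF measurable_info[OF einfo]]) (simp add: ei compression_moments(1))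
  have "(\<integral>\<^sup>+u. ennreal (W (next_x X V (e u) (w u)) (next_v X V (e u)) (next_xc X XC (e u))) \<partial>M)
    \<le> ennreal ((1 - eta * rate) * W X V XC + eta\<^sup>2 * noise_const * \<sigma>\<^sup>2)"
  proof (rule expected_step[OF prob_space_axioms V])
    show "has_bochner_integral M (\<lambda>u. w u $ i) 0" for i
      using wint by (simp add: has_bochner_integral_iff)
    show "has_bochner_integral M (\<lambda>u. w u $ i \<bullet> w u $ j) 0" if "i \<noteq> j" for i j
      by (rule has_bochner_integral_indep_inner[OF indep_var_info[OF winfo winfo] wint(1) wint(1) wint(2)])
        (use that in auto)
    show "has_bochner_integral M (\<lambda>u. w u $ i \<bullet> e u $ j) 0" for i j
      by (rule has_bochner_integral_indep_inner[OF indep_var_info[OF winfo einfo] wint(1) eint wint(2)]) auto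
    have xcn: "X $ i - next_xc X XC (e u) $ i = (X $ i - XC $ i) - ax *\<^sub>R ((X $ i - XC $ i) + e u $ i)" for u i
      by (simp add: next_xc_def algebra_simps)
    show "integrable M (\<lambda>u. (norm (e u $ i))\<^sup>2)"
      "(\<integral>u. (norm (e u $ i))\<^sup>2 \<partial>M) \<le> r0 * (norm (X $ i - XC $ i))\<^sup>2"
      "integrable M (\<lambda>u. (norm (X $ i - next_xc X XC (e u) $ i))\<^sup>2)"
      "(\<integral>u. (norm (X $ i - next_xc X XC (e u) $ i))\<^sup>2 \<partial>M) \<le> (1 - ph2) * (norm (X $ i - XC $ i))\<^sup>2" for i
      unfolding xcn unfolding ei by (rule compression_moments)+
  qed (use wsq in auto)
  then show ?thesis by (simp add: W_next_def e_def w_def)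
qed

lemma eta_rate_less_1: "eta * rate < 1"
proof -
  have p: "0 < ph2" "ph2 < 1"
  proof -
    show "0 < ph2" by (rule ph2)
    have "ph2 \<le> (ax * rC) * 1" unfolding ph2_eq using compr by (intro mult_left_mono) auto
    then show "ph2 < 1" using compr by simp
  qed
  have "0 \<le> eta * (r0 * ((b * om / 2 + om) * hi + 2 * om + eta * ((4 * s + 3) * (b * om * hi)\<^sup>2 + 1 + 2 * om\<^sup>2)))"
    using eta_pos r0 b_pos om_pos hi_pos s_ge by auto
  then have "eta * rate \<le> ph2 / 2 + ph2\<^sup>2 / 2" using contr_U by linarith
  also have "\<dots> < 1"
  proof -
    have "ph2 * ph2 < 1 * 1" by (rule mult_strict_mono) (use p in auto)
    then show ?thesis using p unfolding power2_eq_square by linarith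
  qed
  finally show ?thesis .
qed

lemma noise_const_nonneg: "0 \<le> noise_const"
  using KD_nonneg Lf_pos s_ge cz_nonneg by (simp add: noise_const_def)

text \<open>
  The state at step \<open>k\<close> depends only on earlier draws, so the expectation can be computed by fixing
  the state and integrating over the draws of step \<open>k\<close> first.
\<close>

lemma energy_recursion:
  "(\<integral>\<^sup>+u. ennreal (energy (Suc k) u) \<partial>M)
    \<le> ennreal (1 - eta * rate) * (\<integral>\<^sup>+u. ennreal (energy k u) \<partial>M) + ennreal (eta\<^sup>2 * noise_const * \<sigma>\<^sup>2)"
proof -
  define past_state where "past_state u = (st_x k u, st_v k u, st_xc k u)" for u
  define fresh where "fresh u = ((\<lambda>i. \<xi> i k u), (\<lambda>i. \<zeta> i k u))" for u
  define h where "h z y = (case z of (X, V, XC) \<Rightarrow> case y of (a, d) \<Rightarrow> ennreal (W_next X V XC a d))" for z y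
  let ?P = "PiM UNIV S \<Otimes>\<^sub>M PiM UNIV (\<lambda>_::'n. Q)"
  have ps: "past_state \<in> borel_measurable (info (past k))"
    unfolding past_state_def using st_measurable[of k] by (intro borel_measurable_Pair) auto
  have xk: "\<xi> i k \<in> info (present k) \<rightarrow>\<^sub>M S i" for i by (rule xi_info) (simp add: present_def)
  have zk: "\<zeta> i k \<in> info (present k) \<rightarrow>\<^sub>M Q" for i by (rule zeta_info) (simp add: present_def)
  have fr: "fresh \<in> info (present k) \<rightarrow>\<^sub>M ?P"
    unfolding fresh_def
    by (intro measurable_Pair measurable_PiM_single' xk zk)
      (use measurable_space[OF xk] measurable_space[OF zk] in \<open>auto simp: PiE_UNIV_domain\<close>)
  have hm: "case_prod h \<in> borel_measurable (borel \<Otimes>\<^sub>M ?P)"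
  proof -
    let ?N = "(borel :: ((real^'d^'n) \<times> (real^'d^'n) \<times> (real^'d^'n)) measure) \<Otimes>\<^sub>M ?P"
    have f1: "(\<lambda>p. fst (fst p)) \<in> borel_measurable ?N"
      by (rule measurable_compose[OF measurable_fst borel_measurable_continuous_onI]) (intro continuous_intros)
    have f2: "(\<lambda>p. fst (snd (fst p))) \<in> borel_measurable ?N"
      by (rule measurable_compose[OF measurable_fst borel_measurable_continuous_onI]) (intro continuous_intros)
    have f3: "(\<lambda>p. snd (snd (fst p))) \<in> borel_measurable ?N"
      by (rule measurable_compose[OF measurable_fst borel_measurable_continuous_onI]) (intro continuous_intros)
    have a: "(\<lambda>p. fst (snd p) i) \<in> ?N \<rightarrow>\<^sub>M S i" for i by measurable
    have d: "(\<lambda>p. snd (snd p) i) \<in> ?N \<rightarrow>\<^sub>M Q" for i by measurable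
    have "(\<lambda>p. W_next (fst (fst p)) (fst (snd (fst p))) (snd (snd (fst p))) (fst (snd p)) (snd (snd p))) \<in> borel_measurable ?N"
      unfolding W_next_def
      by (rule W_measurable[OF next_measurable[OF f1 f2 f3 a d]])
    then show ?thesis unfolding h_def split_beta' by measurable
  qed
  have "a \<notin> present k" if "a \<in> past k" for a
    using that by (cases a) (auto simp: past_def present_def)
  then have disj: "past k \<inter> present k = {}" by blast
  have "(\<integral>\<^sup>+u. ennreal (energy (Suc k) u) \<partial>M) = (\<integral>\<^sup>+u. h (past_state u) (fresh u) \<partial>M)"
    by (intro nn_integral_cong) (simp add: energy_def h_def past_state_def fresh_def W_next_def st_step)
  also have "\<dots> = (\<integral>\<^sup>+u. \<integral>\<^sup>+u'. h (past_state u) (fresh u') \<partial>M \<partial>M)"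
    by (rule nn_integral_indep_info[OF ps fr disj hm])
  also have "\<dots> \<le> (\<integral>\<^sup>+u. ennreal ((1 - eta * rate) * energy k u + eta\<^sup>2 * noise_const * \<sigma>\<^sup>2) \<partial>M)"
  proof (rule nn_integral_mono)
    fix u assume "u \<in> space M"
    from one_step[OF mean_mode_st_v[OF this], where X="st_x k u" and XC="st_xc k u" and k=k]
    show "(\<integral>\<^sup>+u'. h (past_state u) (fresh u') \<partial>M) \<le> ennreal ((1 - eta * rate) * energy k u + eta\<^sup>2 * noise_const * \<sigma>\<^sup>2)"
      by (simp add: h_def past_state_def fresh_def energy_def)
  qed
  also have "\<dots> = (\<integral>\<^sup>+u. ennreal (1 - eta * rate) * ennreal (energy k u) + ennreal (eta\<^sup>2 * noise_const * \<sigma>\<^sup>2) \<partial>M)"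
    using eta_rate_less_1 noise_const_nonneg W_nonneg
    by (intro nn_integral_cong) (simp add: ennreal_plus ennreal_mult energy_def)
  also have "\<dots> = ennreal (1 - eta * rate) * (\<integral>\<^sup>+u. ennreal (energy k u) \<partial>M) + ennreal (eta\<^sup>2 * noise_const * \<sigma>\<^sup>2)"
    by (simp add: nn_integral_add nn_integral_cmult emeasure_space_1)
  finally show ?thesis .
qed

lemma energy_bound:
  assumes "0 < rate"
  shows "(\<integral>\<^sup>+u. ennreal (energy k u) \<partial>M) \<le> ennreal ((1 - eta * rate) ^ k * W x0 0 0 + eta * noise_const * \<sigma>\<^sup>2 / rate)"
proof (induction k)
  case 0
  have "(\<integral>\<^sup>+u. ennreal (energy 0 u) \<partial>M) = (\<integral>\<^sup>+u. ennreal (W x0 0 0) \<partial>M)"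
    by (intro nn_integral_cong) (simp add: energy_def st_init)
  also have "\<dots> = ennreal (W x0 0 0)" by (simp add: emeasure_space_1)
  also have "\<dots> \<le> ennreal ((1 - eta * rate) ^ 0 * W x0 0 0 + eta * noise_const * \<sigma>\<^sup>2 / rate)"
    using assms eta_pos noise_const_nonneg by (intro ennreal_leI) simp
  finally show ?case .
next
  case (Suc k)
  let ?t = "1 - eta * rate" and ?N = "eta\<^sup>2 * noise_const * \<sigma>\<^sup>2"
  have t: "0 \<le> ?t" using eta_rate_less_1 by simp
  have W0: "0 \<le> W x0 0 0" by (rule W_nonneg)
  have "(\<integral>\<^sup>+u. ennreal (energy (Suc k) u) \<partial>M)
    \<le> ennreal ?t * ennreal (?t ^ k * W x0 0 0 + eta * noise_const * \<sigma>\<^sup>2 / rate) + ennreal ?N"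
    using energy_recursion[of k] Suc by (meson add_right_mono dual_order.trans mult_left_mono zero_le)
  also have "\<dots> = ennreal (?t * (?t ^ k * W x0 0 0 + eta * noise_const * \<sigma>\<^sup>2 / rate) + ?N)"
    using t W0 assms eta_pos noise_const_nonneg by (simp add: ennreal_mult[symmetric] ennreal_plus[symmetric] del: ennreal_plus)
  also have "?t * (?t ^ k * W x0 0 0 + eta * noise_const * \<sigma>\<^sup>2 / rate) + ?N
    = ?t ^ Suc k * W x0 0 0 + eta * noise_const * \<sigma>\<^sup>2 / rate"
    using assms by (simp add: field_simps power2_eq_square)
  finally show ?case .
qed

theorem error_bound:
  assumes rate: "0 < rate"
  defines "err \<equiv> (\<lambda>k w. (\<Sum>i\<in>UNIV. (norm (x i k w - agent_mean (\<lambda>i. x i k w)))\<^sup>2)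
      + real CARD('n) * (avg_obj f (agent_mean (\<lambda>i. x i k w)) - Inf (range (avg_obj f))))"
  shows "integrable M (err k)"
    and "(1 / 2 - th / (2 * b * lo)) * (\<integral>w. err k w \<partial>M) \<le> (1 - eta * rate) ^ k * W x0 0 0 + eta * noise_const * \<sigma>\<^sup>2 / rate"
proof -
  define kap where "kap = 1 / 2 - th / (2 * b * lo)"
  have kap: "0 < kap" "kap \<le> 1"
  proof -
    have "th / (2 * b * lo) \<le> 1 / (2 * b * lo)" using th b_pos lo_pos by (intro divide_right_mono) auto
    also have "\<dots> < 1 / 2" using b_lo b_pos lo_pos by (simp add: field_simps)
    finally show "0 < kap" by (simp add: kap_def)
    have "0 \<le> th / (2 * b * lo)" using th b_pos lo_pos by simp
    then show "kap \<le> 1" by (simp add: kap_def)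
  qed
  have err: "err k w = disagreement (st_x k w) + real CARD('n) * gap (agent_mean (($) (st_x k w)))" for w
  proof -
    have "($) (st_x k w) = (\<lambda>i. x i k w)" by (auto simp: st_x_def)
    then show ?thesis unfolding err_def consensus_error_modal[symmetric] gap_def by simp
  qed
  have err0: "0 \<le> err k w" for w unfolding err using gap_nonneg by (simp add: sum_nonneg)
  have le: "kap * err k w \<le> energy k w" for w
  proof -
    have "kap * err k w \<le> kap * disagreement (st_x k w) + 1 * (real CARD('n) * gap (agent_mean (($) (st_x k w))))"
      unfolding err distrib_left using kap gap_nonneg by (intro add_mono order_refl mult_right_mono) auto
    then show ?thesis using W_lower[of "st_x k w" "st_v k w" "st_xc k w"] by (simp add: energy_def kap_def)
  qed
  have [measurable]: "st_x k \<in> borel_measurable M" by (rule st_measurable_M)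
  have em [measurable]: "err k \<in> borel_measurable M"
    unfolding err[abs_def] modal_def agent_mean_def gap_def by measurable
  define B where "B = (1 - eta * rate) ^ k * W x0 0 0 + eta * noise_const * \<sigma>\<^sup>2 / rate"
  have B0: "0 \<le> B"
    using eta_rate_less_1 W_nonneg[of x0 0 0] rate eta_pos noise_const_nonneg by (simp add: B_def)
  have nn: "(\<integral>\<^sup>+w. ennreal (kap * err k w) \<partial>M) \<le> ennreal B"
    using energy_bound[OF rate, of k] nn_integral_mono[of M "\<lambda>w. ennreal (kap * err k w)" "\<lambda>w. ennreal (energy k w)"] le
    unfolding B_def by (meson ennreal_leI order_trans)
  have "integrable M (\<lambda>w. kap * err k w)"
  proof (rule integrableI_nonneg)
    show "(\<integral>\<^sup>+w. ennreal (kap * err k w) \<partial>M) < \<infinity>" using le_less_trans[OF nn ennreal_less_top] by simp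
  qed (use kap err0 in simp_all)
  then show int: "integrable M (err k)" using kap by simp
  have "ennreal (\<integral>w. kap * err k w \<partial>M) = (\<integral>\<^sup>+w. ennreal (kap * err k w) \<partial>M)"
    using int kap err0 by (intro nn_integral_eq_integral[symmetric]) auto
  with nn have "ennreal (\<integral>w. kap * err k w \<partial>M) \<le> ennreal B" by (rule ord_eq_le_trans[rotated])
  then have "(\<integral>w. kap * err k w \<partial>M) \<le> B" using ennreal_le_iff[OF B0] by blast
  then show "(1 / 2 - th / (2 * b * lo)) * (\<integral>w. err k w \<partial>M) \<le> (1 - eta * rate) ^ k * W x0 0 0 + eta * noise_const * \<sigma>\<^sup>2 / rate"
    by (simp add: B_def kap_def)
qed

end

section \<open>Admissible parameters\<close>

locale cp_sgd_params =
  fixes p :: params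
  assumes lam: "0 < lam_min p" "lam_min p \<le> lam_max p" and Lf: "0 < L_f p" and nu: "0 < nu p"
    and phi: "0 < phi p" "phi p \<le> 1" and rC: "0 < r_C p"
    and beta5: "0 < beta5 p" and beta1: "c0 p < beta1 p" and beta2: "0 < beta2 p" and omega: "beta3 p < omega p"
    and ax: "0 < alpha_x p" "alpha_x p < 1 / r_C p"
begin

lemma ax_rC: "alpha_x p * r_C p < 1"
  using ax rC by (simp add: field_simps)

lemma phi2: "0 < phi2 p" "phi2 p < 1"
proof -
  show "0 < phi2 p" using ax phi rC by (simp add: phi2_def)
  have "alpha_x p * r_C p * phi p \<le> alpha_x p * r_C p * 1" using ax phi rC by (intro mult_left_mono) auto
  then show "phi2 p < 1" using ax_rC by (simp add: phi2_def)
qed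

lemma s_ge_3: "3 \<le> 1 + 2 / phi2 p"
  using phi2 by (simp add: field_simps)

lemma c0_pos: "0 < c0 p" by (simp add: c0_def less_max_iff_disj)

lemma beta1_gt: "1 < beta1 p" "9 + beta5 p < 2 * (beta1 p * lam_min p)"
proof -
  show "1 < beta1 p" using beta1 by (simp add: c0_def)
  have "(9 + beta5 p) / (2 * lam_min p) < beta1 p" using beta1 by (simp add: c0_def)
  then show "9 + beta5 p < 2 * (beta1 p * lam_min p)" using lam by (simp add: divide_less_eq mult_ac)
qed

lemma beta3_ge:
  "(4 + 5 * (L_f p)\<^sup>2) / beta5 p \<le> beta3 p" "(12 * (1 / lam_min p) + 1) / 3 \<le> beta3 p"
  "sqrt (beta6 p) \<le> beta3 p" "beta2 p / beta4 p \<le> beta3 p"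
  unfolding beta3_def by (intro Max_ge; simp)+

lemma beta3_pos: "0 < beta3 p"
proof -
  have "0 < (4 + 5 * (L_f p)\<^sup>2) / beta5 p" using beta5 by (intro divide_pos_pos add_pos_nonneg) auto
  then show ?thesis using beta3_ge(1) by linarith
qed

lemma omega_pos: "0 < omega p" using beta3_pos omega by linarith
lemma eta_pos: "0 < eta p" using beta2 omega_pos by (simp add: eta_def)
lemma r0_nonneg: "0 \<le> r0 p" using phi by (simp add: r0_def)
lemma gamma_pos: "0 < gamma p" using beta1_gt omega_pos by (simp add: gamma_def)
lemma lam_max_pos: "0 < lam_max p" using lam by linarith

lemma eps1t_pos: "0 < eps1t p"
proof -
  have "4 + 5 * (L_f p)\<^sup>2 < beta5 p * omega p"
    using order_le_less_trans[OF beta3_ge(1) omega] beta5 by (simp add: divide_less_eq mult.commute)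
  also have "\<dots> \<le> (2 * (beta1 p * lam_min p) - 9) * omega p"
    using beta1_gt omega_pos by (intro mult_right_mono) auto
  finally show ?thesis unfolding eps1t_def gamma_def by (simp add: field_simps)
qed

lemma omega_lam: "12 + lam_min p < 3 * omega p * lam_min p"
proof -
  have "12 * (1 / lam_min p) + 1 < 3 * omega p"
    using order_le_less_trans[OF beta3_ge(2) omega] by simp
  then have "(12 * (1 / lam_min p) + 1) * lam_min p < 3 * omega p * lam_min p"
    using lam by (intro mult_strict_right_mono) auto
  then show ?thesis using lam by (simp add: distrib_right)
qed

lemma eps4_pos: "0 < eps4 p"
  using order_le_less_trans[OF beta3_ge(2) omega] by (simp add: eps4_def)

lemma eps6_pos: "0 < eps6 p"
proof -
  have b6: "0 \<le> beta6 p" unfolding beta6_def using beta1_gt lam by (intro mult_nonneg_nonneg add_nonneg_nonneg) auto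
  have "(sqrt (beta6 p))\<^sup>2 < (omega p)\<^sup>2"
    using beta3_ge(3) omega b6 by (intro power_strict_mono) auto
  then have "beta6 p / (omega p)\<^sup>2 < 1" using b6 omega_pos by simp
  moreover have "beta6 p / (omega p)\<^sup>2 = 8 * ((2 * (1 + beta1 p) / ((omega p)\<^sup>2 * lam_min p)
      + 1 / ((omega p)\<^sup>2 * (lam_min p)\<^sup>2)) * (L_f p)\<^sup>2)"
    using omega_pos lam by (simp add: beta6_def field_simps)
  ultimately show ?thesis unfolding eps6_def by linarith
qed

lemma eps_pos: "0 < eps2t p" "0 < eps5 p" "0 < eps7 p" "0 < eps10 p" "0 \<le> eps11 p" "0 \<le> eps12 p" "L_f p \<le> eps7 p"
proof -
  show "0 < eps2t p" unfolding eps2t_def using phi2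
    by (intro add_pos_nonneg[OF add_pos_nonneg[OF add_nonneg_pos[OF add_nonneg_nonneg]]]) auto
  show "0 < eps5 p" unfolding eps5_def using phi2 lam lam_max_pos omega_pos
    by (auto intro!: add_pos_nonneg mult_nonneg_nonneg)
  show "L_f p \<le> eps7 p" unfolding eps7_def using lam beta1_gt
    by (auto intro!: mult_nonneg_nonneg add_nonneg_nonneg)
  then show "0 < eps7 p" using Lf by linarith
  show "0 < eps10 p" unfolding eps10_def using phi2 by (auto intro!: add_pos_nonneg)
  show "0 \<le> eps11 p" unfolding eps11_def using gamma_pos omega_pos lam_max_pos r0_nonneg
    by (auto intro!: add_nonneg_nonneg mult_nonneg_nonneg)
  show "0 \<le> eps12 p" unfolding eps12_def using phi2 r0_nonneg
    by (auto intro!: add_nonneg_nonneg mult_nonneg_nonneg divide_nonneg_nonneg)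
qed

lemma root_pos: "eps12 p \<noteq> 0 \<Longrightarrow> 0 < (sqrt ((eps11 p)\<^sup>2 + 4 * eps10 p * eps12 p) - eps11 p) / (2 * eps12 p)"
proof -
  assume "eps12 p \<noteq> 0"
  then have e12: "0 < eps12 p" using eps_pos by simp
  have "eps11 p < sqrt ((eps11 p)\<^sup>2 + 4 * eps10 p * eps12 p)"
    using e12 eps_pos by (intro real_less_rsqrt) simp
  then show ?thesis using e12 by simp
qed

lemma beta4_pos: "0 < beta4 p"
  unfolding beta4_def using eps1t_pos eps4_pos eps6_pos eps_pos root_pos by (subst Min_gr_iff) auto

lemma beta4_le:
  "beta4 p \<le> eps1t p / eps2t p" "beta4 p \<le> eps4 p / eps5 p" "beta4 p \<le> eps6 p / eps7 p"
  "eps12 p \<noteq> 0 \<Longrightarrow> beta4 p \<le> (sqrt ((eps11 p)\<^sup>2 + 4 * eps10 p * eps12 p) - eps11 p) / (2 * eps12 p)"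
  unfolding beta4_def by (intro Min_le; simp)+

lemma eta_lt_beta4: "eta p < beta4 p"
  using order_le_less_trans[OF beta3_ge(4) omega] beta4_pos omega_pos by (simp add: eta_def divide_less_eq mult.commute)

text \<open>
  The step size is below \<open>beta4\<close>, each entry of which, other than \<open>1\<close>, is the
  step size at which one margin vanishes.
\<close>

lemma margins_pos: "eta p * eps2t p < eps1t p" "eta p * eps5 p < eps4 p" "eta p * eps7 p < eps6 p"
  "eps11 p * eta p + eps12 p * (eta p)\<^sup>2 < eps10 p"
proof -
  show "eta p * eps2t p < eps1t p"
    using less_le_trans[OF eta_lt_beta4 beta4_le(1)] eps_pos by (simp add: less_divide_eq)
  show "eta p * eps5 p < eps4 p"
    using less_le_trans[OF eta_lt_beta4 beta4_le(2)] eps_pos by (simp add: less_divide_eq)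
  show "eta p * eps7 p < eps6 p"
    using less_le_trans[OF eta_lt_beta4 beta4_le(3)] eps_pos by (simp add: less_divide_eq)
  show "eps11 p * eta p + eps12 p * (eta p)\<^sup>2 < eps10 p"
  proof (cases "eps12 p = 0")
    case True
    have "(1 + 2 * (omega p)\<^sup>2) * r0 p \<le> eps12 p"
      unfolding eps12_def using phi2 r0_nonneg by (auto intro!: mult_nonneg_nonneg divide_nonneg_nonneg)
    moreover have "1 * r0 p \<le> (1 + 2 * (omega p)\<^sup>2) * r0 p" using r0_nonneg by (intro mult_right_mono) auto
    ultimately have "r0 p = 0" using True r0_nonneg by linarith
    then show ?thesis using True eps_pos by (simp add: eps11_def)
  next
    case False
    then have e12: "0 < eps12 p" using eps_pos by simp
    have "2 * eps12 p * eta p + eps11 p < sqrt ((eps11 p)\<^sup>2 + 4 * eps10 p * eps12 p)"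
      using less_le_trans[OF eta_lt_beta4 beta4_le(4)[OF False]] e12 by (simp add: less_divide_eq mult_ac)
    \<comment> \<open>Squaring turns the comparison with the root into the quadratic inequality.\<close>
    then have "(2 * eps12 p * eta p + eps11 p)\<^sup>2 < (sqrt ((eps11 p)\<^sup>2 + 4 * eps10 p * eps12 p))\<^sup>2"
      using e12 eta_pos eps_pos by (intro power_strict_mono) auto
    then have "(2 * eps12 p * eta p + eps11 p)\<^sup>2 < (eps11 p)\<^sup>2 + 4 * eps10 p * eps12 p"
      using e12 eps_pos by simp
    then have "(4 * eps12 p) * (eps11 p * eta p + eps12 p * (eta p)\<^sup>2) < (4 * eps12 p) * eps10 p"
      by (simp add: power2_eq_square algebra_simps)
    then show ?thesis using e12 by simp
  qed
qed

text \<open>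
  The minimum in \<open>beta9\<close>; the rate is \<open>margin / beta8\<close> with \<open>beta8 \<ge> 1/2 + \<beta>\<^sub>1\<close>.
\<close>

definition "margin = Min {eps1t p - eps2t p * eta p, eps4 p - eps5 p * eta p, nu p / 2,
  eps10 p / eta p - eps11 p - eps12 p * eta p}"

lemma last_margin: "eta p * (eps10 p / eta p - eps11 p - eps12 p * eta p) = eps10 p - eps11 p * eta p - eps12 p * (eta p)\<^sup>2"
  using eta_pos by (simp add: right_diff_distrib power2_eq_square mult_ac)

lemma margin_pos: "0 < margin"
proof -
  have "0 < eta p * (eps10 p / eta p - eps11 p - eps12 p * eta p)"
    unfolding last_margin using margins_pos(4) by linarith
  then have "0 < eps10 p / eta p - eps11 p - eps12 p * eta p"
    using eta_pos by (simp add: zero_less_mult_iff)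
  then show ?thesis unfolding margin_def using margins_pos nu by (subst Min_gr_iff) (auto simp: mult.commute)
qed

lemma margin_le:
  "margin \<le> eps1t p - eps2t p * eta p" "margin \<le> eps4 p - eps5 p * eta p" "margin \<le> nu p / 2"
  "margin \<le> eps10 p / eta p - eps11 p - eps12 p * eta p"
  unfolding margin_def by (intro Min_le; simp)+

lemma beta8_ge: "1 / 2 + beta1 p \<le> beta8 p" "3 / 2 \<le> beta8 p"
  using beta1_gt by (auto simp: beta8_def le_max_iff_disj)

lemma beta_bar_eq: "beta_bar p = margin / beta8 p"
  using eta_pos by (simp add: beta_bar_def beta9_def margin_def)

lemma beta_bar_pos: "0 < beta_bar p"
  unfolding beta_bar_eq using margin_pos beta8_ge by simp

lemma beta_bar_le: "beta_bar p * (1 / 2 + beta1 p) \<le> margin" "3 / 2 * beta_bar p \<le> margin" "beta_bar p \<le> margin"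
proof -
  have "beta_bar p * (1 / 2 + beta1 p) \<le> beta_bar p * beta8 p" "beta_bar p * (3 / 2) \<le> beta_bar p * beta8 p"
    using beta8_ge beta_bar_pos by (auto intro!: mult_left_mono)
  moreover have "beta_bar p * beta8 p = margin" using beta8_ge by (simp add: beta_bar_eq)
  ultimately show *: "beta_bar p * (1 / 2 + beta1 p) \<le> margin" "3 / 2 * beta_bar p \<le> margin" by auto
  then show "beta_bar p \<le> margin" using beta_bar_pos by linarith
qed

lemma eta_beta_bar_le: "eta p * beta_bar p \<le> 2 / 3"
proof -
  have "eta p * (3 / 2 * beta_bar p) \<le> eta p * (eps10 p / eta p - eps11 p - eps12 p * eta p)"
    using order_trans[OF beta_bar_le(2) margin_le(4)] eta_pos by (intro mult_left_mono) simp_all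
  also have "\<dots> \<le> eps10 p"
  proof -
    have "0 \<le> eps11 p * eta p" "0 \<le> eps12 p * (eta p)\<^sup>2" using eps_pos eta_pos by simp_all
    then show ?thesis unfolding last_margin by linarith
  qed
  also have "\<dots> \<le> 1"
  proof -
    have "phi2 p * phi2 p \<le> 1 * 1" using phi2 by (intro mult_mono) auto
    then show ?thesis using phi2 unfolding eps10_def power2_eq_square by linarith
  qed
  finally show ?thesis by simp
qed

lemma contraction_of_compression:
  "eta p * beta_bar p \<le> phi2 p / 2 + (phi2 p)\<^sup>2 / 2 - eta p * (r0 p * ((beta1 p * omega p / 2 + omega p) * lam_max p
    + 2 * omega p + eta p * ((4 * (1 + 2 / phi2 p) + 3) * (beta1 p * omega p * lam_max p)\<^sup>2 + 1 + 2 * (omega p)\<^sup>2)))"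
proof -
  have "eta p * beta_bar p \<le> eta p * (eps10 p / eta p - eps11 p - eps12 p * eta p)"
    using order_trans[OF beta_bar_le(3) margin_le(4)] eta_pos by (intro mult_left_mono) simp_all
  also have "\<dots> = eps10 p - eta p * (eps11 p + eta p * eps12 p)"
    unfolding last_margin by (simp add: algebra_simps power2_eq_square)
  also have "eps11 p = r0 p * ((beta1 p * omega p / 2 + omega p) * lam_max p + 2 * omega p)"
    by (simp add: eps11_def gamma_def algebra_simps)
  also have "eps12 p = r0 p * ((4 * (1 + 2 / phi2 p) + 3) * (beta1 p * omega p * lam_max p)\<^sup>2 + 1 + 2 * (omega p)\<^sup>2)"
    using phi2 by (simp add: eps12_def gamma_def field_simps)
  finally show ?thesis unfolding eps10_def by (simp add: algebra_simps)
qed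

lemma eps1t_raw: "eps1t p = beta1 p * omega p * lam_min p / 2 - (9 * omega p + 4) / 4 - 5 / 4 * (L_f p)\<^sup>2"
  by (simp add: eps1t_def gamma_def)

lemma eps2t_raw: "eps2t p = (4 * (1 + 2 / phi2 p) + 3) * (beta1 p * omega p * lam_max p)\<^sup>2
    + (8 * (1 + 2 / phi2 p) + 4) * (L_f p)\<^sup>2 + 1 + 2 * (omega p)\<^sup>2"
  by (simp add: eps2t_def gamma_def power_mult_distrib algebra_simps)

lemma eps5_raw: "eps5 p = (omega p)\<^sup>2 * lam_max p + 1 / lam_min p + 4 * (1 + 2 / phi2 p) * (omega p)\<^sup>2 * lam_min p"
  by (simp add: eps5_def algebra_simps)

sublocale step_constants "lam_min p" "lam_max p" "L_f p" "1 + 2 / phi2 p" "omega p" "beta1 p" "eta p"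
proof
  show "9 / 2 < beta1 p * lam_min p" using beta1_gt beta5 by linarith
  show "eta p * ((4 * (1 + 2 / phi2 p) + 3) * (beta1 p * omega p * lam_max p)\<^sup>2
      + (8 * (1 + 2 / phi2 p) + 4) * (L_f p)\<^sup>2 + 1 + 2 * (omega p)\<^sup>2)
    \<le> beta1 p * omega p * lam_min p / 2 - (9 * omega p + 4) / 4 - 5 / 4 * (L_f p)\<^sup>2"
    using margins_pos(1) unfolding eps1t_raw eps2t_raw by linarith
  have "eta p * L_f p \<le> eta p * eps7 p" using eps_pos eta_pos by (intro mult_left_mono) auto
  then have "eta p * L_f p \<le> eps6 p" using margins_pos(3) by linarith
  then show "2 * ((1 + beta1 p) * (L_f p)\<^sup>2 / ((omega p)\<^sup>2 * lam_min p))
      + (L_f p)\<^sup>2 / ((omega p)\<^sup>2 * (lam_min p)\<^sup>2) + eta p * L_f p \<le> 1 / 8"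
  proof -
    define B where "B = 1 + beta1 p"
    show ?thesis using \<open>eta p * L_f p \<le> eps6 p\<close>
      unfolding eps6_def B_def[symmetric] by (simp add: distrib_right)
  qed
qed (use lam Lf s_ge_3 eta_pos beta1_gt omega_lam in auto)

lemma contracting_weights_exist:
  "\<exists>th q ca pb p4 Q4 ya cx ce cy ch c.
    contracting_weights (lam_min p) (lam_max p) (L_f p) (1 + 2 / phi2 p) (omega p) (beta1 p) (eta p)
      th q ca pb p4 Q4 ya cx ce cy ch c (beta_bar p)"
proof -
  note prems = less_imp_le[OF beta_bar_pos]
    order_trans[OF beta_bar_le(1) margin_le(1), unfolded eps1t_raw eps2t_raw mult.commute[of _ "eta p"]]
  have rY: "beta_bar p * (1 / 2 + beta1 p) \<le> (3 * omega p - 1) / 4 - 3 / lam_min p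
      - eta p * ((omega p)\<^sup>2 * lam_max p + 1 / lam_min p + 4 * (1 + 2 / phi2 p) * (omega p)\<^sup>2 * lam_min p)"
    using order_trans[OF beta_bar_le(1) margin_le(2)] unfolding eps4_def eps5_raw by (simp add: mult.commute)
  show ?thesis
  proof (cases "1 + beta1 p \<le> 7 / 4 * (omega p + 3)")
    case True
    show ?thesis by (intro exI) (rule contracting_weights_moderate_b[OF True prems rY])
  next
    case False
    then have "7 / 4 * (omega p + 3) < 1 + beta1 p" by simp
    then show ?thesis by (intro exI) (rule contracting_weights_large_b[OF _ prems rY])
  qed
qed

lemma c1_check_eq: "c1_check p = 1 / 2 - 1 / (2 * beta1 p * lam_min p)"
  using omega_pos beta1_gt lam by (simp add: c1_check_def gamma_def field_simps)

lemma c1_check_pos: "0 < c1_check p"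
  unfolding c1_check_eq using b_lo beta1_gt lam by (simp add: field_simps)

text \<open>
  The noise constant is formed with \<open>beta3\<close>, a lower bound of \<open>\<omega>\<close>, and \<open>\<eta> * \<omega>\<^sup>2 = \<beta>\<^sub>2 * \<omega>\<close>.
\<close>

lemma c1_ge: "2 * (1 + beta1 p)\<^sup>2 * (L_f p)\<^sup>2 / (eta p * (omega p)\<^sup>2 * lam_min p)
      + (1 + beta1 p) * (L_f p)\<^sup>2 / ((omega p)\<^sup>2 * lam_min p)
      + (L_f p)\<^sup>2 / (eta p * (omega p)\<^sup>2 * (lam_min p)\<^sup>2) + (L_f p)\<^sup>2 / ((omega p)\<^sup>2 * (lam_min p)\<^sup>2) + L_f p \<le> c1 p"
proof -
  have eo: "eta p * (omega p)\<^sup>2 = beta2 p * omega p"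
    using omega_pos by (simp add: eta_def power2_eq_square)
  have le: "beta3 p \<le> omega p" using omega by simp
  have sq: "(beta3 p)\<^sup>2 \<le> (omega p)\<^sup>2" using le beta3_pos by (intro power_mono) auto
  have "2 * (1 + beta1 p)\<^sup>2 / (beta2 p * omega p * lam_min p) \<le> 2 * (1 + beta1 p)\<^sup>2 / (beta2 p * beta3 p * lam_min p)"
    using le beta3_pos beta2 lam omega_pos by (intro divide_left_mono mult_right_mono mult_left_mono mult_pos_pos) auto
  moreover have "(1 + beta1 p) / ((omega p)\<^sup>2 * lam_min p) \<le> (1 + beta1 p) / ((beta3 p)\<^sup>2 * lam_min p)"
    using sq beta3_pos lam omega_pos beta1_gt by (intro divide_left_mono mult_right_mono mult_pos_pos) auto
  moreover have "1 / (beta2 p * omega p * (lam_min p)\<^sup>2) \<le> 1 / (beta2 p * beta3 p * (lam_min p)\<^sup>2)"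
    using le beta3_pos beta2 lam omega_pos by (intro divide_left_mono mult_right_mono mult_left_mono mult_pos_pos) auto
  moreover have "1 / ((omega p)\<^sup>2 * (lam_min p)\<^sup>2) \<le> 1 / ((beta3 p)\<^sup>2 * (lam_min p)\<^sup>2)"
    using sq beta3_pos lam omega_pos by (intro divide_left_mono mult_right_mono mult_pos_pos) auto
  ultimately have "2 * (1 + beta1 p)\<^sup>2 / (beta2 p * omega p * lam_min p) + (1 + beta1 p) / ((omega p)\<^sup>2 * lam_min p)
      + 1 / (beta2 p * omega p * (lam_min p)\<^sup>2) + 1 / ((omega p)\<^sup>2 * (lam_min p)\<^sup>2)
    \<le> 2 * (1 + beta1 p)\<^sup>2 / (beta2 p * beta3 p * lam_min p) + (1 + beta1 p) / ((beta3 p)\<^sup>2 * lam_min p)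
      + 1 / (beta2 p * beta3 p * (lam_min p)\<^sup>2) + 1 / ((beta3 p)\<^sup>2 * (lam_min p)\<^sup>2) + 3 / 2"
    by linarith
  then have "(2 * (1 + beta1 p)\<^sup>2 / (beta2 p * omega p * lam_min p) + (1 + beta1 p) / ((omega p)\<^sup>2 * lam_min p)
      + 1 / (beta2 p * omega p * (lam_min p)\<^sup>2) + 1 / ((omega p)\<^sup>2 * (lam_min p)\<^sup>2)) * (L_f p)\<^sup>2 + L_f p \<le> c1 p"
    unfolding c1_def by (intro add_right_mono mult_right_mono) auto
  then show ?thesis unfolding eo by (simp add: distrib_right)
qed

lemma c1_pos: "0 < c1 p"
proof -
  have "0 \<le> 2 * (1 + beta1 p)\<^sup>2 * (L_f p)\<^sup>2 / (eta p * (omega p)\<^sup>2 * lam_min p)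
      + (1 + beta1 p) * (L_f p)\<^sup>2 / ((omega p)\<^sup>2 * lam_min p)
      + (L_f p)\<^sup>2 / (eta p * (omega p)\<^sup>2 * (lam_min p)\<^sup>2) + (L_f p)\<^sup>2 / ((omega p)\<^sup>2 * (lam_min p)\<^sup>2)"
    using eta_pos lam beta1_gt by (intro add_nonneg_nonneg) auto
  then show ?thesis using c1_ge Lf by linarith
qed

end

section \<open>Linear convergence\<close>

theorem theorem2:
  fixes E :: "('n::finite \<times> 'n) set" and W L :: "real^'n^'n"
    and lam :: "real^'m::finite" and R :: "real^'m^'n"
    and f :: "'n \<Rightarrow> real^'d::finite \<Rightarrow> real"
    and M :: "'w measure"
    and S :: "'n \<Rightarrow> 's measure" and \<xi> :: "'n \<Rightarrow> nat \<Rightarrow> 'w \<Rightarrow> 's"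
    and Q :: "'c measure" and \<zeta> :: "'n \<Rightarrow> nat \<Rightarrow> 'w \<Rightarrow> 'c"
    and g :: "'n \<Rightarrow> real^'d \<Rightarrow> 's \<Rightarrow> real^'d" and C :: "'c \<Rightarrow> real^'d \<Rightarrow> real^'d"
    and \<sigma> :: real and p :: params
    and x0 :: "real^'d^'n" and x xh xc v :: "'n \<Rightarrow> nat \<Rightarrow> 'w \<Rightarrow> real^'d"
  assumes graph: "weighted_graph E W" "connected_graph E"
    and L: "L = laplacian W" "laplacian_eigen_decomp L lam R"
    and smooth: "L_f p > 0" "\<And>i. L_smooth (L_f p) (f i)"
    and prob: "prob_space M"
    and samples_indep: "prob_space.indep_vars M (\<lambda>(i, k). S i) (\<lambda>(i, k). \<xi> i k) UNIV"
    and unbiased: "stochastic_gradients M S \<xi> f g"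
    and variance: "\<sigma> > 0" "variance_bounded M \<xi> f g \<sigma>"
    and bounded_below: "bdd_below (range (avg_obj f))"
    and PL: "nu p > 0" "polyak_lojasiewicz (nu p) (avg_obj f)"
    and compr: "0 < phi p" "phi p \<le> 1" "r_C p > 0" "compressor Q C (r_C p) (phi p)"
    and draws: "fresh_compressor_draws M S \<xi> Q \<zeta>"
    and network_params: "n_agents p = CARD('n)" "lam_max p = spec_radius L"
      "lam_min p = min_pos_eigenvalue L"
    and params: "beta5 p > 0" "beta1 p > c0 p" "beta2 p > 0" "omega p > beta3 p"
      "0 < alpha_x p" "alpha_x p < 1 / r_C p"
    and algorithm: "\<And>w. w \<in> space M \<Longrightarrow>
      cp_sgd L g C (\<lambda>k. eta p) (\<lambda>k. beta1 p * omega p) (\<lambda>k. omega p) (alpha_x p) x0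
        (\<lambda>i k. \<xi> i k w) (\<lambda>i k. \<zeta> i k w)
        (\<lambda>i k. x i k w) (\<lambda>i k. xh i k w) (\<lambda>i k. xc i k w) (\<lambda>i k. v i k w)"
  shows "(\<forall>k.
      (let xbar = (\<lambda>w. agent_mean (\<lambda>i. x i (k + 1) w));
           err = (\<lambda>w. (\<Sum>i\<in>UNIV. (norm (x i (k + 1) w - xbar w))\<^sup>2)
                   + real CARD('n) * (avg_obj f (xbar w) - Inf (range (avg_obj f))))
       in integrable M err \<and>
          (\<integral>w. err w \<partial>M) \<le>
            (1 - eta p * beta_bar p) ^ (k + 1) * V_lyap p (P_mat lam R) f x0 0 0 / c1_check p
            + c2_check p * \<sigma>\<^sup>2 * eta p / (beta_bar p * c1_check p)))
    \<and> 0 < eta p * beta_bar p \<and> eta p * beta_bar p \<le> 2 / 3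
    \<and> 0 < beta_bar p \<and> 0 < beta3 p \<and> 0 < c0 p \<and> 0 < c1_check p \<and> 0 < c2_check p
    \<and> 0 \<le> V_lyap p (P_mat lam R) f x0 0 0"
proof -
  interpret eigen_decomp L lam R by unfold_locales (rule L(2))
  have lb: "lam_min p \<le> lam $ k" "lam $ k \<le> lam_max p" for k
    unfolding network_params by (rule lam_ge_min lam_le_max)+
  interpret P: cp_sgd_params p
    using order_trans[OF lb] min_pos smooth(1) PL(1) compr params network_params(3)
    by unfold_locales simp_all
  obtain th q ca pb p4 Q4 ya cx ce cy ch c where
    cw: "contracting_weights (lam_min p) (lam_max p) (L_f p) (1 + 2 / phi2 p) (omega p) (beta1 p) (eta p)
      th q ca pb p4 Q4 ya cx ce cy ch c (beta_bar p)"
    using P.contracting_weights_exist by blast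
  have xi: "\<xi> i k \<in> M \<rightarrow>\<^sub>M S i" for i k
  proof -
    have "\<forall>j\<in>UNIV. (case j of (i, k) \<Rightarrow> \<xi> i k) \<in> M \<rightarrow>\<^sub>M (case j of (i, k) \<Rightarrow> S i)"
      using samples_indep unfolding prob_space.indep_vars_def[OF prob] by blast
    from bspec[OF this, of "(i, k)"] show ?thesis by simp
  qed
  have LS: "lyapunov_step L lam R (lam_min p) (lam_max p) (L_f p) (1 + 2 / phi2 p) (omega p) (beta1 p) (eta p)
      th q ca pb p4 Q4 ya cx ce cy ch c (beta_bar p) f (nu p) (phi2 p) (r0 p)"
  proof (intro lyapunov_step.intro eigen_decomp_axioms cw lyapunov_step_axioms.intro)
    show "beta_bar p \<le> nu p / 3" using P.beta_bar_le(2) P.margin_le(3) by linarith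
  qed (use lb smooth bounded_below PL P.phi2 P.r0_nonneg P.contraction_of_compression in auto)
  interpret X: cp_sgd_process L lam R "lam_min p" "lam_max p" "L_f p" "1 + 2 / phi2 p" "omega p" "beta1 p" "eta p"
      th q ca pb p4 Q4 ya cx ce cy ch c "beta_bar p" f "nu p" "phi2 p" "r0 p" M S \<xi> Q \<zeta>
      g C "r_C p" "phi p" "alpha_x p" \<sigma> x0 x xh xc v
    by (intro cp_sgd_process.intro LS fresh_draws.intro prob fresh_draws_axioms.intro xi draws
        cp_sgd_process_axioms.intro unbiased variance compr params P.ax_rC phi2_def r0_def algorithm)
  define V0 where "V0 = V_lyap p (P_mat lam R) f x0 0 0"
  define D where "D = X.disagreement x0"
  define W0 where "W0 = X.W x0 0 0"
  have D0: "0 \<le> D" by (simp add: D_def sum_nonneg)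
  have V0_eq: "V0 = 1 / 2 * D + (1 + beta1 p) / 2 * (X.dual_energy (X.dual x0 0) + (norm (mean_mode (X.dual x0 0)))\<^sup>2 / X.M0)
    + (\<Sum>k\<in>UNIV. (modal R x0 k \<bullet> modal R (X.dual x0 0) k) / lam $ k)
    + real CARD('n) * X.gap (agent_mean (($) x0)) + (norm (x0 - 0))\<^sup>2"
    unfolding V0_def V_lyap_def Let_def wnorm_sq_def
      inner_kron_spectral[OF spectral_K] inner_kron_spectral[OF spectral_P]
      modal_kron_spectral[OF spectral_P] X.mean_grads_def[symmetric] X.dual_def[symmetric] X.M0_def[symmetric]
    by (simp add: D_def X.gap_def power2_norm_eq_inner)
  have V0W0: "W0 \<le> V0 + (1 - th) / (2 * beta1 p * lam_min p) * D" "c1_check p * D \<le> V0"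
    using X.W_le_full_energy[of x0 0 0] unfolding V0_eq W0_def D_def P.c1_check_eq by simp_all
  have c1p: "0 < c1_check p" by (rule P.c1_check_pos)
  have V0_nonneg: "0 \<le> V0" using V0W0(2) c1p D0 by (meson less_imp_le mult_nonneg_nonneg order_trans)
  define del where "del = (1 - th) / (2 * beta1 p * lam_min p)"
  define kap where "kap = 1 / 2 - th / (2 * beta1 p * lam_min p)"
  have del: "0 \<le> del" using X.th P.b_pos P.lo_pos by (simp add: del_def)
  have kap: "kap = c1_check p + del"
    by (simp add: kap_def del_def P.c1_check_eq diff_divide_distrib)
  have kap_pos: "0 < kap" using kap c1p del by simp
  \<comment> \<open>The weighted function starts at most \<open>del * D\<close> above \<open>V0\<close>, but dominates the error with \<open>kap
    = c1_check p + del\<close> instead of \<open>c1_check p\<close>; since \<open>c1_check p * D \<le> V0\<close>, the two effects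
    compensate.\<close>
  have ratio: "W0 / kap \<le> V0 / c1_check p"
  proof -
    have "c1_check p * W0 \<le> c1_check p * (V0 + del * D)"
      using V0W0(1) c1p unfolding del_def by (intro mult_left_mono) auto
    also have "\<dots> = c1_check p * V0 + del * (c1_check p * D)" by (simp add: algebra_simps)
    also have "\<dots> \<le> c1_check p * V0 + del * V0" using V0W0(2) del by (intro add_left_mono mult_left_mono)
    also have "\<dots> = kap * V0" by (simp add: kap distrib_right)
    finally show ?thesis using c1p kap_pos by (simp add: divide_le_eq le_divide_eq mult_ac)
  qed
  have noise: "X.noise_const \<le> c2_check p"
  proof -
    have n: "1 \<le> real CARD('n)" by (simp add: Suc_leI)
    have s: "3 \<le> 1 + 2 / phi2 p" by (rule P.s_ge_3)
    have "X.KD * (L_f p)\<^sup>2 + L_f p \<le> c1 p + 1 / 8" using X.noise P.c1_ge by linarith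
    moreover have "1 + 2 / phi2 p + 1 / 8 + real CARD('n) * X.cz \<le> real CARD('n) * eps9 p"
    proof -
      have l1: "real CARD('n) * X.cz \<le> real CARD('n) * (1 + 2 / phi2 p + 5 / 8)"
        using X.cz_le by (intro mult_left_mono) auto
      have l2: "1 * (1 + 2 / phi2 p + 1 / 8) \<le> real CARD('n) * (1 + 2 / phi2 p + 1 / 8)"
        using n s by (intro mult_right_mono) auto
      have l3: "real CARD('n) * (1 + 2 / phi2 p + 1 / 8) + real CARD('n) * (1 + 2 / phi2 p + 5 / 8) \<le> real CARD('n) * eps9 p"
        unfolding distrib_left[symmetric] using s by (intro mult_left_mono) (auto simp: eps9_def)
      show ?thesis using order_trans[OF add_mono[OF l2 l1] l3] by (simp only: mult_1_left)
    qed
    ultimately show ?thesis by (simp add: X.noise_const_def c2_check_def network_params(1))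
  qed
  have c2p: "0 < c2_check p"
  proof -
    have "0 \<le> eps9 p" using P.phi2 by (simp add: eps9_def)
    then show ?thesis using P.c1_pos by (simp add: c2_check_def add_pos_nonneg)
  qed
  have main: "integrable M (\<lambda>w. (\<Sum>i\<in>UNIV. (norm (x i k w - agent_mean (\<lambda>i. x i k w)))\<^sup>2)
        + real CARD('n) * (avg_obj f (agent_mean (\<lambda>i. x i k w)) - Inf (range (avg_obj f))))"
    (is "integrable M ?err")
    and bound: "(\<integral>w. (\<Sum>i\<in>UNIV. (norm (x i k w - agent_mean (\<lambda>i. x i k w)))\<^sup>2)
        + real CARD('n) * (avg_obj f (agent_mean (\<lambda>i. x i k w)) - Inf (range (avg_obj f))) \<partial>M)
      \<le> (1 - eta p * beta_bar p) ^ k * V0 / c1_check p + c2_check p * \<sigma>\<^sup>2 * eta p / (beta_bar p * c1_check p)" for k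
  proof -
    show "integrable M ?err" by (rule X.error_bound(1)[OF P.beta_bar_pos])
    define t where "t = (1 - eta p * beta_bar p) ^ k"
    have t: "0 \<le> t" using X.eta_rate_less_1 by (simp add: t_def)
    define N where "N = eta p * X.noise_const * \<sigma>\<^sup>2 / beta_bar p"
    have N0: "0 \<le> N" using P.eta_pos X.noise_const_nonneg P.beta_bar_pos by (simp add: N_def)
    have "kap * (\<integral>w. ?err w \<partial>M) \<le> t * W0 + N"
      using X.error_bound(2)[OF P.beta_bar_pos, of k] by (simp add: kap_def t_def W0_def N_def)
    then have "(\<integral>w. ?err w \<partial>M) \<le> t * (W0 / kap) + N / kap"
      using kap_pos by (simp add: field_simps)
    also have "\<dots> \<le> t * (V0 / c1_check p) + N / c1_check p"
      using t ratio N0 c1p kap del by (intro add_mono mult_left_mono divide_left_mono) auto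
    also have "N / c1_check p \<le> c2_check p * \<sigma>\<^sup>2 * eta p / (beta_bar p * c1_check p)"
    proof -
      have "eta p * X.noise_const * \<sigma>\<^sup>2 \<le> eta p * c2_check p * \<sigma>\<^sup>2"
        using noise P.eta_pos by (intro mult_right_mono mult_left_mono) auto
      then have "eta p * X.noise_const * \<sigma>\<^sup>2 / (beta_bar p * c1_check p) \<le> eta p * c2_check p * \<sigma>\<^sup>2 / (beta_bar p * c1_check p)"
        using P.beta_bar_pos c1p by (intro divide_right_mono) auto
      then show ?thesis by (simp add: N_def mult_ac)
    qed
    finally show "(\<integral>w. ?err w \<partial>M) \<le> (1 - eta p * beta_bar p) ^ k * V0 / c1_check p
        + c2_check p * \<sigma>\<^sup>2 * eta p / (beta_bar p * c1_check p)"
      by (simp add: t_def)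
  qed
  show ?thesis
    unfolding Let_def V0_def[symmetric]
    by (intro conjI allI main bound P.eta_beta_bar_le P.beta_bar_pos P.beta3_pos P.c0_pos c1p c2p V0_nonneg
        mult_pos_pos P.eta_pos)
qed

end
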